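(* Let $v\le w$ in $S_n$ (Bruhat order). The following are equivalent: (a) The interval poset $\mathrm{Int}[v,w]$ of subintervals of $[v,w]$ is (isomorphic to) the face lattice of a polytope. (b) The Bruhat interval $[v,w]$ does not have any 2-crowns. (c) The Bruhat interval $[v,w]$ is a lattice.
   Context: $[v,w]=\{u\in S_n : v\le u\le w\}$ with the induced Bruhat order. $\mathrm{Int}[v,w]$ is the poset consisting of $\emptyset$ and all subintervals $[v',w']$ with $v\le v'\le w'\le w$, ordered by containment. A 2-crown in $[v,w]$ is a subinterval $[v',w']\subset[v,w]$ isomorphic as a poset to $S_3$ with the Bruhat order (a graded poset of rank 3 with two elements in rank 1, two in rank 2, each rank-1 element lying below each rank-2 element). *)

theory Defs
  imports
    "HOL-Analysis.Polytope"
    "HOL-Analysis.Finite_Function_Topology"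
    "HOL-Combinatorics.Permutations"
    "HOL-Algebra.Lattice"
begin

definition poset_iso :: "'a gorder \<Rightarrow> 'b gorder \<Rightarrow> bool" where
  "poset_iso A B \<longleftrightarrow> (\<exists>f. order_emb A B f \<and> bij_betw f (carrier A) (carrier B))"

definition inclusion_poset :: "'a set set \<Rightarrow> 'a set gorder" where
  "inclusion_poset \<A> = \<lparr>carrier = \<A>, eq = (=), le = (\<subseteq>)\<rparr>"

section \<open>Bruhat order on the symmetric group\<close>

text \<open>The symmetric group on \<open>n\<close> letters consists of the functions on \<open>nat\<close> that permute
  \<open>{1..n}\<close>. Coxeter length is the number of inversions.\<close>

definition perm_length :: "nat \<Rightarrow> (nat \<Rightarrow> nat) \<Rightarrow> nat" where
  "perm_length n p = card {(i, j). 1 \<le> i \<and> i < j \<and> j \<le> n \<and> p j < p i}"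

text \<open>The qualified name avoids the matrix transpose of \<open>HOL-Analysis\<close>.\<close>

definition bruhat_step :: "nat \<Rightarrow> (nat \<Rightarrow> nat) \<Rightarrow> (nat \<Rightarrow> nat) \<Rightarrow> bool" where
  "bruhat_step n u w \<longleftrightarrow>
     (\<exists>i j. 1 \<le> i \<and> i < j \<and> j \<le> n \<and> w = u \<circ> Transposition.transpose i j) \<and>
     perm_length n u < perm_length n w"

definition bruhat :: "nat \<Rightarrow> (nat \<Rightarrow> nat) gorder" where
  "bruhat n = \<lparr>carrier = {p. p permutes {1..n}}, eq = (=), le = (bruhat_step n)\<^sup>*\<^sup>*\<rparr>"

text \<open>The set underlying the interval from \<open>v\<close> to \<open>w\<close> is \<open>\<lbrace>v..w\<rbrace>\<^bsub>bruhat n\<^esub>\<close>.\<close>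

definition bruhat_interval :: "nat \<Rightarrow> (nat \<Rightarrow> nat) \<Rightarrow> (nat \<Rightarrow> nat) \<Rightarrow> (nat \<Rightarrow> nat) gorder" where
  "bruhat_interval n v w = (bruhat n)\<lparr>carrier := \<lbrace>v..w\<rbrace>\<^bsub>bruhat n\<^esub>\<rparr>"

definition Int_poset :: "nat \<Rightarrow> (nat \<Rightarrow> nat) \<Rightarrow> (nat \<Rightarrow> nat) \<Rightarrow> (nat \<Rightarrow> nat) set gorder" where
  "Int_poset n v w = inclusion_poset
     (insert {} {\<lbrace>x..y\<rbrace>\<^bsub>bruhat n\<^esub> | x y.
        x \<in> \<lbrace>v..w\<rbrace>\<^bsub>bruhat n\<^esub> \<and> y \<in> \<lbrace>v..w\<rbrace>\<^bsub>bruhat n\<^esub> \<and> x \<sqsubseteq>\<^bsub>bruhat n\<^esub> y})"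

text \<open>The containment in a 2-crown is not strict: the interval itself may be one.\<close>

definition has_two_crown :: "nat \<Rightarrow> (nat \<Rightarrow> nat) \<Rightarrow> (nat \<Rightarrow> nat) \<Rightarrow> bool" where
  "has_two_crown n v w \<longleftrightarrow>
     (\<exists>x y. x \<in> \<lbrace>v..w\<rbrace>\<^bsub>bruhat n\<^esub> \<and> y \<in> \<lbrace>v..w\<rbrace>\<^bsub>bruhat n\<^esub> \<and> x \<sqsubseteq>\<^bsub>bruhat n\<^esub> y \<and>
        poset_iso (bruhat_interval n x y) (bruhat 3))"

section \<open>Face lattices of polytopes\<close>

definition face_lattice :: "'a::real_vector set \<Rightarrow> 'a set gorder" where
  "face_lattice P = inclusion_poset {F. F face_of P}"

text \<open>The dimension of the ambient space is not fixed in advance, so the spaces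
  \<open>\<real>\<^sup>d\<close> for varying \<open>d\<close> are realised inside the real vector space of finitely
  supported sequences, as the vectors supported on the first \<open>d\<close> coordinates. Here
  \<open>F face_of P\<close> includes the improper faces \<open>{}\<close> and \<open>P\<close>.\<close>

definition is_polytope_face_lattice :: "'a gorder \<Rightarrow> bool" where
  "is_polytope_face_lattice L \<longleftrightarrow>
     (\<exists>d (P :: (nat \<Rightarrow>\<^sub>0 real) set).
        polytope P \<and> (\<forall>x\<in>P. Poly_Mapping.keys x \<subseteq> {..<d}) \<and>
        poset_iso L (face_lattice P))"

end

theory Submission
  imports Defs "HOL-Computational_Algebra.Polynomial"
begin

text \<open>The implications towards the lattice property and towards the absence of crowns are short. The
meet of \<open>[a, w]\<close> and \<open>[b, w]\<close> in the interval poset, which exists in a face lattice because the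
intersection of two faces is a face, is the interval from the join of \<open>a\<close> and \<open>b\<close> to \<open>w\<close>; meets
are obtained from the intervals \<open>[v, a]\<close> and \<open>[v, b]\<close> (\<open>polytopal_lattice\<close>). A crown has two
atoms below the same two coatoms and nothing in between, so its atoms have no join
(\<open>lattice_no_crown\<close>).

For the converse a polytope has to be constructed from a crown-free interval. The convex hull of
the permutations themselves is too small in general: it has dimension at most \<open>n - 1\<close>, whereas
the dimension of the polytope has to be the length of the interval. What is kept of it are the
relations of its smallest pieces. In every interval of length two, with elements
\<open>x < p, q < y\<close>, the four vectors \<open>(u(1), \<dots>, u(n))\<close> satisfy an affine relation
\<open>\<alpha> x + \<delta> y = \<beta> p + \<gamma> q\<close> with positive coefficients and \<open>\<alpha> + \<delta> = \<beta> + \<gamma>\<close>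
(\<open>square_ex\<close>). A real function on the interval is called harmonic if its values satisfy the
relations of all these diamonds. The polytope is the convex hull of the points whose coordinates
are the values of finitely many harmonic functions.

Harmonic functions are plentiful: if \<open>a\<close> covers \<open>v\<close>, a harmonic function on \<open>[a, w]\<close> and a value
at \<open>v\<close> determine a harmonic function on \<open>[v, w]\<close> (\<open>harm_determined\<close>, \<open>harm_extend\<close>).
Uniqueness holds because the atoms of an interval are linked by diamonds. Existence requires a
consistency check around every interval of length three, and this is where crowns matter: if
three consecutive covers do not form a chain of a crown, then affine functions of
\<open>(u(1), \<dots>, u(n))\<close> take arbitrary values on their four elements (\<open>LIN_chain\<close>), so that on
intervals of length three all prescriptions are realised by actual affine functions. The order
in which atoms are treated comes from the lexicographic labelling of covers by the transposed
positions, for which increasing chains are unique (\<open>increasing_chain_unique\<close>).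

Extending the zero function on \<open>[a, w]\<close> by the value \<open>-1\<close> at \<open>v\<close> gives a facet function. It is
negative at every element that is not above \<open>a\<close> (\<open>upper_facet_neg\<close>). This convexity statement
follows from the fact that a harmonic function has only one strict local minimum in the Hasse diagram of
an interval (\<open>local_min_unique\<close>), which is proved by passing from intervals to the vertex figures
of their lower ends (\<open>sublevel_connected\<close>). The induction ends at intervals of length three.
They have at most four atoms when there are no crowns (\<open>few_atoms\<close>), so their vertex figures
are triangles and quadrangles, for which the claim is verified by hand
(\<open>four_cycle_convex\<close>).

Finally the facet functions and their order duals describe the convex hull completely
(\<open>in_hull_if_within_facets\<close>), and its faces are exactly the hulls of the subintervals
(\<open>interval_lattice_polytopal\<close>).\<close>

section \<open>Harmonic functions on labelled posets\<close>

lemma rtranclp_swap: "(\<lambda>x y. r y x)\<^sup>*\<^sup>* x y \<longleftrightarrow> r\<^sup>*\<^sup>* y x"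
  using rtranclp_conversep[of r] by (simp add: conversep.simps fun_eq_iff conversep_iff[abs_def])

text \<open>The first element \<open>a\<close> after the start is an argument, so that uniqueness of increasing chains can
be expressed through their first steps alone.\<close>

inductive increasing_chain :: "('a \<Rightarrow> 'a \<Rightarrow> bool) \<Rightarrow> ('a \<Rightarrow> 'a \<Rightarrow> nat) \<Rightarrow> 'a \<Rightarrow> 'a \<Rightarrow> 'a \<Rightarrow> bool"
  for cov lab where
  last: "cov x u \<Longrightarrow> increasing_chain cov lab x u u"
| step: "cov x a \<Longrightarrow> increasing_chain cov lab a c u \<Longrightarrow> lab x a \<le> lab a c \<Longrightarrow> increasing_chain cov lab x a u"

text \<open>A finite graded poset whose intervals of length two are diamonds \<open>x < p, q < y\<close>. Each diamond
carries an affine relation, with coefficients \<open>wb\<close> at its bottom, \<open>wt\<close> at its top and \<open>wm\<close> at its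
middle elements. The functions in \<open>lin\<close> satisfy all these relations and are numerous enough to
prescribe their values along three consecutive covers. The labels of the covers order the atoms
of every interval: by \<open>lab_diamond\<close> a step to the smaller middle element of a diamond is not
followed by a descent, and by \<open>increasing_unique\<close> every chain of increasing labels begins with
the smallest atom.\<close>

locale labelled_poset =
  fixes S :: "'a set"
    and cov :: "'a \<Rightarrow> 'a \<Rightarrow> bool" (infix \<open>\<lessdot>\<close> 50)
    and rk :: "'a \<Rightarrow> int"
    and wb wt :: "'a \<Rightarrow> 'a \<Rightarrow> real"
    and wm :: "'a \<Rightarrow> 'a \<Rightarrow> 'a \<Rightarrow> real"
    and lin :: "('a \<Rightarrow> real) set"
    and lab :: "'a \<Rightarrow> 'a \<Rightarrow> nat"
  assumes finite_S: "finite S"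
    and cov_S: "x \<lessdot> y \<Longrightarrow> x \<in> S \<and> y \<in> S"
    and cov_rk: "x \<lessdot> y \<Longrightarrow> rk y = rk x + 1"
    and thin: "x \<lessdot> p \<Longrightarrow> p \<lessdot> y \<Longrightarrow> \<exists>q. q \<noteq> p \<and> x \<lessdot> q \<and> q \<lessdot> y \<and> (\<forall>m. x \<lessdot> m \<and> m \<lessdot> y \<longrightarrow> m = p \<or> m = q)"
    and weights: "x \<lessdot> p \<Longrightarrow> p \<lessdot> y \<Longrightarrow> x \<lessdot> q \<Longrightarrow> q \<lessdot> y \<Longrightarrow> p \<noteq> q \<Longrightarrow>
        0 < wb x y \<and> 0 < wt x y \<and> 0 < wm x p y \<and> wb x y + wt x y = wm x p y + wm x q y"
    and lin_balanced: "F \<in> lin \<Longrightarrow> x \<lessdot> p \<Longrightarrow> p \<lessdot> y \<Longrightarrow> x \<lessdot> q \<Longrightarrow> q \<lessdot> y \<Longrightarrow> p \<noteq> q \<Longrightarrow>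
        wb x y * F x + wt x y * F y = wm x p y * F p + wm x q y * F q"
    and lin_chain: "x \<lessdot> a \<Longrightarrow> a \<lessdot> c \<Longrightarrow> c \<lessdot> d \<Longrightarrow> \<exists>F\<in>lin. F x = r0 \<and> F a = r1 \<and> F c = r2 \<and> F d = r3"
    and lab_inj: "x \<lessdot> a \<Longrightarrow> x \<lessdot> b \<Longrightarrow> lab x a = lab x b \<Longrightarrow> a = b"
    and lab_diamond: "x \<lessdot> p \<Longrightarrow> p \<lessdot> y \<Longrightarrow> x \<lessdot> q \<Longrightarrow> q \<lessdot> y \<Longrightarrow> p \<noteq> q \<Longrightarrow> lab x q < lab x p \<longleftrightarrow> lab p y < lab x p"
    and increasing_unique: "increasing_chain cov lab x a u \<Longrightarrow> increasing_chain cov lab x b u \<Longrightarrow> a = b"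
begin

abbreviation le (infix \<open>\<preceq>\<close> 50) where "x \<preceq> y \<equiv> cov\<^sup>*\<^sup>* x y"

definition diamond where
  "diamond x p q y \<longleftrightarrow> x \<lessdot> p \<and> p \<lessdot> y \<and> x \<lessdot> q \<and> q \<lessdot> y \<and> p \<noteq> q"

definition balanced :: "('a \<Rightarrow> real) \<Rightarrow> 'a \<Rightarrow> 'a \<Rightarrow> 'a \<Rightarrow> 'a \<Rightarrow> bool" where
  "balanced F x p q y \<longleftrightarrow> wb x y * F x + wt x y * F y = wm x p y * F p + wm x q y * F q"

text \<open>Harmonic functions are the functions that become affine once the elements of the interval are
the vertices of the polytope to be constructed.\<close>

definition harm :: "('a \<Rightarrow> real) \<Rightarrow> 'a \<Rightarrow> 'a \<Rightarrow> bool" where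
  "harm F v w \<longleftrightarrow> (\<forall>x p q y. v \<preceq> x \<and> y \<preceq> w \<and> diamond x p q y \<longrightarrow> balanced F x p q y)"

text \<open>This is the graph of the vertex figure of \<open>[v, w]\<close> at \<open>v\<close>: a diamond above \<open>v\<close> is a face of
dimension two with vertex \<open>v\<close>.\<close>

definition adj where
  "adj v w a b \<longleftrightarrow> (\<exists>c. diamond v a b c \<and> c \<preceq> w)"

lemma le_rk: "x \<preceq> y \<Longrightarrow> rk x \<le> rk y"
  by (induction rule: rtranclp_induct) (auto dest: cov_rk)

lemma le_rk_eq: "x \<preceq> y \<Longrightarrow> rk y \<le> rk x \<Longrightarrow> x = y"
proof (induction rule: converse_rtranclp_induct)
  case (step y z) then show ?case using cov_rk[of y z] le_rk[of z] by auto
qed auto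

lemma le_antisym: "x \<preceq> y \<Longrightarrow> y \<preceq> x \<Longrightarrow> x = y"
  using le_rk le_rk_eq by blast

lemma le_S: "x \<preceq> y \<Longrightarrow> y \<in> S \<Longrightarrow> x \<in> S"
  by (induction rule: converse_rtranclp_induct) (auto dest: cov_S)

lemma le_first: "x \<preceq> y \<Longrightarrow> x \<noteq> y \<Longrightarrow> \<exists>a. x \<lessdot> a \<and> a \<preceq> y"
  by (erule converse_rtranclpE) auto

lemma le_last: "x \<preceq> y \<Longrightarrow> x \<noteq> y \<Longrightarrow> \<exists>b. x \<preceq> b \<and> b \<lessdot> y"
  by (erule rtranclp.cases) auto

lemma cov_le: "x \<lessdot> y \<Longrightarrow> x \<preceq> y" by auto

lemma le_trans: "x \<preceq> y \<Longrightarrow> y \<preceq> z \<Longrightarrow> x \<preceq> z" by auto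

lemma cov_le_trans: "x \<lessdot> y \<Longrightarrow> y \<preceq> z \<Longrightarrow> x \<preceq> z" by (rule converse_rtranclp_into_rtranclp)

lemma le_cov_trans: "x \<preceq> y \<Longrightarrow> y \<lessdot> z \<Longrightarrow> x \<preceq> z" by (rule rtranclp.rtrancl_into_rtrancl)

lemma not_cov_le: "x \<lessdot> y \<Longrightarrow> \<not> y \<preceq> x"
  using cov_rk le_rk by force

lemma cov_of_rk: "x \<preceq> y \<Longrightarrow> rk y = rk x + 1 \<Longrightarrow> x \<lessdot> y"
  by (metis cov_rk le_first le_rk_eq order_refl less_irrefl zless_add1_eq)

lemma diamond_sym: "diamond x p q y \<Longrightarrow> diamond x q p y"
  by (auto simp: diamond_def)

lemma diamond_rk: "diamond x p q y \<Longrightarrow> rk p = rk x + 1 \<and> rk q = rk x + 1 \<and> rk y = rk x + 2"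
  unfolding diamond_def using cov_rk[of x p] cov_rk[of x q] cov_rk[of p y] by auto

lemma diamond_ex: "x \<lessdot> p \<Longrightarrow> p \<lessdot> y \<Longrightarrow> \<exists>q. diamond x p q y"
  using thin unfolding diamond_def by metis

lemma diamond_unique: "diamond x p q y \<Longrightarrow> diamond x p q' y \<Longrightarrow> q = q'"
  using thin[of x p y] unfolding diamond_def by metis

lemma diamond_mid: "diamond x p q y \<Longrightarrow> x \<lessdot> m \<Longrightarrow> m \<lessdot> y \<Longrightarrow> m = p \<or> m = q"
  using thin[of x p y] unfolding diamond_def by metis

lemma diamond_le: "diamond x p q y \<Longrightarrow> x \<lessdot> p \<and> p \<lessdot> y \<and> x \<lessdot> q \<and> q \<lessdot> y \<and> x \<preceq> y"
  unfolding diamond_def by (meson cov_le cov_le_trans)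

lemma diamond_weights:
  "diamond x p q y \<Longrightarrow> 0 < wb x y \<and> 0 < wt x y \<and> 0 < wm x p y \<and> 0 < wm x q y \<and> wb x y + wt x y = wm x p y + wm x q y"
  using weights[of x p y q] weights[of x q y p] unfolding diamond_def by auto

lemma diamond_lab: "diamond x p q y \<Longrightarrow> lab x q < lab x p \<longleftrightarrow> lab p y < lab x p"
  using lab_diamond unfolding diamond_def by blast

lemma balanced_sym: "balanced F x p q y \<Longrightarrow> balanced F x q p y"
  by (auto simp: balanced_def)

lemma balanced_cong:
  "F x = F' x \<Longrightarrow> F p = F' p \<Longrightarrow> F q = F' q \<Longrightarrow> F y = F' y \<Longrightarrow> balanced F x p q y \<longleftrightarrow> balanced F' x p q y"
  by (simp add: balanced_def)

lemma balanced_mid: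
  assumes "diamond x p q y" "balanced F x p q y" "balanced F' x p q y" "F x = F' x" "F p = F' p" "F y = F' y"
  shows "F q = F' q"
proof -
  have "wm x q y * F q = wm x q y * F' q" using assms(2-) unfolding balanced_def by auto
  then show ?thesis using diamond_weights[OF assms(1)] by auto
qed

lemma harm_balanced: "harm F v w \<Longrightarrow> diamond x p q y \<Longrightarrow> v \<preceq> x \<Longrightarrow> y \<preceq> w \<Longrightarrow> balanced F x p q y"
  unfolding harm_def by blast

lemma harm_mono: "harm F v w \<Longrightarrow> v \<preceq> v' \<Longrightarrow> w' \<preceq> w \<Longrightarrow> harm F v' w'"
  unfolding harm_def by (meson le_trans)

lemma lin_harm: "F \<in> lin \<Longrightarrow> harm F v w"
  unfolding harm_def balanced_def diamond_def using lin_balanced by blast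

lemma harm_cong_imp:
  assumes eq: "\<And>u. v \<preceq> u \<Longrightarrow> u \<preceq> w \<Longrightarrow> F u = F' u" and h: "harm F v w"
  shows "harm F' v w"
  unfolding harm_def
proof (intro allI impI)
  fix x p q y assume a: "v \<preceq> x \<and> y \<preceq> w \<and> diamond x p q y"
  then have d: "diamond x p q y" by blast
  note dl = diamond_le[OF d]
  have "v \<preceq> p" "v \<preceq> q" using a dl by (blast intro: le_cov_trans)+
  moreover have "p \<preceq> w" "q \<preceq> w" using a dl by (blast intro: cov_le_trans)+
  moreover have "v \<preceq> y" "x \<preceq> w" using a dl le_trans by blast+
  ultimately have "F x = F' x" "F p = F' p" "F q = F' q" "F y = F' y" using eq a by auto
  then show "balanced F' x p q y"
    using harm_balanced[OF h d] a balanced_cong by blast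
qed

lemma harm_cong: "(\<And>u. v \<preceq> u \<Longrightarrow> u \<preceq> w \<Longrightarrow> F u = F' u) \<Longrightarrow> harm F v w \<longleftrightarrow> harm F' v w"
  using harm_cong_imp[of v w F F'] harm_cong_imp[of v w F' F] by metis

lemma harm_const: "harm (\<lambda>_. k) v w"
  unfolding harm_def balanced_def using diamond_weights by (metis distrib_right)

lemma balanced_add: "balanced F x p q y \<Longrightarrow> balanced F' x p q y \<Longrightarrow> balanced (\<lambda>u. F u + F' u) x p q y"
  unfolding balanced_def by (simp add: distrib_left)

lemma balanced_scale:
  assumes "balanced F x p q y" shows "balanced (\<lambda>u. k * F u) x p q y"
proof -
  have "wb x y * (k * F x) + wt x y * (k * F y) = k * (wb x y * F x + wt x y * F y)" by (simp add: algebra_simps)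
  also have "\<dots> = k * (wm x p y * F p + wm x q y * F q)" using assms unfolding balanced_def by simp
  finally show ?thesis unfolding balanced_def by (simp add: algebra_simps)
qed

lemma harm_add: "harm F v w \<Longrightarrow> harm F' v w \<Longrightarrow> harm (\<lambda>u. F u + F' u) v w"
  unfolding harm_def using balanced_add by blast

lemma harm_scale: "harm F v w \<Longrightarrow> harm (\<lambda>u. k * F u) v w"
  unfolding harm_def using balanced_scale by blast

lemma harm_diff: "harm F v w \<Longrightarrow> harm F' v w \<Longrightarrow> harm (\<lambda>u. F u - F' u) v w"
  using harm_add[of F v w "\<lambda>u. - 1 * F' u"] harm_scale[of F' v w "-1"] by simp

lemma adj_sym: "adj v w a b \<Longrightarrow> adj v w b a"
  unfolding adj_def using diamond_sym by blast

abbreviation increasing where "increasing \<equiv> increasing_chain cov lab"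

lemma increasing_first: "increasing x a u \<Longrightarrow> x \<lessdot> a \<and> a \<preceq> u"
proof (induction rule: increasing_chain.induct)
  case (step x a c u)
  then show ?case using cov_le_trans[of a c u] by simp
qed simp

text \<open>Choosing the smallest label in every step yields an increasing chain: if a step were followed by
one with a smaller label, then \<open>lab_diamond\<close> would supply an atom with a smaller label for the
first of the two.\<close>

lemma increasing_ex:
  assumes "x \<preceq> u" "x \<noteq> u"
  shows "\<exists>a. increasing x a u \<and> (\<forall>b. x \<lessdot> b \<and> b \<preceq> u \<longrightarrow> lab x a \<le> lab x b)"
  using assms
proof (induction "nat (rk u - rk x)" arbitrary: x rule: less_induct)
  case less
  obtain a0 where a0: "x \<lessdot> a0 \<and> a0 \<preceq> u" using le_first less.prems by blast
  obtain a where a: "x \<lessdot> a" "a \<preceq> u" and min: "\<And>b. x \<lessdot> b \<and> b \<preceq> u \<Longrightarrow> lab x a \<le> lab x b"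
    using ex_has_least_nat[of "\<lambda>b. x \<lessdot> b \<and> b \<preceq> u" a0 "lab x"] a0 by blast
  show ?case
  proof (cases "a = u")
    case True
    then have "increasing x a u" using a increasing_chain.last[of cov x u lab] by simp
    then show ?thesis using min by blast
  next
    case False
    have "nat (rk u - rk a) < nat (rk u - rk x)" using cov_rk[OF a(1)] le_rk[OF a(2)] by linarith
    then obtain c where c: "increasing a c u" using less.hyps[of a] a False by blast
    have c': "a \<lessdot> c" "c \<preceq> u" using increasing_first[OF c] by auto
    obtain b where b: "diamond x a b c" using diamond_ex a c' by blast
    have "lab x a \<le> lab x b" using min diamond_le[OF b] c' by (meson cov_le_trans)
    then have "lab x a \<le> lab a c" using diamond_lab[OF b] by simp
    then have "increasing x a u" using increasing_chain.step[of cov x a lab c u, OF a(1) c] by blast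
    then show ?thesis using min by blast
  qed
qed

text \<open>The chain from \<open>x\<close> through \<open>a\<close> that continues increasingly cannot be increasing itself, because
the increasing chain starts at an atom with the smallest label. So it has a descent at \<open>a\<close>, and
the diamond at this descent contains an atom with a smaller label.\<close>

lemma descend:
  assumes "x \<lessdot> a" "a \<preceq> u" "x \<lessdot> b" "b \<preceq> u" "lab x b < lab x a"
  shows "\<exists>b' c. diamond x a b' c \<and> c \<preceq> u \<and> lab x b' < lab x a"
proof -
  have "a \<noteq> u" using assms cov_rk le_rk_eq by (metis less_irrefl order_refl)
  then obtain c where c: "increasing a c u" using increasing_ex assms(2) by blast
  have c': "a \<lessdot> c" "c \<preceq> u" using increasing_first[OF c] by auto
  obtain b' where b': "diamond x a b' c" using diamond_ex assms c' by blast
  show ?thesis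
  proof (cases "lab a c < lab x a")
    case True
    then show ?thesis using b' c' diamond_lab by blast
  next
    case False
    then have inc: "increasing x a u" using increasing_chain.step[of cov x a lab c u, OF assms(1) c] by simp
    obtain a0 where "increasing x a0 u" "\<forall>b. x \<lessdot> b \<and> b \<preceq> u \<longrightarrow> lab x a0 \<le> lab x b"
      using increasing_ex[of x u] assms not_cov_le by (metis cov_le_trans)
    then show ?thesis using increasing_unique[OF inc] assms by (metis not_le)
  qed
qed

text \<open>Repeated descents lead from every atom to the atom with the smallest label, and diamonds can be
crossed in both directions.\<close>

lemma atoms_connected_propagate:
  assumes a: "v \<lessdot> a" "a \<preceq> w" and b: "v \<lessdot> b" "b \<preceq> w" and "P a"
    and step: "\<And>p q c. diamond v p q c \<Longrightarrow> c \<preceq> w \<Longrightarrow> P p \<Longrightarrow> P q"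
  shows "P b"
proof -
  obtain a0 where a0: "v \<lessdot> a0" "a0 \<preceq> w" and min: "\<And>b. v \<lessdot> b \<and> b \<preceq> w \<Longrightarrow> lab v a0 \<le> lab v b"
    using ex_has_least_nat[of "\<lambda>b. v \<lessdot> b \<and> b \<preceq> w" a "lab v"] a by blast
  have main: "P a0 \<longleftrightarrow> P p" if "v \<lessdot> p" "p \<preceq> w" for p
    using that
  proof (induction "lab v p" arbitrary: p rule: less_induct)
    case less
    show ?case
    proof (cases "p = a0")
      case False
      then have "lab v a0 < lab v p" using min[of p] less.prems lab_inj[of v p a0] a0 by fastforce
      then obtain q c where q: "diamond v p q c" "c \<preceq> w" "lab v q < lab v p"
        using descend[OF less.prems a0] by blast
      then have "v \<lessdot> q" "q \<preceq> w" using diamond_le[OF q(1)] by (auto intro: cov_le_trans)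
      then have "P a0 \<longleftrightarrow> P q" using less.hyps q by blast
      then show ?thesis using step q diamond_sym by blast
    qed auto
  qed
  show ?thesis using main[OF a] main[OF b] \<open>P a\<close> by blast
qed

lemma atoms_connected:
  assumes "v \<lessdot> a" "a \<preceq> w" "v \<lessdot> b" "b \<preceq> w"
  shows "(adj v w)\<^sup>*\<^sup>* a b"
  by (rule atoms_connected_propagate[OF assms]) (auto simp: adj_def intro: rtranclp.rtrancl_into_rtrancl)

text \<open>The relation of a diamond determines the value at one middle element from the other three
values. Therefore agreement on \<open>[a, w]\<close> and at \<open>v\<close> passes to \<open>[b, w]\<close> for every atom \<open>b\<close> that is
adjacent to \<open>a\<close>, by induction on the length, and so on to all atoms.\<close>

lemma harm_determined:
  assumes "v \<lessdot> a" "a \<preceq> w" "harm F v w" "harm F' v w" "F v = F' v"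
    and "\<And>u. a \<preceq> u \<Longrightarrow> u \<preceq> w \<Longrightarrow> F u = F' u" and "v \<preceq> u" "u \<preceq> w"
  shows "F u = F' u"
  using assms
proof (induction "nat (rk w - rk v)" arbitrary: v a u rule: less_induct)
  case less
  have *: "\<forall>u. b \<preceq> u \<and> u \<preceq> w \<longrightarrow> F u = F' u" if "v \<lessdot> b" "b \<preceq> w" for b
  proof (rule atoms_connected_propagate[OF less.prems(1,2) that])
    show "\<forall>u. a \<preceq> u \<and> u \<preceq> w \<longrightarrow> F u = F' u" using less.prems(6) by blast
  next
    fix p q c assume d: "diamond v p q c" and c: "c \<preceq> w" and P: "\<forall>u. p \<preceq> u \<and> u \<preceq> w \<longrightarrow> F u = F' u"
    note dl = diamond_le[OF d]
    have q: "F q = F' q"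
      using balanced_mid[OF d harm_balanced[OF less.prems(3) d] harm_balanced[OF less.prems(4) d]]
        less.prems(5) P c dl by (metis cov_le cov_le_trans rtranclp.rtrancl_refl)
    have lt: "nat (rk w - rk q) < nat (rk w - rk v)"
      using diamond_rk[OF d] le_rk[OF c] by linarith
    have hq: "harm F q w" "harm F' q w" using less.prems(3,4) dl harm_mono cov_le by blast+
    show "\<forall>u. q \<preceq> u \<and> u \<preceq> w \<longrightarrow> F u = F' u"
      using less.hyps[OF lt _ c hq q] P dl by (meson cov_le le_trans)
  qed
  show ?case
  proof (cases "u = v")
    case False
    then obtain b where "v \<lessdot> b" "b \<preceq> u" using le_first less.prems by metis
    then show ?thesis using * less.prems by (meson le_trans)
  qed (use less.prems in auto)
qed

text \<open>The harmonic functions on an interval of length three have at most four degrees of freedom.\<close>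

lemma harm_eq_rank3:
  assumes chain: "v \<lessdot> a" "a \<lessdot> c" "c \<lessdot> w" and F: "harm F v w" "harm F' v w"
    and eq: "F v = F' v" "F a = F' a" "F c = F' c" "F w = F' w" and u: "v \<preceq> u" "u \<preceq> w"
  shows "F u = F' u"
proof -
  have aw: "a \<preceq> w" by (rule cov_le_trans[OF chain(2) cov_le[OF chain(3)]])
  have ch: "harm F a w" "harm F' a w" using harm_mono[OF F(1) cov_le[OF chain(1)]] harm_mono[OF F(2) cov_le[OF chain(1)]] by auto
  have "F u = F' u" if u: "c \<preceq> u" "u \<preceq> w" for u
  proof (cases "u = c")
    case False
    then have "u = w" using le_first[OF u(1)] cov_rk cov_rk[OF chain(3)] le_rk_eq[OF u(2)] le_rk by force
    then show ?thesis using eq by simp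
  qed (use eq in simp)
  then have "F u = F' u" if "a \<preceq> u" "u \<preceq> w" for u
    using harm_determined[OF chain(2) cov_le[OF chain(3)] ch eq(2) _ that] by blast
  then show ?thesis using harm_determined[OF chain(1) aw F eq(1) _ u] by blast
qed

text \<open>The atoms of \<open>v\<close> are treated in the order of their labels; here \<open>G\<close> is already known above the
atoms smaller than \<open>a\<close>. The cover \<open>c0\<close> of \<open>a\<close> with the smallest label lies above such an atom,
and the diamond of \<open>v\<close>, \<open>a\<close> and \<open>c0\<close> dictates the value \<open>\<gamma>\<close> at \<open>a\<close>. Together with the values of \<open>G\<close>
above \<open>c0\<close> it fixes a harmonic function \<open>g\<close> on \<open>[a, w]\<close>. The point is that \<open>g\<close> agrees with \<open>G\<close>
above every cover \<open>c\<close> of \<open>a\<close> that lies above a smaller atom. By induction on the label of \<open>c\<close>,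
a descent leads to a cover \<open>c'\<close> with a smaller label and an element \<open>d\<close> above both; on \<open>[v, d]\<close>,
an interval of length three, the known values of \<open>G\<close> are those of a function \<open>f\<close> in \<open>lin\<close>,
which shows that the conditions from \<open>c\<close> and \<open>c'\<close> are compatible.\<close>

lemma extend_step:
  assumes v: "v \<lessdot> a" "a \<preceq> w" "v \<lessdot> a0" "a0 \<preceq> w" "lab v a0 < lab v a"
    and G_harm: "\<And>b. v \<lessdot> b \<Longrightarrow> b \<preceq> w \<Longrightarrow> lab v b < lab v a \<Longrightarrow> harm G b w"
    and G_bal: "\<And>p q c. diamond v p q c \<Longrightarrow> c \<preceq> w \<Longrightarrow> lab v p < lab v a \<Longrightarrow> lab v q < lab v a \<Longrightarrow> balanced G v p q c"
    and ext: "\<And>c g r. a \<lessdot> c \<Longrightarrow> c \<preceq> w \<Longrightarrow> harm g c w \<Longrightarrow> \<exists>G. harm G a w \<and> (\<forall>u. c \<preceq> u \<and> u \<preceq> w \<longrightarrow> G u = g u) \<and> G a = r"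
  obtains g where "harm g a w"
    and "\<And>b u. v \<lessdot> b \<Longrightarrow> lab v b < lab v a \<Longrightarrow> b \<preceq> u \<Longrightarrow> a \<preceq> u \<Longrightarrow> u \<preceq> w \<Longrightarrow> g u = G u"
    and "\<And>b c. diamond v a b c \<Longrightarrow> c \<preceq> w \<Longrightarrow> lab v b < lab v a \<Longrightarrow> balanced (G(a := g a)) v a b c"
proof -
  obtain b1 e1 where "diamond v a b1 e1" "e1 \<preceq> w" "lab v b1 < lab v a"
    using descend[OF v] by blast
  then have e1: "a \<lessdot> e1" "e1 \<preceq> w" "lab a e1 < lab v a" using diamond_lab diamond_def by blast+
  obtain c0 where c0: "a \<lessdot> c0" "c0 \<preceq> w" and min: "\<And>c. a \<lessdot> c \<and> c \<preceq> w \<Longrightarrow> lab a c0 \<le> lab a c"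
    using ex_has_least_nat[of "\<lambda>b. a \<lessdot> b \<and> b \<preceq> w" e1 "lab a"] e1 by blast
  have c0lab: "lab a c0 < lab v a" using min[of e1] e1 by simp
  obtain b0 where b0: "diamond v a b0 c0" using diamond_ex v c0 by blast
  have b0lab: "lab v b0 < lab v a" using diamond_lab[OF b0] c0lab by blast
  have b0': "v \<lessdot> b0" "b0 \<lessdot> c0" "b0 \<preceq> w" using diamond_le[OF b0] c0 by (auto intro: cov_le_trans)
  define \<gamma> where "\<gamma> = (wb v c0 * G v + wt v c0 * G c0 - wm v b0 c0 * G b0) / wm v a c0"
  have bal0: "balanced (G(a := \<gamma>)) v a b0 c0"
  proof -
    have "v \<noteq> a" "c0 \<noteq> a" "b0 \<noteq> a" using b0 diamond_rk[OF b0] by (auto simp: diamond_def)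
    moreover have "wm v a c0 * \<gamma> = wb v c0 * G v + wt v c0 * G c0 - wm v b0 c0 * G b0"
      unfolding \<gamma>_def using diamond_weights[OF b0] by simp
    ultimately show ?thesis unfolding balanced_def by simp
  qed
  have "harm G c0 w" using harm_mono[OF G_harm[OF b0'(1,3) b0lab]] b0' by blast
  then obtain g where g: "harm g a w" and gG: "\<And>u. c0 \<preceq> u \<Longrightarrow> u \<preceq> w \<Longrightarrow> g u = G u" and ga: "g a = \<gamma>"
    using ext[OF c0] by blast
  let ?H = "G(a := \<gamma>)"
  have key: "(\<forall>b. diamond v a b c \<longrightarrow> balanced ?H v a b c) \<and> (\<forall>u. c \<preceq> u \<and> u \<preceq> w \<longrightarrow> g u = G u)"
    if "a \<lessdot> c" "c \<preceq> w" "lab a c < lab v a" for c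
    using that
  proof (induction "lab a c" arbitrary: c rule: less_induct)
    case less
    show ?case
    proof (cases "c = c0")
      case True
      then show ?thesis using bal0 gG diamond_unique[OF b0] by blast
    next
      case False
      then have "lab a c0 < lab a c" using min[of c] less.prems lab_inj c0 by (metis le_neq_implies_less)
      then obtain c' d where d: "diamond a c c' d" "d \<preceq> w" "lab a c' < lab a c"
        using descend[OF less.prems(1,2) c0] by blast
      have dd: "a \<lessdot> c'" "c' \<lessdot> d" "c \<lessdot> d" "c' \<preceq> w" using diamond_le[OF d(1)] d(2) by (auto intro: cov_le_trans)
      note IH = less.hyps[OF d(3) dd(1,4)]
      obtain b where b: "diamond v a b c" using diamond_ex v less.prems by blast
      obtain b' where b': "diamond v a b' c'" using diamond_ex v dd by blast
      have blab: "lab v b < lab v a" using diamond_lab[OF b] less.prems by blast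
      have b'lab: "lab v b' < lab v a" using diamond_lab[OF b'] less.prems d(3) by simp
      have IH: "balanced ?H v a b' c'" "\<And>u. c' \<preceq> u \<Longrightarrow> u \<preceq> w \<Longrightarrow> g u = G u"
        using IH b' d(3) less.prems(3) by auto
      have bd: "v \<lessdot> b" "b \<preceq> d" "v \<lessdot> b'" "b' \<preceq> d" "b \<lessdot> c" "b' \<lessdot> c'"
        using diamond_le[OF b] diamond_le[OF b'] dd by (auto intro: cov_le_trans)
      obtain a1 where a1: "v \<lessdot> a1" "a1 \<preceq> d" and min1: "\<And>e. v \<lessdot> e \<and> e \<preceq> d \<Longrightarrow> lab v a1 \<le> lab v e"
        using ex_has_least_nat[of "\<lambda>e. v \<lessdot> e \<and> e \<preceq> d" b "lab v"] bd by blast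
      have rkd: "rk d = rk v + 3" using diamond_rk[OF b] cov_rk[OF dd(3)] by simp
      then have "a1 \<noteq> d" using cov_rk[OF a1(1)] by auto
      then obtain c1 where c1: "a1 \<lessdot> c1" "c1 \<preceq> d" using le_first a1 by blast
      have c1d: "c1 \<lessdot> d" using cov_of_rk[OF c1(2)] cov_rk[OF c1(1)] cov_rk[OF a1(1)] rkd by simp
      obtain f where f: "f \<in> lin" "f v = G v" "f a1 = G a1" "f c1 = G c1" "f d = G d"
        using lin_chain[OF a1(1) c1(1) c1d] by blast
      have fbal: "balanced f x p q y" if "diamond x p q y" for x p q y
        using lin_harm[OF f(1), of x y] harm_balanced that by blast
      \<comment> \<open>The functions \<open>f\<close> and \<open>G\<close> agree at all atoms of \<open>[v, d]\<close> smaller than \<open>a\<close> and above them.\<close>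
      have cl: "f e = G e \<and> (\<forall>z. e \<lessdot> z \<and> z \<lessdot> d \<longrightarrow> f z = G z)" if "v \<lessdot> e" "e \<preceq> d" "lab v e < lab v a" for e
        using that
      proof (induction "lab v e" arbitrary: e rule: less_induct)
        case (less e)
        have he: "harm G e w" using G_harm less.prems d(2) le_trans by blast
        have "\<exists>z0. f e = G e \<and> e \<lessdot> z0 \<and> z0 \<lessdot> d \<and> f z0 = G z0"
        proof (cases "e = a1")
          case True then show ?thesis using f c1 c1d by blast
        next
          case False
          then have "lab v a1 < lab v e" using min1[of e] less.prems lab_inj a1 by (metis le_neq_implies_less)
          then obtain e' z where z: "diamond v e e' z" "z \<preceq> d" "lab v e' < lab v e"
            using descend[OF less.prems(1,2) a1] by blast
          have zd: "z \<lessdot> d" using cov_of_rk[OF z(2)] diamond_rk[OF z(1)] rkd by simp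
          have ez: "v \<lessdot> e'" "e' \<lessdot> z" "e' \<preceq> d" "e \<lessdot> z" using diamond_le[OF z(1)] z(2) by (auto intro: cov_le_trans)
          have IH': "f e' = G e'" "f z = G z" using less.hyps[OF z(3) ez(1,3)] z(3) less.prems(3) ez zd by auto
          have bz: "balanced G v e e' z"
            using G_bal[OF z(1) le_trans[OF z(2) d(2)] less.prems(3)] z(3) less.prems(3) by linarith
          then have "f e = G e"
            using balanced_mid[OF diamond_sym[OF z(1)] fbal[OF diamond_sym[OF z(1)]] balanced_sym[OF bz] f(2) IH'] by simp
          then show ?thesis using IH' ez zd by blast
        qed
        then obtain z0 where z0: "f e = G e" "e \<lessdot> z0" "z0 \<lessdot> d" "f z0 = G z0" by blast
        have "f z = G z" if "e \<lessdot> z" "z \<lessdot> d" for z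
        proof (cases "z = z0")
          case False
          then have dz: "diamond e z0 z d" using z0 that by (simp add: diamond_def)
          have "balanced G e z0 z d" using harm_balanced[OF he dz] d(2) by blast
          then show ?thesis using balanced_mid[OF dz fbal[OF dz] _ z0(1) z0(4) f(5)] by blast
        qed (use z0 in simp)
        then show ?case using z0 by blast
      qed
      have fb: "f b = G b" "f c = G c" "f b' = G b'" "f c' = G c'"
        using cl[OF bd(1,2) blab] cl[OF bd(3,4) b'lab] bd dd by blast+
      have ne: "v \<noteq> a" "b \<noteq> a" "c \<noteq> a" "b' \<noteq> a" "c' \<noteq> a"
        using diamond_rk[OF b] b b' diamond_rk[OF b'] by (auto simp: diamond_def)
      have fa: "f a = \<gamma>"
        using balanced_mid[OF diamond_sym[OF b'] fbal[OF diamond_sym[OF b']] balanced_sym[OF IH(1)]] f fb ne by simp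
      have bal: "balanced ?H v a b c"
        using fbal[OF b] f fb fa ne by (simp add: balanced_def)
      have "g c' = f c'" "g d = f d" using IH(2)[of c'] IH(2)[of d] dd d(2) fb f(5) by auto
      then have gc: "g c = G c"
        using balanced_mid[OF diamond_sym[OF d(1)] fbal[OF diamond_sym[OF d(1)]], of g]
          harm_balanced[OF g diamond_sym[OF d(1)]] d(2) fa ga fb by auto
      have "harm G c w" using harm_mono[OF G_harm[of b]] bd blab v d less.prems
        by (metis cov_le cov_le_trans rtranclp.rtrancl_refl)
      moreover have "harm g c w" using harm_mono[OF g] less.prems by blast
      moreover have "g u = G u" if "d \<preceq> u" "u \<preceq> w" for u using IH(2)[of u] that dd(2) cov_le_trans by blast
      ultimately have "g u = G u" if "c \<preceq> u" "u \<preceq> w" for u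
        using harm_determined[OF dd(3) d(2), of g G u] gc that by blast
      then show ?thesis using bal diamond_unique[OF b] by blast
    qed
  qed
  have lower: "g u = G u" if u: "v \<lessdot> b" "lab v b < lab v a" "b \<preceq> u" "a \<preceq> u" "u \<preceq> w" for b u
  proof -
    obtain b' c where c: "diamond v a b' c" "c \<preceq> u" "lab v b' < lab v a"
      using descend[OF v(1) u(4) u(1,3,2)] by blast
    have "a \<lessdot> c" "c \<preceq> w" "lab a c < lab v a"
      using diamond_le[OF c(1)] diamond_lab[OF c(1)] c u le_trans by blast+
    then show ?thesis using key c u by blast
  qed
  moreover have "balanced (G(a := g a)) v a b c" if "diamond v a b c" "c \<preceq> w" "lab v b < lab v a" for b c
    using key[of c] that diamond_lab[OF that(1)] diamond_le[OF that(1)] unfolding ga by blast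
  ultimately show ?thesis using that g by blast
qed

text \<open>The function is constructed by adding atoms one at a time. For the bound \<open>k\<close> on their labels it is
harmonic above each atom treated so far, and the diamonds at \<open>v\<close> between two such atoms are
balanced. The first atom imposes no condition, which is why it may carry a prescribed function.\<close>

lemma extend_min:
  assumes a0: "v \<lessdot> a0" "a0 \<preceq> w" and min: "\<And>b. v \<lessdot> b \<Longrightarrow> b \<preceq> w \<Longrightarrow> lab v a0 \<le> lab v b"
    and g: "harm g a0 w"
    and ext: "\<And>a c g r. v \<lessdot> a \<Longrightarrow> a \<lessdot> c \<Longrightarrow> c \<preceq> w \<Longrightarrow> harm g c w \<Longrightarrow> \<exists>G. harm G a w \<and> (\<forall>u. c \<preceq> u \<and> u \<preceq> w \<longrightarrow> G u = g u) \<and> G a = r"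
  shows "\<exists>G. harm G v w \<and> (\<forall>u. a0 \<preceq> u \<and> u \<preceq> w \<longrightarrow> G u = g u) \<and> G v = r"
proof -
  have main: "\<exists>G. G v = r \<and> (\<forall>u. a0 \<preceq> u \<and> u \<preceq> w \<longrightarrow> G u = g u)
      \<and> (\<forall>b. v \<lessdot> b \<and> b \<preceq> w \<and> lab v b < k \<longrightarrow> harm G b w)
      \<and> (\<forall>p q c. diamond v p q c \<and> c \<preceq> w \<and> lab v p < k \<and> lab v q < k \<longrightarrow> balanced G v p q c)" for k
  proof (induction k)
    case 0
    have "\<not> a0 \<preceq> v" using not_cov_le a0 by blast
    then show ?case by (intro exI[of _ "g(v := r)"]) auto
  next
    case (Suc k)
    then obtain G where Gv: "G v = r" and Gg: "\<And>u. a0 \<preceq> u \<Longrightarrow> u \<preceq> w \<Longrightarrow> G u = g u"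
      and Gh: "\<And>b. v \<lessdot> b \<Longrightarrow> b \<preceq> w \<Longrightarrow> lab v b < k \<Longrightarrow> harm G b w"
      and Gb: "\<And>p q c. diamond v p q c \<Longrightarrow> c \<preceq> w \<Longrightarrow> lab v p < k \<Longrightarrow> lab v q < k \<Longrightarrow> balanced G v p q c"
      by blast
    show ?case
    proof (cases "\<exists>a. v \<lessdot> a \<and> a \<preceq> w \<and> lab v a = k")
      case False
      have "lab v b < k" if "v \<lessdot> b" "b \<preceq> w" "lab v b < Suc k" for b
        using False that less_Suc_eq by blast
      moreover have "v \<lessdot> p \<and> p \<preceq> w \<and> v \<lessdot> q \<and> q \<preceq> w" if "diamond v p q c" "c \<preceq> w" for p q c
        using diamond_le[OF that(1)] that(2) by (auto intro: cov_le_trans)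
      ultimately show ?thesis using Gv Gg Gh Gb by (intro exI[of _ G]) meson
    next
      case True
      then obtain a where a: "v \<lessdot> a" "a \<preceq> w" "lab v a = k" by blast
      have uniq: "b = a \<or> lab v b < k" if "v \<lessdot> b" "lab v b < Suc k" for b
        using that a lab_inj less_Suc_eq by metis
      show ?thesis
      proof (cases "a = a0")
        case True
        have "harm G a0 w" using g Gg harm_cong by metis
        moreover have "\<not> lab v b < k" if "v \<lessdot> b" "b \<preceq> w" for b using min[OF that] a True by simp
        moreover have "v \<lessdot> p \<and> p \<preceq> w \<and> v \<lessdot> q \<and> q \<preceq> w \<and> p \<noteq> q" if "diamond v p q c" "c \<preceq> w" for p q c
          using diamond_le[OF that(1)] that by (auto simp: diamond_def intro: cov_le_trans)
        ultimately show ?thesis using Gv Gg uniq True by (intro exI[of _ G]) metis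
      next
        case False
        then have lt: "lab v a0 < lab v a" using min[OF a(1,2)] lab_inj a a0 by (metis le_neq_implies_less)
        obtain h where h: "harm h a w"
          and hG: "\<And>b u. v \<lessdot> b \<Longrightarrow> lab v b < lab v a \<Longrightarrow> b \<preceq> u \<Longrightarrow> a \<preceq> u \<Longrightarrow> u \<preceq> w \<Longrightarrow> h u = G u"
          and hb: "\<And>b c. diamond v a b c \<Longrightarrow> c \<preceq> w \<Longrightarrow> lab v b < lab v a \<Longrightarrow> balanced (G(a := h a)) v a b c"
          using extend_step[OF a(1,2) a0 lt, of G] Gh Gb a(3) ext[OF a(1)] by blast
        define H where "H u = (if a \<preceq> u \<and> u \<preceq> w then h u else G u)" for u
        have HG: "H u = G u" if "v \<lessdot> b" "lab v b < k" "b \<preceq> u" "u \<preceq> w" for b u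
          using hG that a(3) by (auto simp: H_def)
        have Hv: "H v = G v" using not_cov_le a by (auto simp: H_def)
        have "harm H b w" if b: "v \<lessdot> b" "b \<preceq> w" "lab v b < Suc k" for b
        proof (cases "b = a")
          case True
          then show ?thesis using h harm_cong[of a w H h] by (simp add: H_def)
        next
          case False
          then show ?thesis using Gh[OF b(1,2)] uniq[OF b(1,3)] HG[OF b(1)] harm_cong[of b w H G] by blast
        qed
        moreover have Hat: "balanced H v a q c" if q: "diamond v a q c" "c \<preceq> w" "lab v q < k" for q c
        proof -
          have dl: "v \<lessdot> q" "q \<lessdot> c" "a \<lessdot> c" using diamond_le[OF q(1)] by auto
          have "H c = G c" "H q = G q" using HG[OF dl(1) q(3)] dl q(2) cov_le_trans by blast+
          moreover have "H a = h a" using a by (simp add: H_def)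
          moreover have "v \<noteq> a" "q \<noteq> a" "c \<noteq> a" using q(1) diamond_rk[OF q(1)] by (auto simp: diamond_def)
          ultimately show ?thesis using hb[OF q(1,2)] q(3) a(3) Hv by (simp add: balanced_def)
        qed
        moreover have "balanced H v p q c" if q: "diamond v p q c" "c \<preceq> w" "lab v p < Suc k" "lab v q < Suc k" for p q c
        proof -
          have dl: "v \<lessdot> p" "p \<lessdot> c" "v \<lessdot> q" "q \<lessdot> c" "p \<noteq> q" using q(1) by (auto simp: diamond_def)
          consider "p = a" | "q = a" | "p \<noteq> a" "q \<noteq> a" by blast
          then show ?thesis
          proof cases
            case 1 then show ?thesis using Hat q uniq[OF dl(3)] dl by blast
          next
            case 2 then show ?thesis using Hat[of p c] diamond_sym[OF q(1)] q uniq[OF dl(1)] dl balanced_sym by blast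
          next
            case 3
            then have k: "lab v p < k" "lab v q < k" using uniq dl q by blast+
            have "H c = G c" "H q = G q" "H p = G p" using HG[OF dl(3) k(2)] HG[OF dl(1) k(1)] dl q(2) cov_le_trans by blast+
            then show ?thesis using Gb[OF q(1,2) k] Hv by (simp add: balanced_def)
          qed
        qed
        moreover have "\<forall>u. a0 \<preceq> u \<and> u \<preceq> w \<longrightarrow> H u = g u" using HG[OF a0(1)] lt a(3) Gg by metis
        ultimately show ?thesis using Hv Gv by (intro exI[of _ H]) blast
      qed
    qed
  qed
  have "finite {b. v \<lessdot> b}" using finite_S by (rule rev_finite_subset) (auto dest: cov_S)
  then obtain k where k: "\<And>b. v \<lessdot> b \<Longrightarrow> lab v b < k"
    using finite_nat_set_iff_bounded[of "lab v ` {b. v \<lessdot> b}"] by auto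
  obtain G where G: "G v = r" "\<forall>u. a0 \<preceq> u \<and> u \<preceq> w \<longrightarrow> G u = g u"
      "\<forall>b. v \<lessdot> b \<and> b \<preceq> w \<and> lab v b < k \<longrightarrow> harm G b w"
      "\<forall>p q c. diamond v p q c \<and> c \<preceq> w \<and> lab v p < k \<and> lab v q < k \<longrightarrow> balanced G v p q c"
    using main by blast
  have "balanced G x p q y" if x: "v \<preceq> x" "y \<preceq> w" "diamond x p q y" for x p q y
  proof (cases "x = v")
    case True
    then show ?thesis using G(4) x k diamond_le[OF x(3)] by blast
  next
    case False
    then obtain b where b: "v \<lessdot> b" "b \<preceq> x" using le_first x by metis
    then have "b \<preceq> w" using x diamond_le[OF x(3)] by (meson le_trans)
    then have "harm G b w" using G(3) b k by blast
    then show ?thesis using harm_balanced x b by blast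
  qed
  then show ?thesis using G unfolding harm_def by blast
qed

text \<open>The case of the atom with the smallest label carries over along the diamonds of \<open>v\<close>. For a
diamond \<open>v < p, q < c\<close> and a function \<open>g\<close> on \<open>[q, w]\<close>, restrict \<open>g\<close> to \<open>[c, w]\<close> and extend it to
\<open>[p, w]\<close> with the value at \<open>p\<close> that balances the diamond; a harmonic extension of the result to
\<open>[v, w]\<close> agrees with \<open>g\<close> on \<open>[q, w]\<close>.\<close>

lemma harm_extend:
  assumes "v \<lessdot> a" "a \<preceq> w" "harm g a w"
  shows "\<exists>G. harm G v w \<and> (\<forall>u. a \<preceq> u \<and> u \<preceq> w \<longrightarrow> G u = g u) \<and> G v = r"
  using assms
proof (induction "nat (rk w - rk v)" arbitrary: v a g r rule: less_induct)
  case less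
  have ext: "\<exists>G. harm G a w \<and> (\<forall>u. c \<preceq> u \<and> u \<preceq> w \<longrightarrow> G u = g u) \<and> G a = r"
    if "v \<lessdot> a" "a \<lessdot> c" "c \<preceq> w" "harm g c w" for a c g r
  proof -
    have "nat (rk w - rk a) < nat (rk w - rk v)"
      using cov_rk[OF that(1)] cov_rk[OF that(2)] le_rk[OF that(3)] by linarith
    then show ?thesis using less.hyps that by blast
  qed
  let ?P = "\<lambda>a. \<forall>g. harm g a w \<longrightarrow> (\<exists>G. harm G v w \<and> (\<forall>u. a \<preceq> u \<and> u \<preceq> w \<longrightarrow> G u = g u) \<and> G v = r)"
  obtain a0 where a0: "v \<lessdot> a0" "a0 \<preceq> w" and min: "\<And>b. v \<lessdot> b \<and> b \<preceq> w \<Longrightarrow> lab v a0 \<le> lab v b"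
    using ex_has_least_nat[of "\<lambda>b. v \<lessdot> b \<and> b \<preceq> w" a "lab v"] less.prems by blast
  have "?P a"
  proof (rule atoms_connected_propagate[OF a0 less.prems(1,2)])
    show "?P a0" using extend_min[OF a0 _ _ ext] min by blast
  next
    fix p q c assume d: "diamond v p q c" and c: "c \<preceq> w" and P: "?P p"
    note dl = diamond_le[OF d]
    have pw: "p \<preceq> w" "q \<preceq> w" using dl c by (auto intro: cov_le_trans)
    show "?P q"
    proof (intro allI impI)
      fix g assume g: "harm g q w"
      define \<rho> where "\<rho> = (wb v c * r + wt v c * g c - wm v q c * g q) / wm v p c"
      have \<rho>: "wm v p c * \<rho> = wb v c * r + wt v c * g c - wm v q c * g q"
        unfolding \<rho>_def using diamond_weights[OF d] by simp
      have "harm g c w" using harm_mono[OF g] dl by blast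
      then obtain g' where g': "harm g' p w" "\<forall>u. c \<preceq> u \<and> u \<preceq> w \<longrightarrow> g' u = g u" "g' p = \<rho>"
        using ext[of p c g \<rho>] dl c by blast
      then obtain G where G: "harm G v w" "\<forall>u. p \<preceq> u \<and> u \<preceq> w \<longrightarrow> G u = g' u" "G v = r"
        using P by blast
      have Gc: "G u = g u" if "c \<preceq> u" "u \<preceq> w" for u using G(2) g'(2) that cov_le_trans[of p c u] dl by simp
      have Gcp: "G c = g c" "G p = \<rho>" using Gc[of c] c G(2) g'(3) pw by auto
      have "balanced G v p q c" using harm_balanced[OF G(1) d] c by blast
      then have "wm v q c * G q = wm v q c * g q" using \<rho> Gcp G(3) unfolding balanced_def by simp
      then have Gq: "G q = g q" using diamond_weights[OF d] by simp
      have hq: "harm G q w" using harm_mono[OF G(1)] dl by blast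
      have "G u = g u" if "q \<preceq> u" "u \<preceq> w" for u
        using harm_determined[OF _ c hq g Gq _ that] Gc dl by blast
      then show "\<exists>G. harm G v w \<and> (\<forall>u. q \<preceq> u \<and> u \<preceq> w \<longrightarrow> G u = g u) \<and> G v = r" using G by blast
    qed
  qed
  then show ?case using less.prems by blast
qed

end

section \<open>Sublevel sets of harmonic functions among the atoms\<close>

text \<open>If the neighbours below each vertex can be joined below that vertex, then the highest vertices of
a path can be bypassed. Formally the bound \<open>t\<close> is lowered past one vertex \<open>q\<close> after the other:
\<open>q\<close> is the lowest vertex at level at least \<open>t\<close>, and the bound \<open>t'\<close> admits one more vertex than
\<open>t\<close>, namely \<open>q\<close>.\<close>

lemma mountain_pass:
  fixes \<rho> :: "'a \<Rightarrow> real"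
  assumes "finite V" and E: "\<And>x y. E x y \<Longrightarrow> x \<in> V \<and> y \<in> V \<and> E y x" and inj: "inj_on \<rho> V"
    and pass: "\<And>q p1 p2. E q p1 \<Longrightarrow> E q p2 \<Longrightarrow> \<rho> p1 < \<rho> q \<Longrightarrow> \<rho> p2 < \<rho> q \<Longrightarrow>
        (\<lambda>x y. E x y \<and> \<rho> x < \<rho> q \<and> \<rho> y < \<rho> q)\<^sup>*\<^sup>* p1 p2"
    and "E\<^sup>*\<^sup>* a b" "\<rho> a < t" "\<rho> b < t"
  shows "(\<lambda>x y. E x y \<and> \<rho> x < t \<and> \<rho> y < t)\<^sup>*\<^sup>* a b"
  using assms(6,7)
proof (induction "card {x \<in> V. t \<le> \<rho> x}" arbitrary: t rule: less_induct)
  case less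
  let ?A = "{x \<in> V. t \<le> \<rho> x}" and ?R = "\<lambda>t x y. E x y \<and> \<rho> x < t \<and> \<rho> y < t"
  have fin: "finite ?A" using \<open>finite V\<close> by simp
  show ?case
  proof (cases "?A = {}")
    case True
    then have "?R t = E" using E by (fastforce simp: fun_eq_iff not_le)
    then show ?thesis using assms(5) by simp
  next
    case False
    obtain q where q: "q \<in> ?A" and qmin: "\<And>x. x \<in> ?A \<Longrightarrow> \<rho> q \<le> \<rho> x"
      using ex_min_if_finite[of "\<rho> ` ?A"] fin False by (metis (no_types, lifting) finite_imageI arg_min_if_finite(1) arg_min_least)
    \<comment> \<open>Injectivity of \<open>\<rho>\<close> separates \<open>q\<close> from the next level.\<close>
    define t' where "t' = (if ?A - {q} = {} then \<rho> q + 1 else Min (\<rho> ` (?A - {q})))"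
    have t'q: "\<rho> q < t'"
    proof (cases "?A - {q} = {}")
      case False
      have "\<rho> q < \<rho> x" if "x \<in> ?A - {q}" for x
      proof -
        have "\<rho> q \<noteq> \<rho> x" using that q inj by (auto dest: inj_onD)
        then show ?thesis using qmin[of x] that by auto
      qed
      then show ?thesis using False fin by (simp add: t'_def)
    qed (simp add: t'_def)
    have t'A: "t' \<le> \<rho> x" if "x \<in> ?A" "x \<noteq> q" for x
      using that fin by (auto simp: t'_def intro!: Min_le)
    have below: "\<rho> x < t \<or> x = q" if "x \<in> V" "\<rho> x < t'" for x using t'A[of x] that by force
    have tq: "t \<le> \<rho> q" "q \<in> V" using q by auto
    have "{x \<in> V. t' \<le> \<rho> x} \<subset> ?A" using t'q tq by force
    then have "card {x \<in> V. t' \<le> \<rho> x} < card ?A" using fin psubset_card_mono by blast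
    then have path: "(?R t')\<^sup>*\<^sup>* a b" using less.hyps[of t'] less.prems t'q tq by force
    have "(x \<noteq> q \<longrightarrow> (?R t)\<^sup>*\<^sup>* a x) \<and> (x = q \<longrightarrow> (\<exists>p. E q p \<and> \<rho> p < t \<and> (?R t)\<^sup>*\<^sup>* a p))"
      if "(?R t')\<^sup>*\<^sup>* a x" for x
      using that
    proof (induction rule: rtranclp_induct)
      case base
      then show ?case using less.prems tq by auto
    next
      case (step x y)
      have xy: "E x y" "x \<in> V" "y \<in> V" "E y x" "\<rho> x < t \<or> x = q" "\<rho> y < t \<or> y = q"
        using step(2) E below by blast+
      show ?case
      proof (cases "x = q")
        case False
        then have Rx: "(?R t)\<^sup>*\<^sup>* a x" "\<rho> x < t" using step(3) xy by auto
        show ?thesis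
        proof (cases "y = q")
          case True then show ?thesis using Rx xy by blast
        next
          case False then have "?R t x y" using xy Rx by auto
          then show ?thesis using rtranclp.rtrancl_into_rtrancl[of "?R t" a x y] Rx(1) False by blast
        qed
      next
        case True
        then obtain p where p: "E q p" "\<rho> p < t" "(?R t)\<^sup>*\<^sup>* a p" using step(3) by blast
        show ?thesis
        proof (cases "y = q")
          case True then show ?thesis using p by blast
        next
          case False
          then have "\<rho> y < t" using xy by blast
          then have "(?R (\<rho> q))\<^sup>*\<^sup>* p y" using pass[of q p y] p xy True tq by force
          then have "(?R t)\<^sup>*\<^sup>* p y"
          proof (rule rtranclp_mono[THEN predicate2D, rotated], intro predicate2I)
            fix x y assume "?R (\<rho> q) x y"
            moreover from this have "x \<in> V" "y \<in> V" using E by blast+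
            ultimately show "?R t x y" using qmin by (force simp: not_le[symmetric])
          qed
          then show ?thesis using p(3) False by auto
        qed
      qed
    qed
    then show ?thesis using path less.prems tq by force
  qed
qed

lemma eventually_perturb_less:
  fixes x y r s :: real
  assumes "x < y" shows "eventually (\<lambda>\<epsilon>. x + \<epsilon> * r < y + \<epsilon> * s) (at_right 0)"
proof -
  have "((\<lambda>\<epsilon>. (y + \<epsilon> * s) - (x + \<epsilon> * r)) \<longlongrightarrow> (y + 0 * s) - (x + 0 * r)) (at_right 0)"
    by (intro tendsto_intros)
  then have "eventually (\<lambda>\<epsilon>. 0 < (y + \<epsilon> * s) - (x + \<epsilon> * r)) (at_right 0)"
    using assms by (intro order_tendstoD(1)) auto
  then show ?thesis by eventually_elim simp
qed

lemma eventually_perturb_neq: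
  fixes x y r s :: real
  assumes "r \<noteq> s" shows "eventually (\<lambda>\<epsilon>. x + \<epsilon> * r \<noteq> y + \<epsilon> * s) (at_right 0)"
proof -
  consider "x < y" | "y < x" | "x = y" by linarith
  then show ?thesis
  proof cases
    case 1 show ?thesis by (rule eventually_mono[OF eventually_perturb_less[OF 1, of r s]]) simp
  next
    case 2 show ?thesis by (rule eventually_mono[OF eventually_perturb_less[OF 2, of s r]]) simp
  next
    case 3
    show ?thesis by (rule eventually_mono[OF eventually_at_right_less[of "0 :: real"]]) (use 3 assms in auto)
  qed
qed

lemma eventually_right_ex: "eventually P (at_right (0::real)) \<Longrightarrow> \<exists>\<epsilon>>0. P \<epsilon>"
  using eventually_happens'[OF trivial_limit_at_right_real, OF eventually_conj[OF eventually_at_right_less]] by blast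

text \<open>The function \<open>h\<close> serves as a height, and the generic function \<open>G\<close> is used to break ties. The
vertex figure of an interval of length three is a cycle through its atoms; it is a triangle or a
quadrangle by \<open>few_atoms\<close>.\<close>

locale convex_poset = labelled_poset +
  fixes h G :: "'a \<Rightarrow> real"
  assumes h_lin: "h \<in> lin" and G_lin: "G \<in> lin"
    and h_less: "x \<lessdot> y \<Longrightarrow> h x < h y"
    and G_inj: "inj_on G S"
    and G_ratio: "x \<lessdot> a \<Longrightarrow> x \<lessdot> b \<Longrightarrow> a \<noteq> b \<Longrightarrow> (G a - G x) * (h b - h x) \<noteq> (G b - G x) * (h a - h x)"
    and few_atoms: "v \<preceq> w \<Longrightarrow> rk w = rk v + 3 \<Longrightarrow> card {a. v \<lessdot> a \<and> a \<preceq> w} \<le> 4"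
begin

lemma finite_atoms: "finite {a. v \<lessdot> a \<and> P a}"
  using finite_S by (rule rev_finite_subset) (auto dest: cov_S)

lemma rank3_lin:
  assumes F: "harm F v w" and "v \<preceq> w" "rk w = rk v + 3"
  shows "\<exists>f\<in>lin. \<forall>u. v \<preceq> u \<and> u \<preceq> w \<longrightarrow> f u = F u"
proof -
  obtain a where a: "v \<lessdot> a" "a \<preceq> w" using le_first[of v w] assms by force
  obtain c where c: "a \<lessdot> c" "c \<preceq> w" using le_first[OF a(2)] assms cov_rk[OF a(1)] by force
  have cw: "c \<lessdot> w" using cov_of_rk[OF c(2)] cov_rk[OF c(1)] cov_rk[OF a(1)] assms by simp
  obtain f where f: "f \<in> lin" "f v = F v" "f a = F a" "f c = F c" "f w = F w"
    using lin_chain[OF a(1) c(1) cw] by blast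
  have "f u = F u" if "v \<preceq> u" "u \<preceq> w" for u
    by (rule harm_eq_rank3[OF a(1) c(1) cw lin_harm[OF f(1)] F f(2-5) that])
  then show ?thesis using f(1) by blast
qed

lemma balanced_zero_top:
  assumes "diamond x p q y" "balanced F x p q y" "F x = 0" "F p = 0" "F q = 0" shows "F y = 0"
  using assms diamond_weights[OF assms(1)] unfolding balanced_def by auto

lemma balanced_zero_mid:
  assumes "diamond x p q y" "balanced F x p q y" "F x = 0" "F p = 0" "F y = 0" shows "F q = 0"
  using assms diamond_weights[OF assms(1)] unfolding balanced_def by auto

lemma balanced_pos_top_mid:
  assumes "diamond x p q y" "balanced F x p q y" "F x = 0" "F p = 0" "0 < F y" shows "0 < F q"
proof -
  note w = diamond_weights[OF assms(1)]
  have "wm x q y * F q = wt x y * F y" using assms(2-4) unfolding balanced_def by simp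
  then have "0 < wm x q y * F q" using w assms(5) by simp
  then show ?thesis using w by (simp add: zero_less_mult_iff)
qed

text \<open>In an interval \<open>[v, d]\<close> of length three a diamond \<open>v < p, q < c\<close> is a facet. The function that
vanishes at \<open>v\<close>, \<open>p\<close>, \<open>c\<close> and has value one at \<open>d\<close> defines its plane, and the other
diamonds at \<open>p\<close> and \<open>q\<close> lie on the positive side.\<close>

lemma plane_functional:
  assumes d: "diamond v p q c" and cd: "c \<lessdot> d"
  obtains f where "harm f v d" "f v = 0" "f p = 0" "f q = 0"
    and "\<And>s r c'. s = p \<or> s = q \<Longrightarrow> diamond v s r c' \<Longrightarrow> c' \<lessdot> d \<Longrightarrow> c' \<noteq> c \<Longrightarrow> 0 < f r"
proof -
  have c: "v \<lessdot> p" "p \<lessdot> c" "v \<lessdot> q" "q \<lessdot> c" using d by (auto simp: diamond_def)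
  obtain f where f: "f \<in> lin" "f v = 0" "f p = 0" "f c = 0" "f d = 1"
    using lin_chain[OF c(1,2) cd] by blast
  have bal: "balanced f x s r y" if "diamond x s r y" for x s r y
    using lin_balanced[OF f(1)] that unfolding diamond_def balanced_def by blast
  have fq: "f q = 0" using balanced_zero_mid[OF d bal[OF d] f(2,3,4)] .
  have "0 < f r" if s: "s = p \<or> s = q" "diamond v s r c'" "c' \<lessdot> d" "c' \<noteq> c" for s r c'
  proof -
    have fs: "f s = 0" using s f fq by auto
    have sd: "diamond s c c' d" using s c cd by (auto simp: diamond_def)
    have "0 < f c'" using balanced_pos_top_mid[OF sd bal[OF sd] fs] f by simp
    then show ?thesis using balanced_pos_top_mid[OF s(2) bal[OF s(2)]] f(2) fs by simp
  qed
  then show ?thesis using that[of f] f fq lin_harm by blast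
qed

text \<open>The vertex figure is the quadrangle \<open>a, a1, b, a2\<close> with the diagonals \<open>a b\<close> and \<open>a1 a2\<close>. The claim
expresses that the diagonals intersect: a function that is smaller at both ends of one diagonal
than at \<open>v\<close> is so at an end of the other one.\<close>

lemma four_cycle_convex:
  assumes dc1: "diamond v a a1 c1" and dc2: "diamond v a a2 c2" and de1: "diamond v b a1 e1" and de2: "diamond v b a2 e2"
    and top: "c1 \<lessdot> d" "c2 \<lessdot> d" "e1 \<lessdot> d" "e2 \<lessdot> d" and ne: "a \<noteq> b" "a1 \<noteq> a2"
    and F: "harm F v d" "F a < F v" "F b < F v"
  shows "F a1 < F v \<or> F a2 < F v"
proof (rule ccontr)
  assume "\<not> ?thesis"
  then have F12: "F v \<le> F a1" "F v \<le> F a2" by auto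
  have c12: "c1 \<noteq> c2" using diamond_mid[OF dc1, of a2] dc2 ne by (auto simp: diamond_def)
  have e12: "e1 \<noteq> e2" using diamond_mid[OF de1, of a2] de2 ne by (auto simp: diamond_def)
  have ce1: "c1 \<noteq> e1" using diamond_mid[OF dc1, of b] dc1 de1 ne by (auto simp: diamond_def)
  have ce2: "c2 \<noteq> e2" using diamond_mid[OF dc2, of b] dc2 de2 ne by (auto simp: diamond_def)
  obtain f1 where f1: "harm f1 v d" "f1 v = 0" "f1 b = 0" "f1 a1 = 0"
      and f1p: "\<And>s r c'. s = b \<or> s = a1 \<Longrightarrow> diamond v s r c' \<Longrightarrow> c' \<lessdot> d \<Longrightarrow> c' \<noteq> e1 \<Longrightarrow> 0 < f1 r"
    using plane_functional[OF de1 top(3)] by blast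
  obtain f2 where f2: "harm f2 v d" "f2 v = 0" "f2 b = 0" "f2 a2 = 0"
      and f2p: "\<And>s r c'. s = b \<or> s = a2 \<Longrightarrow> diamond v s r c' \<Longrightarrow> c' \<lessdot> d \<Longrightarrow> c' \<noteq> e2 \<Longrightarrow> 0 < f2 r"
    using plane_functional[OF de2 top(4)] by blast
  obtain g where g: "harm g v d" "g v = 0" "g a = 0" "g a1 = 0"
      and gp: "\<And>s r c'. s = a \<or> s = a1 \<Longrightarrow> diamond v s r c' \<Longrightarrow> c' \<lessdot> d \<Longrightarrow> c' \<noteq> c1 \<Longrightarrow> 0 < g r"
    using plane_functional[OF dc1 top(1)] by blast
  have f1a: "0 < f1 a" "0 < f1 a2" using f1p[OF _ diamond_sym[OF dc1] top(1) ce1] f1p[OF _ de2 top(4)] e12 by auto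
  have f2a: "0 < f2 a" "0 < f2 a1" using f2p[OF _ diamond_sym[OF dc2] top(2) ce2] f2p[OF _ de1 top(3) e12] by auto
  have ga: "0 < g a2" "0 < g b" using gp[OF _ dc2 top(2)] c12 gp[OF _ diamond_sym[OF de1] top(3)] ce1 by auto
  \<comment> \<open>Make \<open>F - F v\<close> vanish at \<open>a1\<close> and \<open>a2\<close>; it remains negative at \<open>a\<close> and \<open>b\<close>.\<close>
  define E where "E u = (F u - F v) + (- ((F a1 - F v) / f2 a1)) * f2 u + (- ((F a2 - F v) / f1 a2)) * f1 u" for u
  have Eh: "harm E v d" unfolding E_def by (intro harm_add harm_scale harm_diff harm_const f1 f2 F)
  have E: "E v = 0" "E a1 = 0" "E a2 = 0" "E b < 0"
    using f1 f2 f1a f2a F by (auto simp: E_def)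
  have "0 \<le> (F a1 - F v) / f2 a1 * f2 a" "0 \<le> (F a2 - F v) / f1 a2 * f1 a"
    using F12 f1a f2a by simp_all
  then have Ea: "E a < 0" using F(2) by (simp add: E_def)
  \<comment> \<open>Make it vanish at \<open>a\<close> as well, keeping the zeros at \<open>a1\<close> and \<open>a2\<close>. It is then zero at \<open>v\<close>
    and three atoms and has to vanish identically, although it is negative at \<open>b\<close>.\<close>
  define \<kappa> where "\<kappa> = - E a / f1 a"
  define \<mu> where "\<mu> = - \<kappa> * f1 a2 / g a2"
  have \<kappa>: "0 < \<kappa>" using Ea f1a by (simp add: \<kappa>_def divide_neg_pos)
  then have \<mu>: "\<mu> < 0" using f1a ga by (simp add: \<mu>_def)
  define Z where "Z u = E u + \<kappa> * f1 u + \<mu> * g u" for u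
  have Zh: "harm Z v d" unfolding Z_def by (intro harm_add harm_scale Eh f1 g)
  have bal: "balanced Z x s r y" if "diamond x s r y" "v \<preceq> x" "y \<preceq> d" for x s r y
    using harm_balanced[OF Zh that(1)] that by blast
  have Z: "Z v = 0" "Z a = 0" "Z a1 = 0" "Z a2 = 0"
    using E f1 g f1a ga by (auto simp: Z_def \<kappa>_def \<mu>_def)
  have "\<mu> * g b < 0" using \<mu> ga by (simp add: mult_neg_pos)
  then have Zb: "Z b < 0" using E f1 by (simp add: Z_def)
  have cov: "v \<lessdot> a" "v \<lessdot> a1" "a \<lessdot> c1" "a \<lessdot> c2" "a1 \<lessdot> c1" "a1 \<lessdot> e1" using dc1 dc2 de1 by (auto simp: diamond_def)
  have d1: "diamond a c1 c2 d" "diamond a1 c1 e1 d" using cov top c12 ce1 by (auto simp: diamond_def)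
  have "Z c1 = 0" "Z c2 = 0"
    using balanced_zero_top[OF dc1 bal[OF dc1]] balanced_zero_top[OF dc2 bal[OF dc2]] Z top by auto
  moreover from this have "Z d = 0" using balanced_zero_top[OF d1(1) bal[OF d1(1)]] Z cov by auto
  ultimately have "Z e1 = 0" using balanced_zero_mid[OF d1(2) bal[OF d1(2)]] Z cov by auto
  then have "Z b = 0"
    using balanced_zero_mid[OF diamond_sym[OF de1] bal[OF diamond_sym[OF de1]]] Z top by auto
  then show False using Zb by simp
qed

text \<open>Every atom of an interval of length three has at most two neighbours. Two atoms that are neither
equal nor adjacent leave room for only two more, hence are opposite vertices of a quadrangle, and
one of the remaining two vertices provides the connection.\<close>

lemma rank3_sublevel_connected:
  assumes F: "F \<in> lin" and rk: "rk w = rk v + 3" and a: "v \<lessdot> a" "a \<preceq> w" "F a < F v"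
    and b: "v \<lessdot> b" "b \<preceq> w" "F b < F v"
  shows "(\<lambda>p q. adj v w p q \<and> F p < F v \<and> F q < F v)\<^sup>*\<^sup>* a b"
proof -
  let ?R = "\<lambda>p q. adj v w p q \<and> F p < F v \<and> F q < F v"
  have cov_top: "c \<lessdot> w" if "diamond v p q c" "c \<preceq> w" for p q c
    using cov_of_rk[OF that(2)] diamond_rk[OF that(1)] rk by simp
  have two: "\<exists>p1 p2 c1 c2. diamond v p p1 c1 \<and> diamond v p p2 c2 \<and> c1 \<noteq> c2 \<and> c1 \<lessdot> w \<and> c2 \<lessdot> w
      \<and> (\<forall>q. adj v w p q \<longrightarrow> q = p1 \<or> q = p2)" if p: "v \<lessdot> p" "p \<preceq> w" for p
  proof -
    have "p \<noteq> w" using cov_rk[OF p(1)] rk by auto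
    then obtain c1 where c1: "p \<lessdot> c1" "c1 \<preceq> w" using le_first p by blast
    have c1w: "c1 \<lessdot> w" using cov_of_rk[OF c1(2)] cov_rk[OF c1(1)] cov_rk[OF p(1)] rk by simp
    obtain c2 where c2: "diamond p c1 c2 w" using diamond_ex[OF c1(1) c1w] by blast
    obtain p1 where p1: "diamond v p p1 c1" using diamond_ex p c1 by blast
    obtain p2 where p2: "diamond v p p2 c2" using diamond_ex[of v p c2] p c2 by (auto simp: diamond_def)
    have "q = p1 \<or> q = p2" if q: "adj v w p q" for q
    proof -
      obtain c where c: "diamond v p q c" "c \<preceq> w" using q unfolding adj_def by blast
      have "c = c1 \<or> c = c2" using diamond_mid[OF c2, of c] cov_top[OF c] c(1) by (auto simp: diamond_def)
      then show ?thesis using diamond_unique[OF p1, of q] diamond_unique[OF p2, of q] c(1) by blast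
    qed
    then show ?thesis using p1 p2 c2 by (auto simp: diamond_def)
  qed
  show ?thesis
  proof (cases "a = b \<or> adj v w a b")
    case True then show ?thesis using a b by auto
  next
    case False
    obtain a1 a2 c1 c2 where A: "diamond v a a1 c1" "diamond v a a2 c2" "c1 \<noteq> c2" "c1 \<lessdot> w" "c2 \<lessdot> w"
      "\<And>q. adj v w a q \<Longrightarrow> q = a1 \<or> q = a2" using two[OF a(1,2)] by blast
    obtain b1 b2 e1 e2 where B: "diamond v b b1 e1" "diamond v b b2 e2" "e1 \<noteq> e2" "e1 \<lessdot> w" "e2 \<lessdot> w"
      "\<And>q. adj v w b q \<Longrightarrow> q = b1 \<or> q = b2" using two[OF b(1,2)] by blast
    have distinct_nbrs: "p1 \<noteq> p2"
      if p: "diamond v p p1 c1" "diamond v p p2 c2" "c1 \<noteq> c2" "c1 \<lessdot> w" "c2 \<lessdot> w"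
        "\<And>q. adj v w p q \<Longrightarrow> q = p1 \<or> q = p2" "v \<lessdot> q" "q \<preceq> w" "q \<noteq> p" "\<not> adj v w p q" for p p1 p2 c1 c2 q
    proof
      assume eq: "p1 = p2"
      have cc: "diamond p1 c1 c2 w" using p(1-5) eq by (auto simp: diamond_def)
      have nb: "r = p" if r: "adj v w p1 r" for r
      proof -
        obtain c where c: "diamond v p1 r c" "c \<preceq> w" using r unfolding adj_def by blast
        have "c = c1 \<or> c = c2" using diamond_mid[OF cc, of c] cov_top[OF c] c(1) by (auto simp: diamond_def)
        then show ?thesis using diamond_unique[OF diamond_sym[OF p(1)], of r] diamond_unique[OF diamond_sym[OF p(2)], of r] c(1) eq by blast
      qed
      have pv: "v \<lessdot> p" "p \<preceq> w" using p(1,4) by (auto simp: diamond_def)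
      have "q = p \<or> q = p1"
      proof (rule atoms_connected_propagate[OF pv p(7,8)])
        fix s r c assume s: "diamond v s r c" "c \<preceq> w" "s = p \<or> s = p1"
        then have "adj v w s r" unfolding adj_def by blast
        then show "r = p \<or> r = p1" using s(3) p(6) nb eq by blast
      qed simp
      moreover have "adj v w p p1" using p(1,4) unfolding adj_def by blast
      ultimately show False using p(9,10) by blast
    qed
    have a12: "a1 \<noteq> a2" using distinct_nbrs[OF A, of b] b False by blast
    have nba: "\<not> adj v w b a" using False adj_sym by blast
    have b12: "b1 \<noteq> b2" using distinct_nbrs[OF B, of a] a False nba by blast
    have adjA: "adj v w a a1" "adj v w a a2" using A unfolding adj_def by blast+
    have adjB: "adj v w b b1" "adj v w b b2" using B unfolding adj_def by blast+
    let ?At = "{p. v \<lessdot> p \<and> p \<preceq> w}"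
    have atoms: "a1 \<in> ?At" "a2 \<in> ?At" "b1 \<in> ?At" "b2 \<in> ?At"
      using A(1,2,4,5) B(1,2,4,5) by (auto simp: diamond_def)
    have vw: "v \<preceq> w" using cov_le_trans a by blast
    have fin: "finite ?At" by (rule finite_subset[OF _ finite_S]) (auto dest: cov_S)
    have four: "card {a, b, a1, a2} = 4"
      using False a12 A(1,2) adjA by (auto simp: diamond_def card_insert_if)
    have "{a, b, a1, a2} = ?At"
    proof (rule card_subset_eq[OF fin])
      show "{a, b, a1, a2} \<subseteq> ?At" using a b atoms by blast
      show "card {a, b, a1, a2} = card ?At"
        using four few_atoms[OF vw rk] card_mono[OF fin \<open>{a, b, a1, a2} \<subseteq> ?At\<close>] by simp
    qed
    then have "b1 \<in> {a1, a2}" "b2 \<in> {a1, a2}"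
      using atoms adjB nba B(1,2) by (auto simp: diamond_def)
    then have "(b1 = a1 \<and> b2 = a2) \<or> (b1 = a2 \<and> b2 = a1)" using b12 by auto
    then obtain e1' e2' where e: "diamond v b a1 e1'" "diamond v b a2 e2'" "e1' \<lessdot> w" "e2' \<lessdot> w"
      using B by blast
    have "F a1 < F v \<or> F a2 < F v"
      using four_cycle_convex[OF A(1,2) e(1,2) A(4,5) e(3,4) _ a12 lin_harm[OF F] a(3) b(3)] False by blast
    moreover have "adj v w a1 b" "adj v w a2 b" using e adj_sym unfolding adj_def by blast+
    ultimately show ?thesis
      using adjA a b converse_rtranclp_into_rtranclp[of ?R a] by blast
  qed
qed

text \<open>Count the covers between atoms and coatoms in two ways: every atom lies below exactly two coatoms,
and every coatom lies above exactly two atoms.\<close>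

lemma card_coatoms:
  assumes rk: "rk w = rk v + 3"
  shows "card {b. b \<lessdot> w \<and> v \<preceq> b} = card {a. v \<lessdot> a \<and> a \<preceq> w}"
proof -
  let ?A = "{a. v \<lessdot> a \<and> a \<preceq> w}" and ?B = "{b. b \<lessdot> w \<and> v \<preceq> b}"
  have fin: "finite ?A" "finite ?B" by (rule finite_subset[OF _ finite_S]; auto dest: cov_S)+
  have A: "card {b\<in>?B. a \<lessdot> b} = 2" if a: "a \<in> ?A" for a
  proof -
    have "a \<noteq> w" using cov_rk[of v a] a rk by auto
    then obtain c where c: "a \<lessdot> c" "c \<preceq> w" using le_first a by blast
    then have cw: "c \<lessdot> w" using cov_of_rk[OF c(2)] cov_rk[OF c(1)] cov_rk[of v a] a rk by simp
    obtain c' where c': "diamond a c c' w" using diamond_ex[OF c(1) cw] by blast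
    have v: "v \<preceq> c" "v \<preceq> c'" using le_cov_trans[OF cov_le[of v a]] a c' by (simp_all add: diamond_def)
    have "{b\<in>?B. a \<lessdot> b} = {c, c'}"
    proof (intro Set.set_eqI iffI)
      show "b \<in> {c, c'}" if "b \<in> {b\<in>?B. a \<lessdot> b}" for b using diamond_mid[OF c', of b] that by simp
      show "b \<in> {b\<in>?B. a \<lessdot> b}" if "b \<in> {c, c'}" for b using v c' that by (auto simp: diamond_def)
    qed
    then show ?thesis using c' by (simp add: diamond_def card_insert_if)
  qed
  have B: "card {a\<in>?A. a \<lessdot> b} = 2" if b: "b \<in> ?B" for b
  proof -
    have "v \<noteq> b" using cov_rk[of b w] b rk by auto
    then obtain c where c: "v \<lessdot> c" "c \<preceq> b" using le_first b by blast
    then have cb: "c \<lessdot> b" using cov_of_rk[OF c(2)] cov_rk[OF c(1)] cov_rk[of b w] b rk by simp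
    obtain c' where c': "diamond v c c' b" using diamond_ex[OF c(1) cb] by blast
    have w: "c \<preceq> w" "c' \<preceq> w" using cov_le_trans[OF _ cov_le[of b w]] b c' by (simp_all add: diamond_def)
    have "{a\<in>?A. a \<lessdot> b} = {c, c'}"
    proof (intro Set.set_eqI iffI)
      show "a \<in> {c, c'}" if "a \<in> {a\<in>?A. a \<lessdot> b}" for a using diamond_mid[OF c', of a] that by simp
      show "a \<in> {a\<in>?A. a \<lessdot> b}" if "a \<in> {c, c'}" for a using w c' that by (auto simp: diamond_def)
    qed
    then show ?thesis using c' by (simp add: diamond_def card_insert_if)
  qed
  have "2 * card ?A = (\<Sum>a\<in>?A. card {b\<in>?B. a \<lessdot> b})" using A by simp
  also have "\<dots> = (\<Sum>a\<in>?A. \<Sum>b\<in>?B. if a \<lessdot> b then 1 else 0)"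
    by (simp only: card_eq_sum sum.inter_filter[OF fin(2)])
  also have "\<dots> = (\<Sum>b\<in>?B. \<Sum>a\<in>?A. if a \<lessdot> b then 1 else 0)" by (rule sum.swap)
  also have "\<dots> = (\<Sum>b\<in>?B. card {a\<in>?A. a \<lessdot> b})"
    by (simp only: card_eq_sum sum.inter_filter[OF fin(1)])
  also have "\<dots> = 2 * card ?B" using B by simp
  finally show ?thesis by simp
qed

lemma balanced_sign:
  assumes "diamond x p q y" "balanced F x p q y" "F x = F p"
  shows "F y < F p \<longleftrightarrow> F q < F x"
proof -
  note w = diamond_weights[OF assms(1)]
  have "wb x y * F x + wt x y * F y = (wb x y + wt x y - wm x q y) * F x + wm x q y * F q"
    using assms(2,3) w unfolding balanced_def by simp
  then have "wt x y * (F y - F x) = wm x q y * (F q - F x)" by (simp add: algebra_simps)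
  then have "wt x y * (F y - F x) < 0 \<longleftrightarrow> wm x q y * (F q - F x) < 0" by simp
  then show ?thesis using w assms(3) by (simp add: mult_less_0_iff)
qed

text \<open>Adding a small multiple of \<open>h\<close> makes all differences to the value at \<open>v\<close> nonzero without changing
the sign of the negative ones; then a small multiple of \<open>G\<close> separates the slopes.\<close>

lemma perturb_ratio:
  assumes A: "finite A" "A \<subseteq> {a. v \<lessdot> a}" and F: "harm F v w"
  obtains F' where "harm F' v w" "\<And>a. a \<in> A \<Longrightarrow> F' a < F' v \<longleftrightarrow> F a < F v"
    "inj_on (\<lambda>a. (F' a - F' v) / (h a - h v)) A"
proof -
  have hp: "0 < h a - h v" if "a \<in> A" for a using A that h_less by fastforce
  have "eventually (\<lambda>\<delta>. \<forall>a\<in>{a\<in>A. F a < F v}. F a + \<delta> * h a < F v + \<delta> * h v) (at_right 0)"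
    using A by (intro eventually_ball_finite) (auto intro: eventually_perturb_less)
  then obtain \<delta> where \<delta>: "\<delta> > 0" "\<And>a. a \<in> A \<Longrightarrow> F a < F v \<Longrightarrow> F a + \<delta> * h a < F v + \<delta> * h v"
    using eventually_right_ex by blast
  define F1 where "F1 u = F u + \<delta> * h u" for u
  have F1: "harm F1 v w" unfolding F1_def by (intro harm_add harm_scale F lin_harm h_lin)
  have lt: "F1 a < F1 v" if "a \<in> A" "F a < F v" for a using \<delta> that by (simp add: F1_def)
  have gt: "F1 v < F1 a" if "a \<in> A" "\<not> F a < F v" for a
    using that(2) mult_strict_left_mono[of "h v" "h a" \<delta>] \<delta>(1) hp[OF that(1)] unfolding F1_def by linarith
  define r where "r F a = (F a - F v) / (h a - h v)" for F :: "'a \<Rightarrow> real" and a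
  have rG: "r G a \<noteq> r G b" if "a \<in> A" "b \<in> A" "a \<noteq> b" for a b
    using G_ratio[of v a b] that A hp[OF that(1)] hp[OF that(2)] by (auto simp: r_def frac_eq_eq)
  have rGe: "eventually (\<lambda>\<epsilon>. r F1 a + \<epsilon> * r G a \<noteq> r F1 b + \<epsilon> * r G b) (at_right 0)"
    if "a \<in> A" "b \<in> A" "b \<noteq> a" for a b
    using eventually_perturb_neq[OF rG] that by blast
  have "eventually (\<lambda>\<epsilon>. (\<forall>a\<in>{a\<in>A. F a < F v}. F1 a + \<epsilon> * G a < F1 v + \<epsilon> * G v)
      \<and> (\<forall>a\<in>{a\<in>A. \<not> F a < F v}. F1 v + \<epsilon> * G v < F1 a + \<epsilon> * G a)
      \<and> (\<forall>a\<in>A. \<forall>b\<in>A-{a}. r F1 a + \<epsilon> * r G a \<noteq> r F1 b + \<epsilon> * r G b)) (at_right 0)"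
    using A by (intro eventually_conj eventually_ball_finite ballI)
      (auto intro: eventually_perturb_less lt gt rGe)
  from eventually_right_ex[OF this] obtain \<epsilon> where
      e1: "\<forall>a\<in>{a\<in>A. F a < F v}. F1 a + \<epsilon> * G a < F1 v + \<epsilon> * G v"
      and e2: "\<forall>a\<in>{a\<in>A. \<not> F a < F v}. F1 v + \<epsilon> * G v < F1 a + \<epsilon> * G a"
      and e3: "\<forall>a\<in>A. \<forall>b\<in>A-{a}. r F1 a + \<epsilon> * r G a \<noteq> r F1 b + \<epsilon> * r G b" by blast
  define F' where "F' u = F1 u + \<epsilon> * G u" for u
  have "harm F' v w" unfolding F'_def by (intro harm_add harm_scale F1 lin_harm G_lin)
  moreover have "F' a < F' v \<longleftrightarrow> F a < F v" if "a \<in> A" for a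
    using that e1 e2 by (cases "F a < F v") (force simp: F'_def)+
  moreover have "r F' a = r F1 a + \<epsilon> * r G a" for a
    by (simp add: r_def F'_def diff_divide_distrib add_divide_distrib algebra_simps)
  then have "inj_on (r F') A" using e3 by (intro inj_onI) (metis Diff_iff singletonD)
  then have "inj_on (\<lambda>a. (F' a - F' v) / (h a - h v)) A" by (simp add: r_def[abs_def])
  ultimately show ?thesis using that by blast
qed

text \<open>Induction on the length, by a mountain pass argument along the slopes \<open>\<rho>\<close> of \<open>F\<close> with respect to
the height \<open>h\<close>. At an atom \<open>q\<close> the function \<open>f = F' - \<rho>(q) h\<close> takes the same value at \<open>q\<close> as at \<open>v\<close>.
The diamonds that contain \<open>v\<close> and \<open>q\<close> translate the neighbours \<open>p\<close> of \<open>q\<close> with \<open>\<rho>(p) < \<rho>(q)\<close> into covers of \<open>q\<close> at which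
\<open>f\<close> is smaller than at \<open>q\<close>. These covers are connected by the induction hypothesis for \<open>[q, w]\<close>,
and a step between two of them, with upper end \<open>d\<close>, is carried back to the atoms by the
induction hypothesis for \<open>[v, d]\<close>.\<close>

lemma sublevel_connected:
  assumes "harm F v w" "v \<lessdot> a" "a \<preceq> w" "F a < F v" "v \<lessdot> b" "b \<preceq> w" "F b < F v"
  shows "(\<lambda>p q. adj v w p q \<and> F p < F v \<and> F q < F v)\<^sup>*\<^sup>* a b"
  using assms
proof (induction "nat (rk w - rk v)" arbitrary: v w a b F rule: less_induct)
  case less
  let ?Q = "\<lambda>F v w p q. adj v w p q \<and> F p < F v \<and> F q < (F v :: real)"
  have vw: "v \<preceq> w" using less.prems by (meson cov_le_trans)
  have rka: "rk a = rk v + 1" "rk b = rk v + 1" "rk a \<le> rk w" using cov_rk[of v a] cov_rk[of v b] less.prems le_rk[of a w] by auto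
  consider "rk w = rk v + 1" | "rk w = rk v + 2" | "rk w = rk v + 3" | "rk w \<ge> rk v + 4" using rka by linarith
  then show ?case
  proof cases
    case 1
    then have "a = w" "b = w" using le_rk_eq less.prems rka by auto
    then show ?thesis by simp
  next
    case 2
    then have "a \<lessdot> w" "b \<lessdot> w" using cov_of_rk less.prems rka by auto
    then have "a = b \<or> ?Q F v w a b" using less.prems by (auto simp: adj_def diamond_def)
    then show ?thesis by auto
  next
    case 3
    obtain f where f: "f \<in> lin" "\<And>u. v \<preceq> u \<Longrightarrow> u \<preceq> w \<Longrightarrow> f u = F u"
      using rank3_lin[OF less.prems(1) vw 3] by blast
    have eq: "f p = F p" if "v \<lessdot> p" "p \<preceq> w" for p using f(2) that by blast
    have fv: "f v = F v" using f(2) vw by blast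
    have "(?Q f v w)\<^sup>*\<^sup>* a b"
      by (rule rank3_sublevel_connected[OF f(1) 3]) (use less.prems eq fv in auto)
    then show ?thesis
    proof (rule rtranclp_mono[THEN predicate2D, rotated], intro predicate2I)
      fix p q assume pq: "?Q f v w p q"
      then obtain c where "diamond v p q c" "c \<preceq> w" unfolding adj_def by blast
      then have "v \<lessdot> p" "v \<lessdot> q" "p \<preceq> w" "q \<preceq> w" using diamond_le by (blast intro: cov_le_trans)+
      then show "?Q F v w p q" using pq eq fv by auto
    qed
  next
    case 4
    define V where "V = {p. v \<lessdot> p \<and> p \<preceq> w}"
    have V: "finite V" "V \<subseteq> {a. v \<lessdot> a}" using finite_atoms[of v "\<lambda>p. p \<preceq> w"] by (auto simp: V_def)
    obtain F' where F': "harm F' v w" and sgn: "\<And>a. a \<in> V \<Longrightarrow> F' a < F' v \<longleftrightarrow> F a < F v"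
      and inj: "inj_on (\<lambda>a. (F' a - F' v) / (h a - h v)) V"
      using perturb_ratio[OF V less.prems(1)] by blast
    define \<rho> where "\<rho> a = (F' a - F' v) / (h a - h v)" for a
    have hp: "0 < h a - h v" if "a \<in> V" for a using h_less that by (auto simp: V_def)
    have \<rho>neg: "\<rho> p < 0 \<longleftrightarrow> F p < F v" if "p \<in> V" for p
      using sgn[OF that] hp[OF that] by (simp add: \<rho>_def divide_less_0_iff)
    have adjV: "p \<in> V \<and> q \<in> V \<and> adj v w q p" if "adj v w p q" for p q
      using that adj_sym diamond_le unfolding adj_def V_def by (blast intro: cov_le_trans)
    have "(\<lambda>p q. adj v w p q \<and> \<rho> p < 0 \<and> \<rho> q < 0)\<^sup>*\<^sup>* a b"
    proof (rule mountain_pass[OF V(1)])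
      show "inj_on \<rho> V" using inj by (simp add: \<rho>_def[abs_def])
      show "(adj v w)\<^sup>*\<^sup>* a b" using atoms_connected less.prems by blast
      show "\<rho> a < 0" "\<rho> b < 0" using \<rho>neg less.prems by (auto simp: V_def)
    next
      fix q p1 p2 assume q: "adj v w q p1" "adj v w q p2" "\<rho> p1 < \<rho> q" "\<rho> p2 < \<rho> q"
      have qV: "q \<in> V" using adjV q by blast
      define f where "f u = F' u - \<rho> q * h u" for u
      have fh: "harm f v w" unfolding f_def by (intro harm_diff harm_scale F' lin_harm h_lin)
      have fq: "f v = f q" using hp[OF qV] by (simp add: f_def \<rho>_def field_simps)
      have fp: "f p < f v \<longleftrightarrow> \<rho> p < \<rho> q" if "p \<in> V" for p
      proof -
        have "\<rho> p < \<rho> q \<longleftrightarrow> F' p - F' v < \<rho> q * (h p - h v)"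
          using hp[OF that] by (simp add: \<rho>_def[of p] divide_less_eq)
        then show ?thesis by (auto simp: f_def algebra_simps)
      qed
      obtain c1 where c1: "diamond v q p1 c1" "c1 \<preceq> w" using q(1) unfolding adj_def by blast
      obtain c2 where c2: "diamond v q p2 c2" "c2 \<preceq> w" using q(2) unfolding adj_def by blast
      have low: "f c < f q \<longleftrightarrow> f p < f v" if "diamond v q p c" "c \<preceq> w" for p c
        using balanced_sign[OF that(1) harm_balanced[OF fh that(1)] fq] that by blast
      have fqh: "harm f q w" using harm_mono[OF fh] qV by (auto simp: V_def)
      have lt: "nat (rk w - rk q) < nat (rk w - rk v)" using qV cov_rk[of v q] 4 by (auto simp: V_def)
      have ql: "q \<lessdot> c1" "q \<lessdot> c2" using c1 c2 by (auto simp: diamond_def)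
      have "f c1 < f q" "f c2 < f q"
        using low[OF c1] low[OF c2] fp q adjV by blast+
      then have path: "(?Q f q w)\<^sup>*\<^sup>* c1 c2"
        using less.hyps[OF lt fqh ql(1) c1(2) _ ql(2) c2(2)] by blast
      let ?R = "\<lambda>x y. adj v w x y \<and> \<rho> x < \<rho> q \<and> \<rho> y < \<rho> q"
      have "\<forall>p. diamond v q p c \<longrightarrow> ?R\<^sup>*\<^sup>* p1 p" if "(?Q f q w)\<^sup>*\<^sup>* c1 c" for c
        using that
      proof (induction rule: rtranclp_induct)
        case base then show ?case using diamond_unique[OF c1(1)] by blast
      next
        case (step c c')
        show ?case
        proof (intro allI impI)
          fix p' assume p': "diamond v q p' c'"
          obtain d where d: "diamond q c c' d" "d \<preceq> w" using step(2) unfolding adj_def by blast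
          note dl = diamond_le[OF d(1)]
          have cw: "c \<preceq> w" "c' \<preceq> w" using dl d(2) by (auto intro: cov_le_trans)
          obtain p where p: "diamond v q p c" using diamond_ex[of v q c] p' dl by (auto simp: diamond_def)
          have fpp: "f p < f v" "f p' < f v" using low[OF p cw(1)] low[OF p' cw(2)] step(2) by auto
          have pd: "v \<lessdot> p" "p \<preceq> d" "v \<lessdot> p'" "p' \<preceq> d"
            using diamond_le[OF p] diamond_le[OF p'] dl by (blast intro: cov_le_trans cov_le)+
          have rkd: "rk d = rk v + 3" using diamond_rk[OF p] cov_rk[of c d] dl by simp
          then have lt': "nat (rk d - rk v) < nat (rk w - rk v)" using 4 by simp
          have "harm f v d" using harm_mono[OF fh] d by blast
          then have "(?Q f v d)\<^sup>*\<^sup>* p p'"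
            using less.hyps[OF lt' _ pd(1,2) fpp(1) pd(3,4) fpp(2)] by blast
          then have "?R\<^sup>*\<^sup>* p p'"
          proof (rule rtranclp_mono[THEN predicate2D, rotated], intro predicate2I)
            fix x y assume xy: "?Q f v d x y"
            then have "adj v w x y" using d(2) unfolding adj_def by (meson le_trans)
            then show "?R x y" using xy fp adjV by blast
          qed
          then show "?R\<^sup>*\<^sup>* p1 p'" using step(3) p by (meson rtranclp_trans)
        qed
      qed
      then show "?R\<^sup>*\<^sup>* p1 p2" using path c2 by blast
    qed (use adjV in blast)
    then show ?thesis
    proof (rule rtranclp_mono[THEN predicate2D, rotated], intro predicate2I)
      fix p q assume "adj v w p q \<and> \<rho> p < 0 \<and> \<rho> q < 0"
      then show "?Q F v w p q" using adjV \<rho>neg by blast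
    qed
  qed
qed

end

section \<open>Facet functions\<close>

text \<open>The assumptions are those of \<open>convex_poset\<close> for the order and for its dual, which allows every
statement to be read upside down.\<close>

locale biconvex_poset =
  up: convex_poset S cov rk wb wt wm lin lab h G +
  down: convex_poset S "\<lambda>x y. cov y x" "\<lambda>x. - rk x" "\<lambda>x y. wt y x" "\<lambda>x y. wb y x" "\<lambda>x p y. wm y p x" lin lab' "\<lambda>x. - h x" G
  for S :: "'a set" and cov (infix \<open>\<lessdot>\<close> 50) and rk wb wt wm lin lab lab' h G
begin

lemma dual:
  "biconvex_poset S (\<lambda>x y. cov y x) (\<lambda>x. - rk x) (\<lambda>x y. wt y x) (\<lambda>x y. wb y x) (\<lambda>x p y. wm y p x) lin lab' lab (\<lambda>x. - h x) G"
  unfolding biconvex_poset_def using up.convex_poset_axioms down.convex_poset_axioms by simp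

lemma down_le [simp]: "(\<lambda>x y. cov y x)\<^sup>*\<^sup>* x y \<longleftrightarrow> cov\<^sup>*\<^sup>* y x"
  by (rule rtranclp_swap)

lemma down_diamond [simp]: "down.diamond x p q y \<longleftrightarrow> up.diamond y p q x"
  unfolding up.diamond_def down.diamond_def by auto

lemma down_balanced [simp]: "down.balanced F x p q y \<longleftrightarrow> up.balanced F y p q x"
  unfolding up.balanced_def down.balanced_def by (auto simp: add.commute)

lemma down_harm [simp]: "down.harm F x y \<longleftrightarrow> up.harm F y x"
  unfolding up.harm_def down.harm_def by auto

abbreviation interval where "interval v w \<equiv> {u. v \<preceq> u \<and> u \<preceq> w}"

lemma finite_interval: "finite (interval v w)"
proof -
  have "interval v w \<subseteq> insert v S"
  proof
    fix u assume "u \<in> interval v w"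
    then show "u \<in> insert v S" using up.le_last[of v u] up.cov_S by blast
  qed
  then show ?thesis using up.finite_S finite_subset by blast
qed

definition hasse where
  "hasse v w x y \<longleftrightarrow> x \<in> interval v w \<and> y \<in> interval v w \<and> (x \<lessdot> y \<or> y \<lessdot> x)"

lemma balanced_mid_side:
  assumes "up.diamond x p q y" "up.balanced F x p q y" "F x < F p" "F y < F p"
  shows "F q < F p"
proof -
  note w = up.diamond_weights[OF assms(1)]
  have "wb x y * F x < wb x y * F p" "wt x y * F y < wt x y * F p" using w assms(3,4) by simp_all
  then have "wm x p y * F p + wm x q y * F q < (wb x y + wt x y) * F p"
    using assms(2) unfolding up.balanced_def by (simp add: distrib_right)
  also have "\<dots> = wm x p y * F p + wm x q y * F p" using w by (simp add: distrib_right)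
  finally show ?thesis using w by simp
qed

lemma balanced_top:
  assumes "up.diamond x p q y" "up.balanced F x p q y" "F p < F x" "F q < F x"
  shows "F y < F x"
proof -
  note w = up.diamond_weights[OF assms(1)]
  have "wm x p y * F p < wm x p y * F x" "wm x q y * F q < wm x q y * F x" using w assms(3,4) by simp_all
  then have "wb x y * F x + wt x y * F y < (wm x p y + wm x q y) * F x"
    using assms(2) unfolding up.balanced_def by (simp add: distrib_right)
  also have "\<dots> = wb x y * F x + wt x y * F x" using w by (simp add: distrib_right[symmetric])
  finally show ?thesis using w by simp
qed

text \<open>Two adjacent atoms with smaller values are joined in the Hasse diagram through the top of their
diamond, whose value is smaller as well.\<close>

lemma hasse_pass_up:
  assumes F: "up.harm F v w" and q: "q \<in> interval v w" and p1: "q \<lessdot> p1" "p1 \<preceq> w" "F p1 < F q"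
    and p2: "q \<lessdot> p2" "p2 \<preceq> w" "F p2 < F q"
  shows "(\<lambda>x y. hasse v w x y \<and> F x < F q \<and> F y < F q)\<^sup>*\<^sup>* p1 p2"
proof -
  let ?R = "\<lambda>x y. hasse v w x y \<and> F x < F q \<and> F y < F q"
  have Fq: "up.harm F q w" using up.harm_mono[OF F] q by blast
  have "(\<lambda>x y. up.adj q w x y \<and> F x < F q \<and> F y < F q)\<^sup>*\<^sup>* p1 p2"
    by (rule up.sublevel_connected[OF Fq p1 p2])
  then show ?thesis
  proof (induction rule: rtranclp_induct)
    case (step y z)
    then obtain c where c: "up.diamond q y z c" "c \<preceq> w" unfolding up.adj_def by blast
    have "F c < F q" using balanced_top[OF c(1) up.harm_balanced[OF Fq c(1)]] c(2) step(2) by blast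
    moreover have "hasse v w y c" "hasse v w c z"
    proof -
      have d: "q \<lessdot> y" "y \<lessdot> c" "q \<lessdot> z" "z \<lessdot> c" using c(1) by (simp_all add: up.diamond_def)
      have vq: "v \<preceq> q" using q by simp
      have "v \<preceq> y" "v \<preceq> z" using up.le_cov_trans[OF vq] d by simp_all
      moreover from this have "v \<preceq> c" using up.le_cov_trans d(2) by metis
      moreover have "y \<preceq> w" "z \<preceq> w" using up.cov_le_trans[OF _ c(2)] d by simp_all
      ultimately show "hasse v w y c" "hasse v w c z" using d c(2) by (simp_all add: hasse_def)
    qed
    ultimately have "?R y c" "?R c z" using step(2) by blast+
    then show ?case by (rule rtranclp.rtrancl_into_rtrancl[OF rtranclp.rtrancl_into_rtrancl[OF step(3)]])
  qed simp
qed

lemma hasse_sym: "hasse v w x y \<Longrightarrow> hasse v w y x"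
  by (auto simp: hasse_def)

lemma hasse_connected: "x \<in> interval v w \<Longrightarrow> (hasse v w)\<^sup>*\<^sup>* v x"
proof -
  have "v \<preceq> x \<Longrightarrow> x \<preceq> w \<longrightarrow> (hasse v w)\<^sup>*\<^sup>* v x"
  proof (induction rule: rtranclp_induct)
    case (step y z)
    show ?case
    proof
      assume z: "z \<preceq> w"
      then have y: "y \<preceq> w" using step by (blast intro: up.cov_le_trans)
      have "v \<preceq> z" using up.le_cov_trans[OF step(1,2)] .
      then have "hasse v w y z" using step(1,2) y z by (simp add: hasse_def)
      then show "(hasse v w)\<^sup>*\<^sup>* v z" using step(3) y rtranclp.rtrancl_into_rtrancl[of "hasse v w" v y z] by blast
    qed
  qed simp
  then show "x \<in> interval v w \<Longrightarrow> (hasse v w)\<^sup>*\<^sup>* v x" by blast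
qed

end

lemma (in biconvex_poset) hasse_dual:
  "biconvex_poset.hasse (\<lambda>x y. cov y x) w v = hasse v w"
  by (auto simp: biconvex_poset.hasse_def[OF dual] hasse_def fun_eq_iff)

context biconvex_poset begin

lemma hasse_pass_down:
  assumes F: "up.harm F v w" and q: "q \<in> interval v w" and p1: "p1 \<lessdot> q" "v \<preceq> p1" "F p1 < F q"
    and p2: "p2 \<lessdot> q" "v \<preceq> p2" "F p2 < F q"
  shows "(\<lambda>x y. hasse v w x y \<and> F x < F q \<and> F y < F q)\<^sup>*\<^sup>* p1 p2"
  using biconvex_poset.hasse_pass_up[OF dual, of F w v q p1 p2] assms by (simp add: hasse_dual conj_commute)

text \<open>The mountain pass condition for two neighbours of \<open>q\<close> follows from the connectedness of sublevel
sets of atoms if both are above \<open>q\<close>, from its dual if both are below \<open>q\<close>, and otherwise from the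
diamond that contains \<open>q\<close> and both neighbours.\<close>

lemma hasse_sublevel_connected:
  assumes F: "up.harm F v w" and inj: "inj_on F (interval v w)"
    and a: "a \<in> interval v w" "F a < t" and b: "b \<in> interval v w" "F b < t"
  shows "(\<lambda>x y. hasse v w x y \<and> F x < t \<and> F y < t)\<^sup>*\<^sup>* a b"
proof (rule mountain_pass[OF finite_interval _ inj])
  show "hasse v w x y \<Longrightarrow> x \<in> interval v w \<and> y \<in> interval v w \<and> hasse v w y x" for x y
    by (auto simp: hasse_def)
  have "(hasse v w)\<^sup>*\<^sup>* a v"
    using hasse_connected[OF a(1)] symp_rtranclp[of "hasse v w"] hasse_sym by (metis sympD sympI)
  then show "(hasse v w)\<^sup>*\<^sup>* a b" using hasse_connected[OF b(1)] by simp
next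
  fix q p1 p2 assume q: "hasse v w q p1" "hasse v w q p2" "F p1 < F q" "F p2 < F q"
  let ?R = "\<lambda>x y. hasse v w x y \<and> F x < F q \<and> F y < F q"
  have qi: "q \<in> interval v w" and pi: "p1 \<in> interval v w" "p2 \<in> interval v w" using q by (auto simp: hasse_def)
  have cross: "?R\<^sup>*\<^sup>* p p' \<and> ?R\<^sup>*\<^sup>* p' p" if p: "p \<lessdot> q" "q \<lessdot> p'" "F p < F q" "F p' < F q" "p \<in> interval v w" "p' \<in> interval v w" for p p'
  proof -
    obtain r where r: "up.diamond p q r p'" using up.diamond_ex p by blast
    have "up.balanced F p q r p'" using up.harm_balanced[OF F r] p by blast
    then have "F r < F q" using balanced_mid_side[OF r] p by blast
    moreover have "hasse v w p r" "hasse v w r p'"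
    proof -
      have d: "p \<lessdot> r" "r \<lessdot> p'" using r by (simp_all add: up.diamond_def)
      have "v \<preceq> r" using up.le_cov_trans[OF _ d(1)] p(5) by simp
      moreover have "r \<preceq> w" using up.cov_le_trans[OF d(2)] p(6) by simp
      ultimately show "hasse v w p r" "hasse v w r p'" using d p(5,6) by (simp_all add: hasse_def)
    qed
    ultimately have R: "?R p r" "?R r p'" "?R p' r" "?R r p" using p hasse_sym by blast+
    show ?thesis
      using converse_rtranclp_into_rtranclp[of ?R, OF R(1) r_into_rtranclp[of ?R, OF R(2)]]
        converse_rtranclp_into_rtranclp[of ?R, OF R(3) r_into_rtranclp[of ?R, OF R(4)]] by blast
  qed
  consider "q \<lessdot> p1" "q \<lessdot> p2" | "p1 \<lessdot> q" "p2 \<lessdot> q" | "q \<lessdot> p1" "p2 \<lessdot> q" | "p1 \<lessdot> q" "q \<lessdot> p2"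
    using q by (auto simp: hasse_def)
  then show "?R\<^sup>*\<^sup>* p1 p2"
  proof cases
    case 1 then show ?thesis using hasse_pass_up[OF F qi] q pi by auto
  next
    case 2 then show ?thesis using hasse_pass_down[OF F qi] q pi by auto
  next
    case 3 then show ?thesis using cross q pi by blast
  next
    case 4 then show ?thesis using cross q pi by blast
  qed
qed (use a b in auto)

text \<open>After a generic perturbation the values are distinct. The sublevel set that has the higher one of
two local minima as its highest element could not be connected.\<close>

lemma local_min_unique:
  assumes F: "up.harm F v w" and a: "a \<in> interval v w" and b: "b \<in> interval v w"
    and mina: "\<And>p. hasse v w a p \<Longrightarrow> F a < F p" and minb: "\<And>p. hasse v w b p \<Longrightarrow> F b < F p"
  shows "a = b"
proof (rule ccontr)
  assume ab: "a \<noteq> b"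
  let ?I = "interval v w"
  have "v \<in> S"
  proof -
    obtain u where "u \<in> ?I" "u \<noteq> v" using a b ab by blast
    then show ?thesis using up.le_first[of v u] up.cov_S by blast
  qed
  then have IS: "?I \<subseteq> S" using up.le_last up.cov_S by blast
  have G: "G x \<noteq> G y" if "x \<in> ?I" "y \<in> ?I" "y \<noteq> x" for x y
    using up.G_inj IS that by (metis inj_onD subsetD)
  have fins: "finite {p\<in>?I. hasse v w c p}" for c by (rule finite_subset[OF _ finite_interval]) blast
  have "eventually (\<lambda>\<epsilon>. (\<forall>p\<in>{p\<in>?I. hasse v w a p}. F a + \<epsilon> * G a < F p + \<epsilon> * G p)
      \<and> (\<forall>p\<in>{p\<in>?I. hasse v w b p}. F b + \<epsilon> * G b < F p + \<epsilon> * G p)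
      \<and> (\<forall>x\<in>?I. \<forall>y\<in>?I - {x}. F x + \<epsilon> * G x \<noteq> F y + \<epsilon> * G y)) (at_right 0)"
  proof (intro eventually_conj eventually_ball_finite ballI)
    show "eventually (\<lambda>\<epsilon>. F x + \<epsilon> * G x \<noteq> F y + \<epsilon> * G y) (at_right 0)" if "x \<in> ?I" "y \<in> ?I - {x}" for x y
      using eventually_perturb_neq[OF G] that by blast
  qed (use finite_interval fins[of a] fins[of b] mina minb eventually_perturb_less in auto)
  from eventually_right_ex[OF this] obtain \<epsilon> where
      e: "\<forall>p\<in>{p\<in>?I. hasse v w a p}. F a + \<epsilon> * G a < F p + \<epsilon> * G p"
      "\<forall>p\<in>{p\<in>?I. hasse v w b p}. F b + \<epsilon> * G b < F p + \<epsilon> * G p"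
      "\<forall>x\<in>?I. \<forall>y\<in>?I - {x}. F x + \<epsilon> * G x \<noteq> F y + \<epsilon> * G y" by blast
  define F' where "F' u = F u + \<epsilon> * G u" for u
  have F': "up.harm F' v w" unfolding F'_def by (intro up.harm_add up.harm_scale F up.lin_harm up.G_lin)
  have inj: "inj_on F' ?I" using e(3) unfolding F'_def by (intro inj_onI) (metis Diff_iff singletonD)
  have min: "F' x < F' p" if "hasse v w x p" "x = a \<or> x = b" for x p
  proof -
    have "p \<in> ?I" using that by (simp add: hasse_def)
    then show ?thesis using e(1,2) that unfolding F'_def by blast
  qed
  have no: False if xy: "x \<in> ?I" "y \<in> ?I" "x = a \<or> x = b" "x \<noteq> y" "F' y < F' x" for x y
  proof -
    have first: "\<exists>p. hasse v w x p \<and> F' p \<le> F' x" if "(\<lambda>p q. hasse v w p q \<and> F' p < t \<and> F' q < t)\<^sup>*\<^sup>* x y" "\<forall>u\<in>?I. F' u < t \<longrightarrow> F' u \<le> F' x" for t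
      using that(1)
    proof (cases rule: converse_rtranclpE)
      case base then show ?thesis using xy by simp
    next
      case (step z) then show ?thesis using that(2) by (auto simp: hasse_def)
    qed
    \<comment> \<open>No value lies strictly between \<open>F' x\<close> and \<open>t\<close>, so \<open>x\<close> is the highest element below \<open>t\<close>.\<close>
    define t where "t = (if {u\<in>?I. F' x < F' u} = {} then F' x + 1 else Min (F' ` {u\<in>?I. F' x < F' u}))"
    have fin: "finite {u\<in>?I. F' x < F' u}" by (rule finite_subset[OF _ finite_interval]) blast
    have xt: "F' x < t"
    proof (cases "{u\<in>?I. F' x < F' u} = {}")
      case False
      then have "Min (F' ` {u\<in>?I. F' x < F' u}) \<in> F' ` {u\<in>?I. F' x < F' u}" using fin by (intro Min_in) auto
      then show ?thesis using False unfolding t_def by auto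
    qed (simp add: t_def)
    have "\<forall>u\<in>?I. F' u < t \<longrightarrow> F' u \<le> F' x"
    proof (intro ballI impI)
      fix u assume u: "u \<in> ?I" "F' u < t"
      show "F' u \<le> F' x"
      proof (rule ccontr)
        assume "\<not> F' u \<le> F' x"
        then have "u \<in> {u\<in>?I. F' x < F' u}" using u by auto
        then have "t \<le> F' u" unfolding t_def using fin by auto
        then show False using u by simp
      qed
    qed
    moreover have "(\<lambda>p q. hasse v w p q \<and> F' p < t \<and> F' q < t)\<^sup>*\<^sup>* x y"
      by (rule hasse_sublevel_connected[OF F' inj]) (use xy xt in auto)
    ultimately obtain p where "hasse v w x p" "F' p \<le> F' x" using first by blast
    then show False using min xy by fastforce
  qed
  have "F' a \<noteq> F' b" using inj ab a b by (auto dest: inj_onD)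
  then show False using no[of a b] no[of b a] a b ab by fastforce
qed

text \<open>The subinterval \<open>[a, w]\<close> is to become a facet of the polytope of \<open>[v, w]\<close>; the function is its
defining inequality, normalised by the value \<open>-1\<close> at \<open>v\<close>.\<close>

definition upper_facet where
  "upper_facet v w a g \<longleftrightarrow> v \<lessdot> a \<and> a \<preceq> w \<and> up.harm g v w \<and> (\<forall>u\<in>interval a w. g u = 0) \<and> g v = -1"

definition lower_facet where
  "lower_facet v w b g \<longleftrightarrow> b \<lessdot> w \<and> v \<preceq> b \<and> up.harm g v w \<and> (\<forall>u\<in>interval v b. g u = 0) \<and> g w = -1"

text \<open>Suppose that \<open>g\<close> is nonnegative at some element that is not above \<open>a\<close>. Then its maximum \<open>m\<close> is
attained outside \<open>[a, w]\<close>; let \<open>x\<close> be of smallest rank with this property. For small \<open>\<epsilon>\<close> the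
function \<open>- g + \<epsilon> h\<close> has local minima both at \<open>x\<close> and at \<open>a\<close>: inside the interval the
elements covered by \<open>x\<close> have values of \<open>g\<close> below \<open>m\<close>, the only element covered by \<open>a\<close> is \<open>v\<close>, and
upwards \<open>h\<close> increases.\<close>

lemma upper_facet_neg:
  assumes g: "upper_facet v w a g" and u: "u \<in> interval v w" "\<not> a \<preceq> u"
  shows "g u < 0"
proof -
  let ?I = "interval v w"
  have a: "v \<lessdot> a" "a \<preceq> w" and gh: "up.harm g v w" and g0: "\<And>u. a \<preceq> u \<Longrightarrow> u \<preceq> w \<Longrightarrow> g u = 0" and gv: "g v = -1"
    using g by (auto simp: upper_facet_def)
  have aI: "a \<in> ?I" using a by auto
  have "\<not> (0 \<le> g u)"
  proof
    assume gu: "0 \<le> g u"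
    define m where "m = Max (g ` ?I)"
    define M where "M = {x \<in> ?I. g x = m}"
    have fin: "finite (g ` ?I)" using finite_interval by blast
    have gm: "g x \<le> m" if "x \<in> ?I" for x unfolding m_def using fin that by (intro Max_ge) auto
    have below: "\<exists>x\<in>M. \<not> a \<preceq> x"
    proof (cases "m = 0")
      case True then have "u \<in> M" using gm[OF u(1)] gu u by (simp add: M_def)
      then show ?thesis using u by blast
    next
      case False
      have "m \<in> g ` ?I" unfolding m_def using fin u(1) by (intro Max_in) blast+
      then obtain x where x: "x \<in> ?I" "g x = m" by blast
      then have "\<not> a \<preceq> x" using g0[of x] False by auto
      then show ?thesis using x by (auto simp: M_def)
    qed
    have "finite {x\<in>M. \<not> a \<preceq> x}" unfolding M_def by (rule finite_subset[OF _ finite_interval]) blast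
    then obtain x where x: "x \<in> {x\<in>M. \<not> a \<preceq> x}" and xmin: "\<And>y. y \<in> {x\<in>M. \<not> a \<preceq> x} \<Longrightarrow> rk x \<le> rk y"
      using below arg_min_if_finite(1)[of "{x\<in>M. \<not> a \<preceq> x}" rk] arg_min_least[of "{x\<in>M. \<not> a \<preceq> x}" _ rk] by (metis (no_types, lifting) empty_iff mem_Collect_eq)
    have xI: "x \<in> ?I" "g x = m" "\<not> a \<preceq> x" using x by (auto simp: M_def)
    have xdown: "g p < m" if "p \<lessdot> x" "p \<in> ?I" for p
    proof (rule ccontr)
      assume "\<not> g p < m"
      then have "p \<in> M" using gm[OF that(2)] that by (simp add: M_def)
      moreover have "\<not> a \<preceq> p" using xI that up.le_cov_trans by blast
      ultimately show False using xmin[of p] up.cov_rk[OF that(1)] by auto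
    qed
    have adown: "p = v" if "p \<lessdot> a" "p \<in> ?I" for p
      using up.le_rk_eq[of v p] up.cov_rk[OF that(1)] up.cov_rk[OF a(1)] that by simp
    have fins: "finite {p\<in>?I. p \<lessdot> x}" by (rule finite_subset[OF _ finite_interval]) blast
    have "eventually (\<lambda>\<epsilon>. (\<forall>p\<in>{p\<in>?I. p \<lessdot> x}. - g x + \<epsilon> * h x < - g p + \<epsilon> * h p)
        \<and> (- g a + \<epsilon> * h a < - g v + \<epsilon> * h v)) (at_right 0)"
    proof (intro eventually_conj eventually_ball_finite ballI eventually_perturb_less)
      show "- g a < - g v" using g0[of a] a gv by simp
    qed (use fins xdown xI in auto)
    from eventually_right_ex[OF this] obtain \<epsilon> where e: "\<epsilon> > 0"
        "\<And>p. p \<in> ?I \<Longrightarrow> p \<lessdot> x \<Longrightarrow> - g x + \<epsilon> * h x < - g p + \<epsilon> * h p"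
        "- g a + \<epsilon> * h a < - g v + \<epsilon> * h v" by blast
    define F where "F u = (-1) * g u + \<epsilon> * h u" for u
    have F: "up.harm F v w" unfolding F_def by (intro up.harm_add up.harm_scale gh up.lin_harm up.h_lin)
    have "x = a"
    proof (rule local_min_unique[OF F xI(1) aI])
      fix p assume p: "hasse v w x p"
      then have pI: "p \<in> ?I" by (simp add: hasse_def)
      show "F x < F p"
      proof (cases "p \<lessdot> x")
        case True then show ?thesis using e(2)[OF pI] by (simp add: F_def)
      next
        case False
        then have "h x < h p" using p up.h_less by (auto simp: hasse_def)
        then have "\<epsilon> * h x < \<epsilon> * h p" using e(1) by simp
        then show ?thesis using gm[OF pI] xI(2) by (simp add: F_def)
      qed
    next
      fix p assume p: "hasse v w a p"
      then have pI: "p \<in> ?I" by (simp add: hasse_def)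
      show "F a < F p"
      proof (cases "p \<lessdot> a")
        case True then show ?thesis using adown[OF True pI] e(3) by (simp add: F_def)
      next
        case False
        then have ap: "a \<lessdot> p" using p by (auto simp: hasse_def)
        then have "h a < h p" using up.h_less by blast
        then have "\<epsilon> * h a < \<epsilon> * h p" using e(1) by simp
        moreover have "g p = 0" "g a = 0" using g0 ap pI a by auto
        ultimately show ?thesis by (simp add: F_def)
      qed
    qed
    then show False using xI by blast
  qed
  then show ?thesis by simp
qed

lemma lower_facet_dual: "lower_facet v w b g \<longleftrightarrow> biconvex_poset.upper_facet (\<lambda>x y. cov y x) (\<lambda>x y. wt y x) (\<lambda>x y. wb y x) (\<lambda>x p y. wm y p x) w v b g"
  unfolding lower_facet_def biconvex_poset.upper_facet_def[OF dual] by (auto simp: conj_commute)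

lemma lower_facet_neg:
  assumes "lower_facet v w b g" "u \<in> interval v w" "\<not> u \<preceq> b"
  shows "g u < 0"
  using biconvex_poset.upper_facet_neg[OF dual, of w v b g u] assms lower_facet_dual by simp

lemma upper_facet_ex:
  assumes "v \<lessdot> a" "a \<preceq> w" shows "\<exists>g. upper_facet v w a g"
  using up.harm_extend[OF assms up.harm_const[of 0], of "-1"] assms unfolding upper_facet_def by auto

lemma lower_facet_ex:
  assumes "b \<lessdot> w" "v \<preceq> b" shows "\<exists>g. lower_facet v w b g"
  using biconvex_poset.upper_facet_ex[OF dual, where v = w and a = b and w = v] assms lower_facet_dual by simp

lemma harm_determined_down:
  assumes "b \<lessdot> w" "v \<preceq> b" "up.harm F v w" "up.harm F' v w" "F w = F' w"
    and "\<And>u. v \<preceq> u \<Longrightarrow> u \<preceq> b \<Longrightarrow> F u = F' u" and "v \<preceq> u" "u \<preceq> w"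
  shows "F u = F' u"
  by (rule down.harm_determined[where v = w and a = b and w = v]) (use assms in simp_all)

end

section \<open>Points satisfying the facet inequalities\<close>

context biconvex_poset begin

text \<open>A point of the affine space spanned by the interval is represented by the values that harmonic
functions take at it, that is, by a linear functional on the space of harmonic functions that maps
the constant \<open>1\<close> to \<open>1\<close>. This avoids choosing coordinates, and it allows the space to vary with the interval.\<close>

definition evaluation where
  "evaluation v w z \<longleftrightarrow>
    (\<forall>F F'. up.harm F v w \<longrightarrow> up.harm F' v w \<longrightarrow> z (\<lambda>u. F u + F' u) = z F + z F') \<and>
    (\<forall>k F. up.harm F v w \<longrightarrow> z (\<lambda>u. k * F u) = k * z F) \<and> z (\<lambda>_. 1 :: real) = (1 :: real) \<and>
    (\<forall>F F'. up.harm F v w \<longrightarrow> up.harm F' v w \<longrightarrow> (\<forall>u\<in>interval v w. F u = F' u) \<longrightarrow> z F = z F')"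

definition in_hull where
  "in_hull v w z \<longleftrightarrow> (\<exists>\<mu>. (\<forall>u. 0 \<le> \<mu> u) \<and> sum \<mu> (interval v w) = 1 \<and>
     (\<forall>F. up.harm F v w \<longrightarrow> z F = (\<Sum>u\<in>interval v w. \<mu> u * F u :: real)))"

definition within_facets where
  "within_facets v w z \<longleftrightarrow> (\<forall>a g. upper_facet v w a g \<longrightarrow> z g \<le> (0::real)) \<and> (\<forall>b g. lower_facet v w b g \<longrightarrow> z g \<le> 0)"

lemma upper_facet_unique:
  assumes "upper_facet v w a g" "upper_facet v w a g'" "u \<in> interval v w"
  shows "g u = g' u"
  using up.harm_determined[of v a w g g' u] assms by (simp add: upper_facet_def)

lemma lower_facet_unique:
  assumes "lower_facet v w b g" "lower_facet v w b g'" "u \<in> interval v w"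
  shows "g u = g' u"
  using harm_determined_down[of b w v g g' u] assms by (simp add: lower_facet_def)

lemma evaluation_dual: "biconvex_poset.evaluation (\<lambda>x y. cov y x) (\<lambda>x y. wt y x) (\<lambda>x y. wb y x) (\<lambda>x p y. wm y p x) w v z \<longleftrightarrow> evaluation v w z"
  unfolding evaluation_def biconvex_poset.evaluation_def[OF dual] by (simp add: conj_commute)

lemma in_hull_dual: "biconvex_poset.in_hull (\<lambda>x y. cov y x) (\<lambda>x y. wt y x) (\<lambda>x y. wb y x) (\<lambda>x p y. wm y p x) w v z \<longleftrightarrow> in_hull v w z"
  unfolding in_hull_def biconvex_poset.in_hull_def[OF dual] by (simp add: conj_commute)

lemma upper_facet_dual: "biconvex_poset.lower_facet (\<lambda>x y. cov y x) (\<lambda>x y. wt y x) (\<lambda>x y. wb y x) (\<lambda>x p y. wm y p x) w v b g \<longleftrightarrow> upper_facet v w b g"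
  unfolding upper_facet_def biconvex_poset.lower_facet_def[OF dual] by (auto simp: conj_commute)

lemma within_facets_dual: "biconvex_poset.within_facets (\<lambda>x y. cov y x) (\<lambda>x y. wt y x) (\<lambda>x y. wb y x) (\<lambda>x p y. wm y p x) w v z \<longleftrightarrow> within_facets v w z"
proof -
  have "biconvex_poset.within_facets (\<lambda>x y. cov y x) (\<lambda>x y. wt y x) (\<lambda>x y. wb y x) (\<lambda>x p y. wm y p x) w v z \<longleftrightarrow>
      (\<forall>a g. lower_facet v w a g \<longrightarrow> z g \<le> 0) \<and> (\<forall>b g. upper_facet v w b g \<longrightarrow> z g \<le> 0)"
    by (subst biconvex_poset.within_facets_def[OF dual]) (simp only: upper_facet_dual lower_facet_dual)
  then show ?thesis by (subst within_facets_def) blast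
qed

text \<open>A point on a facet of \<open>[v, w]\<close> is also a point for \<open>[a, w]\<close>: a harmonic function on \<open>[a, w]\<close> is
evaluated after extension to \<open>[v, w]\<close>, and two extensions differ by a multiple of \<open>g\<close>, which
vanishes at the point. The facet functions of \<open>[a, w]\<close> are, up to positive factors, restrictions
of facet functions of \<open>[v, w]\<close>, so the point satisfies their inequalities.\<close>

lemma in_hull_on_upper_facet:
  assumes g: "upper_facet v w a g" and z: "evaluation v w z" and zg: "z g = 0" and le: "within_facets v w z"
    and IH: "\<And>z. evaluation a w z \<Longrightarrow> within_facets a w z \<Longrightarrow> in_hull a w z"
  shows "in_hull v w z"
proof -
  have a: "v \<lessdot> a" "a \<preceq> w" and gh: "up.harm g v w" and g0: "\<And>u. a \<preceq> u \<Longrightarrow> u \<preceq> w \<Longrightarrow> g u = 0" and gv: "g v = -1"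
    using g by (auto simp: upper_facet_def)
  have zadd: "z (\<lambda>u. F u + F' u) = z F + z F'" if "up.harm F v w" "up.harm F' v w" for F F'
    using z that unfolding evaluation_def by blast
  have zscale: "z (\<lambda>u. k * F u) = k * z F" if "up.harm F v w" for k F
    using z that unfolding evaluation_def by blast
  have z1: "z (\<lambda>_. 1) = 1" using z by (simp add: evaluation_def)
  have zcong: "z F = z F'" if "up.harm F v w" "up.harm F' v w" "\<And>u. v \<preceq> u \<Longrightarrow> u \<preceq> w \<Longrightarrow> F u = F' u" for F F'
    using z that unfolding evaluation_def by blast
  \<comment> \<open>The value \<open>0\<close> at \<open>v\<close> is an arbitrary choice, immaterial for \<open>z (ext F)\<close> by \<open>ext_eq\<close>.\<close>
  define ext where "ext F = (SOME F'. up.harm F' v w \<and> (\<forall>u. a \<preceq> u \<and> u \<preceq> w \<longrightarrow> F' u = F u) \<and> F' v = 0)" for F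
  have ext: "up.harm (ext F) v w \<and> (\<forall>u. a \<preceq> u \<and> u \<preceq> w \<longrightarrow> ext F u = F u) \<and> ext F v = 0" if "up.harm F a w" for F
    unfolding ext_def by (rule someI_ex[OF up.harm_extend[OF a that]])
  have ext_eq: "z (ext F) = z H" if F: "up.harm F a w" and H: "up.harm H v w" "\<And>u. a \<preceq> u \<Longrightarrow> u \<preceq> w \<Longrightarrow> H u = F u" for F H
  proof -
    have H': "up.harm (\<lambda>u. H u + H v * g u) v w" by (intro up.harm_add up.harm_scale H gh)
    have "z (ext F) = z (\<lambda>u. H u + H v * g u)"
    proof (rule zcong[OF _ H'])
      show "up.harm (ext F) v w" using ext[OF F] by blast
      fix u assume u: "v \<preceq> u" "u \<preceq> w"
      show "ext F u = H u + H v * g u"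
      proof (rule up.harm_determined[OF a _ H' _ _ u])
        show "up.harm (ext F) v w" using ext[OF F] by blast
        show "ext F v = H v + H v * g v" using ext[OF F] gv by simp
        show "ext F u = H u + H v * g u" if "a \<preceq> u" "u \<preceq> w" for u using ext[OF F] g0 H that by simp
      qed
    qed
    also have "\<dots> = z H + z (\<lambda>u. H v * g u)" by (rule zadd) (intro up.harm_scale H gh)+
    also have "\<dots> = z H" using zscale[OF gh] zg by simp
    finally show ?thesis .
  qed
  have sub: "up.harm H a w" if "up.harm H v w" for H using up.harm_mono[OF that] a by blast
  have "evaluation a w (\<lambda>F. z (ext F))"
    unfolding evaluation_def
  proof (intro conjI allI impI)
    fix F F' assume F: "up.harm F a w" "up.harm F' a w"
    have "z (ext (\<lambda>u. F u + F' u)) = z (\<lambda>u. ext F u + ext F' u)"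
      by (rule ext_eq) (use ext[OF F(1)] ext[OF F(2)] F in \<open>auto intro: up.harm_add\<close>)
    also have "\<dots> = z (ext F) + z (ext F')" using zadd ext F by blast
    finally show "z (ext (\<lambda>u. F u + F' u)) = z (ext F) + z (ext F')" .
  next
    fix k F assume F: "up.harm F a w"
    have "z (ext (\<lambda>u. k * F u)) = z (\<lambda>u. k * ext F u)"
      by (rule ext_eq) (use ext[OF F] F in \<open>auto intro: up.harm_scale\<close>)
    also have "\<dots> = k * z (ext F)" using zscale ext F by blast
    finally show "z (ext (\<lambda>u. k * F u)) = k * z (ext F)" .
  next
    show "z (ext (\<lambda>_. 1)) = 1" using ext_eq[of "\<lambda>_. 1" "\<lambda>_. 1"] up.harm_const z1 by simp
  next
    fix F F' assume F: "up.harm F a w" "up.harm F' a w" "\<forall>u\<in>interval a w. F u = F' u"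
    show "z (ext F) = z (ext F')" by (rule ext_eq) (use ext[OF F(2)] F in auto)
  qed
  moreover have "within_facets a w (\<lambda>F. z (ext F))"
    unfolding within_facets_def
  proof (intro conjI allI impI)
    fix c k assume k: "upper_facet a w c k"
    then have c: "a \<lessdot> c" "c \<preceq> w" and kh: "up.harm k a w" by (auto simp: upper_facet_def)
    obtain a' where a': "up.diamond v a a' c" using up.diamond_ex a c by blast
    have va': "v \<lessdot> a'" "a' \<lessdot> c" "a' \<noteq> a" using a' by (auto simp: up.diamond_def)
    have a'w: "a' \<preceq> w" using up.cov_le_trans[OF va'(2) c(2)] .
    obtain f where f: "upper_facet v w a' f" using upper_facet_ex[OF va'(1) a'w] by blast
    have fh: "up.harm f v w" and f0: "\<And>u. a' \<preceq> u \<Longrightarrow> u \<preceq> w \<Longrightarrow> f u = 0" using f by (auto simp: upper_facet_def)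
    have "\<not> a' \<preceq> a" using up.le_rk_eq[of a' a] up.cov_rk[OF va'(1)] up.cov_rk[OF a(1)] va'(3) by auto
    then have fa: "f a < 0" using upper_facet_neg[OF f] a by auto
    have fk: "up.harm (\<lambda>u. (1 / - f a) * f u) v w" by (intro up.harm_scale fh)
    have "z (ext k) = z (\<lambda>u. (1 / - f a) * f u)"
    proof (rule ext_eq[OF kh fk])
      fix u assume u: "a \<preceq> u" "u \<preceq> w"
      show "(1 / - f a) * f u = k u"
      proof (rule up.harm_determined[OF c sub[OF fk] kh _ _ u])
        show "(1 / - f a) * f a = k a" using fa k by (simp add: upper_facet_def)
        fix u assume u: "c \<preceq> u" "u \<preceq> w"
        have "a' \<preceq> u" using up.cov_le_trans[OF va'(2) u(1)] .
        then show "(1 / - f a) * f u = k u" using f0 u k by (simp add: upper_facet_def)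
      qed
    qed
    also have "\<dots> = (1 / - f a) * z f" using zscale[OF fh] .
    also have "\<dots> \<le> 0"
    proof -
      have "z f \<le> 0" using le f unfolding within_facets_def by blast
      then show ?thesis using fa by (intro mult_nonneg_nonpos) auto
    qed
    finally show "z (ext k) \<le> 0" .
  next
    fix b k assume k: "lower_facet a w b k"
    then have b: "b \<lessdot> w" "a \<preceq> b" and kh: "up.harm k a w" by (auto simp: lower_facet_def)
    have vb: "v \<preceq> b" using up.cov_le_trans[OF a(1) b(2)] .
    obtain f where f: "lower_facet v w b f" using lower_facet_ex[OF b(1) vb] by blast
    have fh: "up.harm f v w" using f by (simp add: lower_facet_def)
    have "z (ext k) = z f"
    proof (rule ext_eq[OF kh fh])
      fix u assume u: "a \<preceq> u" "u \<preceq> w"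
      show "f u = k u"
      proof (rule harm_determined_down[OF b sub[OF fh] kh _ _ u])
        show "f w = k w" using f k by (simp add: lower_facet_def)
        fix u assume u: "a \<preceq> u" "u \<preceq> b"
        have "v \<preceq> u" using up.cov_le_trans[OF a(1) u(1)] .
        then show "f u = k u" using f k u by (simp add: lower_facet_def)
      qed
    qed
    then show "z (ext k) \<le> 0" using le f unfolding within_facets_def by auto
  qed
  ultimately obtain \<mu> where \<mu>: "\<And>u. 0 \<le> \<mu> u" "sum \<mu> (interval a w) = 1"
      "\<And>F. up.harm F a w \<Longrightarrow> z (ext F) = (\<Sum>u\<in>interval a w. \<mu> u * F u)"
    using IH unfolding in_hull_def by blast
  define \<nu> where "\<nu> u = (if a \<preceq> u then \<mu> u else 0)" for u
  have I: "interval a w = interval v w \<inter> {u. a \<preceq> u}"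
    using up.cov_le_trans[OF a(1)] by blast
  have sums: "(\<Sum>u\<in>interval v w. \<nu> u * F u) = (\<Sum>u\<in>interval a w. \<mu> u * F u)" for F
    unfolding I sum.inter_restrict[OF finite_interval] by (rule sum.cong) (auto simp: \<nu>_def)
  show ?thesis
    unfolding in_hull_def
  proof (intro exI[of _ \<nu>] conjI allI impI)
    show "0 \<le> \<nu> u" for u using \<mu>(1) by (simp add: \<nu>_def)
    show "sum \<nu> (interval v w) = 1" using sums[of "\<lambda>_. 1"] \<mu>(2) by simp
    fix F assume F: "up.harm F v w"
    have "z F = z (ext F)" using ext_eq[OF sub[OF F] F] by simp
    also have "\<dots> = (\<Sum>u\<in>interval v w. \<nu> u * F u)" using \<mu>(3)[OF sub[OF F]] sums by simp
    finally show "z F = (\<Sum>u\<in>interval v w. \<nu> u * F u)" .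
  qed
qed

text \<open>Moving in the direction \<open>w - v\<close> increases every upper facet function at unit speed and decreases
every lower one, so the first facet that is met is an upper one.\<close>

lemma push_to_upper_facet:
  assumes z: "evaluation v w z" and le: "within_facets v w z" and vw: "v \<preceq> w" "v \<noteq> w"
    and IH: "\<And>a z. v \<lessdot> a \<Longrightarrow> a \<preceq> w \<Longrightarrow> evaluation a w z \<Longrightarrow> within_facets a w z \<Longrightarrow> in_hull a w z"
  shows "\<exists>t\<ge>0. in_hull v w (\<lambda>F. z F + t * (F w - F v))"
proof -
  define A where "A = {a. v \<lessdot> a \<and> a \<preceq> w}"
  have A: "finite A" "A \<noteq> {}" using up.finite_atoms up.le_first[OF vw] by (auto simp: A_def)
  have "\<forall>a\<in>A. \<exists>g. upper_facet v w a g" using upper_facet_ex by (auto simp: A_def)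
  then obtain g where g: "\<And>a. a \<in> A \<Longrightarrow> upper_facet v w a (g a)" by metis
  define t where "t = Min ((\<lambda>a. - z (g a)) ` A)"
  have "t \<in> (\<lambda>a. - z (g a)) ` A" unfolding t_def using A by (intro Min_in) auto
  then obtain a where a: "a \<in> A" "t = - z (g a)" by blast
  have t: "t \<le> - z (g a)" if "a \<in> A" for a unfolding t_def using A that by (intro Min_le) auto
  have t0: "t \<ge> 0" using a le g unfolding within_facets_def by fastforce
  let ?y = "\<lambda>F. z F + t * (F w - F v)"
  have "evaluation v w ?y"
    unfolding evaluation_def
  proof (intro conjI allI impI)
    fix F F' assume F: "up.harm F v w" "up.harm F' v w"
    have "z (\<lambda>u. F u + F' u) = z F + z F'" using z F unfolding evaluation_def by blast
    then show "?y (\<lambda>u. F u + F' u) = ?y F + ?y F'" by (simp add: algebra_simps)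
  next
    fix k F assume F: "up.harm F v w"
    have "z (\<lambda>u. k * F u) = k * z F" using z F unfolding evaluation_def by blast
    then show "?y (\<lambda>u. k * F u) = k * ?y F" by (simp add: algebra_simps)
  next
    show "?y (\<lambda>_. 1) = 1" using z by (simp add: evaluation_def)
  next
    fix F F' assume F: "up.harm F v w" "up.harm F' v w" "\<forall>u\<in>interval v w. F u = F' u"
    then have "F w = F' w" "F v = F' v" using vw by simp_all
    moreover have "z F = z F'" using z F unfolding evaluation_def by blast
    ultimately show "?y F = ?y F'" by simp
  qed
  moreover have "within_facets v w ?y"
    unfolding within_facets_def
  proof (intro conjI allI impI)
    fix a k assume k: "upper_facet v w a k"
    then have aA: "a \<in> A" by (auto simp: upper_facet_def A_def)
    have "z k = z (g a)"
      using z upper_facet_unique[OF k g[OF aA]] k g[OF aA] unfolding evaluation_def upper_facet_def by blast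
    moreover have "k w = 0" "k v = -1" using k by (auto simp: upper_facet_def)
    ultimately show "?y k \<le> 0" using t[OF aA] by simp
  next
    fix b k assume k: "lower_facet v w b k"
    have "k w = -1" "k v = 0" using k by (auto simp: lower_facet_def)
    moreover have "z k \<le> 0" using le k unfolding within_facets_def by blast
    ultimately show "?y k \<le> 0" using t0 by simp
  qed
  moreover have "?y (g a) = 0" using a g[OF a(1)] by (simp add: upper_facet_def)
  ultimately have "in_hull v w ?y"
    using in_hull_on_upper_facet[OF g[OF a(1)]] IH a by (auto simp: A_def)
  then show ?thesis using t0 by blast
qed

lemma push_to_lower_facet:
  assumes z: "evaluation v w z" and le: "within_facets v w z" and vw: "v \<preceq> w" "v \<noteq> w"
    and IH: "\<And>b z. b \<lessdot> w \<Longrightarrow> v \<preceq> b \<Longrightarrow> evaluation v b z \<Longrightarrow> within_facets v b z \<Longrightarrow> in_hull v b z"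
  shows "\<exists>t\<ge>0. in_hull v w (\<lambda>F. z F + t * (F v - F w))"
  using biconvex_poset.push_to_upper_facet[OF dual, of w v z] assms
  by (simp add: evaluation_dual within_facets_dual in_hull_dual)

lemma in_hull_mix:
  assumes 1: "in_hull v w z1" and 2: "in_hull v w z2" and ab: "0 \<le> \<alpha>" "0 \<le> \<beta>" "\<alpha> + \<beta> = 1"
    and z: "\<And>F. up.harm F v w \<Longrightarrow> z F = \<alpha> * z1 F + \<beta> * z2 F"
  shows "in_hull v w z"
proof -
  obtain \<mu>1 where 1: "\<And>u. 0 \<le> \<mu>1 u" "sum \<mu>1 (interval v w) = 1"
      "\<And>F. up.harm F v w \<Longrightarrow> z1 F = (\<Sum>u\<in>interval v w. \<mu>1 u * F u)" using 1 unfolding in_hull_def by blast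
  obtain \<mu>2 where 2: "\<And>u. 0 \<le> \<mu>2 u" "sum \<mu>2 (interval v w) = 1"
      "\<And>F. up.harm F v w \<Longrightarrow> z2 F = (\<Sum>u\<in>interval v w. \<mu>2 u * F u)" using 2 unfolding in_hull_def by blast
  have sums: "(\<Sum>u\<in>I. (\<alpha> * \<mu>1 u + \<beta> * \<mu>2 u) * F u) = \<alpha> * (\<Sum>u\<in>I. \<mu>1 u * F u) + \<beta> * (\<Sum>u\<in>I. \<mu>2 u * F u)" for I F
    by (simp add: sum_distrib_left distrib_right sum.distrib mult.assoc)
  show ?thesis
    unfolding in_hull_def
  proof (intro exI[of _ "\<lambda>u. \<alpha> * \<mu>1 u + \<beta> * \<mu>2 u"] conjI allI impI)
    show "0 \<le> \<alpha> * \<mu>1 u + \<beta> * \<mu>2 u" for u using 1(1) 2(1) ab by simp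
    show "(\<Sum>u\<in>interval v w. \<alpha> * \<mu>1 u + \<beta> * \<mu>2 u) = 1"
      using sums[where F = "\<lambda>_. 1"] 1(2) 2(2) ab by simp
    show "z F = (\<Sum>u\<in>interval v w. (\<alpha> * \<mu>1 u + \<beta> * \<mu>2 u) * F u)" if "up.harm F v w" for F
      using z 1 2 sums that by simp
  qed
qed

text \<open>The point lies on the segment between the two points at which the line through it in the direction
\<open>w - v\<close> meets the boundary. These lie on facets, to which the induction hypothesis applies.\<close>

theorem in_hull_if_within_facets:
  assumes "v \<preceq> w" "evaluation v w z" "within_facets v w z"
  shows "in_hull v w z"
  using assms
proof (induction "nat (rk w - rk v)" arbitrary: v w z rule: less_induct)
  case less
  show ?case
  proof (cases "v = w")
    case True
    have I: "interval v w = {v}" using True up.le_antisym by auto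
    show ?thesis
      unfolding in_hull_def
    proof (intro exI[of _ "\<lambda>_. 1"] conjI allI impI)
      fix F assume F: "up.harm F v w"
      have "z F = z (\<lambda>u. F v * (\<lambda>_. 1) u)"
      proof -
        have "up.harm (\<lambda>u. F v * (\<lambda>_. 1) u) v w" by (intro up.harm_scale up.harm_const)
        moreover have "\<forall>u\<in>interval v w. F u = F v * (\<lambda>_. 1) u" unfolding I by simp
        ultimately show ?thesis using less.prems(2) F unfolding evaluation_def by blast
      qed
      also have "\<dots> = F v * z (\<lambda>_. 1)" using less.prems(2) up.harm_const unfolding evaluation_def by blast
      also have "\<dots> = F v" using less.prems(2) by (simp add: evaluation_def)
      finally show "z F = (\<Sum>u\<in>interval v w. 1 * F u)" using I by simp
    qed (use I in auto)
  next
    case False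
    have up_IH: "in_hull a w z" if "v \<lessdot> a" "a \<preceq> w" "evaluation a w z" "within_facets a w z" for a z
      using less.hyps[of w a z] that up.cov_rk[OF that(1)] up.le_rk[OF that(2)] by simp
    have down_IH: "in_hull v b z" if "b \<lessdot> w" "v \<preceq> b" "evaluation v b z" "within_facets v b z" for b z
      using less.hyps[of b v z] that up.cov_rk[OF that(1)] up.le_rk[OF that(2)] by simp
    obtain t where t: "t \<ge> 0" "in_hull v w (\<lambda>F. z F + t * (F w - F v))"
      using push_to_upper_facet[OF less.prems(2,3,1) False up_IH] by blast
    obtain s where s: "s \<ge> 0" "in_hull v w (\<lambda>F. z F + s * (F v - F w))"
      using push_to_lower_facet[OF less.prems(2,3,1) False down_IH] by blast
    show ?thesis
    proof (cases "s + t = 0")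
      case True
      then have "t = 0" using t(1) s(1) by simp
      then show ?thesis using t(2) by simp
    next
      case False
      then have st: "s + t > 0" using t s by simp
      show ?thesis
      proof (rule in_hull_mix[OF t(2) s(2), of "s / (s + t)" "t / (s + t)"])
        show "s / (s + t) + t / (s + t) = 1" using st by (simp add: add_divide_distrib[symmetric])
        fix F
        have "s * (z F + t * (F w - F v)) + t * (z F + s * (F v - F w)) = (s + t) * z F" by (simp add: algebra_simps)
        then show "z F = s / (s + t) * (z F + t * (F w - F v)) + t / (s + t) * (z F + s * (F v - F w))"
          using st by (simp add: add_divide_distrib[symmetric] eq_divide_eq mult.commute)
      qed (use s t st in auto)
    qed
  qed
qed

end

section \<open>The interval poset as a face lattice\<close>

lemma face_of_convex_hull_exposed:
  fixes V :: "'b::real_vector set" and g :: "'b \<Rightarrow> real"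
  assumes V: "finite V" and g: "linear g" and le: "\<And>x. x \<in> V \<Longrightarrow> g x \<le> 0"
  shows "convex hull {x \<in> V. g x = 0} face_of convex hull V"
proof (rule face_of_convex_hulls[OF V])
  have "affine {x. g x = 0}"
    unfolding affine_def by (auto simp: linear_add[OF g] linear_scale[OF g])
  then have 1: "affine hull {x \<in> V. g x = 0} \<subseteq> {x. g x = 0}" by (intro hull_minimal) auto
  have "convex {x. g x < 0}"
    unfolding convex_def using convex_bound_lt[of _ 0] by (auto simp: linear_add[OF g] linear_scale[OF g])
  then have "convex hull (V - {x \<in> V. g x = 0}) \<subseteq> {x. g x < 0}"
    using le by (intro hull_minimal) (auto simp: less_le)
  then show "affine hull {x \<in> V. g x = 0} \<inter> convex hull (V - {x \<in> V. g x = 0}) = {}"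
    using 1 by fastforce
qed auto

lemma linear_zero_on_hull:
  fixes g :: "'b::real_vector \<Rightarrow> real"
  assumes g: "linear g" and "\<And>x. x \<in> V \<Longrightarrow> g x = 0" and "p \<in> convex hull V"
  shows "g p = 0"
proof -
  have "convex {x. g x = 0}" unfolding convex_def by (auto simp: linear_add[OF g] linear_scale[OF g])
  then have "convex hull V \<subseteq> {x. g x = 0}" using assms(2) by (intro hull_minimal) auto
  then show ?thesis using assms(3) by blast
qed

text \<open>If a point of a face is written as a convex combination of points of the polytope, then the face contains all points with
positive coefficients.\<close>

lemma face_of_finite_convex_hull:
  fixes V :: "'b::real_vector set"
  assumes V: "finite V" and F: "F face_of convex hull V"
  shows "F = convex hull (F \<inter> V)"
proof
  show "convex hull (F \<inter> V) \<subseteq> F" using F by (intro hull_minimal) (auto simp: face_of_def)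
  show "F \<subseteq> convex hull (F \<inter> V)"
  proof
    fix p assume p: "p \<in> F"
    then have "p \<in> convex hull V" using F by (auto simp: face_of_def)
    then obtain u where u: "\<And>x. x \<in> V \<Longrightarrow> 0 \<le> u x" "sum u V = 1" "(\<Sum>x\<in>V. u x *\<^sub>R x) = p"
      unfolding convex_hull_finite[OF V] by auto
    have inF: "x \<in> F" if x: "x \<in> V" "0 < u x" for x
    proof -
      have sp: "sum u (V - {x}) = 1 - u x" "(\<Sum>y\<in>V - {x}. u y *\<^sub>R y) = p - u x *\<^sub>R x"
        using u(2,3) sum.remove[OF V x(1), of u] sum.remove[OF V x(1), of "\<lambda>y. u y *\<^sub>R y"] by (simp_all add: algebra_simps)
      have nn: "0 \<le> sum u (V - {x})" using u by (intro sum_nonneg) auto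
      show ?thesis
      proof (cases "u x = 1")
        case True
        then have "\<forall>y\<in>V - {x}. u y = 0" using sp(1) u(1) V sum_nonneg_eq_0_iff[of "V - {x}" u] by auto
        then have "(\<Sum>y\<in>V - {x}. u y *\<^sub>R y) = 0" by simp
        then show ?thesis using sp True p by simp
      next
        case False
        then have u1: "u x < 1" using sp nn by simp
        define q where "q = (\<Sum>y\<in>V - {x}. (u y / (1 - u x)) *\<^sub>R y)"
        have "q \<in> convex hull V"
          unfolding q_def
        proof (rule convex_sum)
          show "(\<Sum>y\<in>V - {x}. u y / (1 - u x)) = 1" using sp u1 by (simp add: sum_divide_distrib[symmetric])
        qed (use V u u1 in \<open>auto intro: hull_inc\<close>)
        have "q = (1 / (1 - u x)) *\<^sub>R (\<Sum>y\<in>V - {x}. u y *\<^sub>R y)"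
          unfolding q_def by (simp add: scaleR_sum_right)
        then have "(1 - u x) *\<^sub>R q = p - u x *\<^sub>R x" using sp u1 by simp
        then have pq: "p = (1 - u x) *\<^sub>R q + u x *\<^sub>R x" by (simp add: algebra_simps)
        show ?thesis
        proof (cases "q = x")
          case True
          then have "p = x" using pq by (simp add: scaleR_left_distrib[symmetric])
          then show ?thesis using p by simp
        next
          case False
          then have "p \<in> open_segment q x" using pq x u1 by (auto simp: in_segment)
          then show ?thesis using F \<open>q \<in> convex hull V\<close> p x hull_inc[of x V] unfolding face_of_def by blast
        qed
      qed
    qed
    have z: "u x = 0" if "x \<in> V" "x \<notin> F" for x using inF[of x] u(1)[of x] that by force
    have "sum u (F \<inter> V) = sum u V" using V z by (intro sum.mono_neutral_left) auto
    moreover have "(\<Sum>x\<in>F \<inter> V. u x *\<^sub>R x) = (\<Sum>x\<in>V. u x *\<^sub>R x)" using V z by (intro sum.mono_neutral_left) auto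
    ultimately show "p \<in> convex hull (F \<inter> V)"
      using u V by (subst convex_hull_finite) auto
  qed
qed

lemma weak_partial_order_inclusion: "weak_partial_order (inclusion_poset \<A>)"
  by unfold_locales (auto simp: inclusion_poset_def)

lemma lookup_scaleR: "Poly_Mapping.lookup (r *\<^sub>R x) i = r * Poly_Mapping.lookup (x :: 'b \<Rightarrow>\<^sub>0 real) i"
proof -
  have "finite {i. r * Poly_Mapping.lookup x i \<noteq> 0}"
    by (rule finite_subset[OF _ finite_keys[of x]]) (auto simp: in_keys_iff)
  then show ?thesis by (simp add: scaleR_poly_mapping_def Abs_poly_mapping_inverse)
qed

lemma linear_lookup: "linear (\<lambda>x. Poly_Mapping.lookup (x :: 'b \<Rightarrow>\<^sub>0 real) i)"
  by (rule linearI) (simp_all add: lookup_add lookup_scaleR)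

lemma lookup_sum: "Poly_Mapping.lookup (sum f A) i = (\<Sum>x\<in>A. Poly_Mapping.lookup (f x) i)"
  by (induction A rule: infinite_finite_induct) (simp_all add: lookup_add)

context biconvex_poset begin

lemma extend_below:
  assumes "v \<preceq> x" "x \<preceq> w" "up.harm g x w"
  shows "\<exists>F. up.harm F v w \<and> (\<forall>u\<in>interval x w. F u = g u)"
  using assms(1)
proof (induction rule: converse_rtranclp_induct)
  case base then show ?case using assms by blast
next
  case (step y z)
  then obtain F where F: "up.harm F z w" "\<forall>u\<in>interval x w. F u = g u" by blast
  have zw: "z \<preceq> w" using up.le_trans[OF step(2) assms(2)] .
  obtain F' where F': "up.harm F' y w" "\<forall>u. z \<preceq> u \<and> u \<preceq> w \<longrightarrow> F' u = F u"
    using up.harm_extend[OF step(1) zw F(1), of 0] by blast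
  have "F' u = g u" if "u \<in> interval x w" for u
  proof -
    have "z \<preceq> u" using up.le_trans[OF step(2)] that by simp
    then show ?thesis using F F' that by simp
  qed
  then show ?case using F' by blast
qed

lemma upper_facet_extend:
  assumes "v \<preceq> x" "x \<lessdot> a" "a \<preceq> w"
  shows "\<exists>F. up.harm F v w \<and> upper_facet x w a F"
proof -
  obtain g where g: "upper_facet x w a g" using upper_facet_ex assms by blast
  have xw: "x \<preceq> w" using up.cov_le_trans assms by blast
  obtain F where F: "up.harm F v w" "\<forall>u\<in>interval x w. F u = g u"
    using extend_below[OF assms(1) xw] g unfolding upper_facet_def by blast
  have "F u = g u" if "a \<preceq> u" "u \<preceq> w" for u
    using F(2) up.cov_le_trans[OF assms(2) that(1)] that by simp
  moreover have "up.harm F x w" using up.harm_mono[OF F(1) assms(1)] by simp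
  ultimately have "upper_facet x w a F" using g F xw unfolding upper_facet_def by simp
  then show ?thesis using F by blast
qed

lemma lower_facet_extend:
  assumes "y \<preceq> w" "b \<lessdot> y" "v \<preceq> b"
  shows "\<exists>F. up.harm F v w \<and> lower_facet v y b F"
  using biconvex_poset.upper_facet_extend[OF dual, of w y b v] assms by (simp add: lower_facet_dual)

text \<open>The coordinates are the facet functions of all intervals \<open>[x, w]\<close> and \<open>[v, y]\<close>, extended to
\<open>[v, w]\<close>. Finitely many functions are chosen because the ambient space has to be of finite
dimension.\<close>

lemma embedding_ex:
  shows "\<exists>(\<psi> :: 'a \<Rightarrow> nat \<Rightarrow>\<^sub>0 real) d. (\<forall>u. Poly_Mapping.keys (\<psi> u) \<subseteq> {..<d})
    \<and> (\<forall>i. up.harm (\<lambda>u. Poly_Mapping.lookup (\<psi> u) i) v w)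
    \<and> (\<forall>x a. v \<preceq> x \<and> x \<lessdot> a \<and> a \<preceq> w \<longrightarrow> (\<exists>i. upper_facet x w a (\<lambda>u. Poly_Mapping.lookup (\<psi> u) i)))
    \<and> (\<forall>b y. v \<preceq> b \<and> b \<lessdot> y \<and> y \<preceq> w \<longrightarrow> (\<exists>i. lower_facet v y b (\<lambda>u. Poly_Mapping.lookup (\<psi> u) i)))"
proof -
  define K where "K = {(x, a). v \<preceq> x \<and> x \<lessdot> a \<and> a \<preceq> w}"
  have "K \<subseteq> S \<times> S" using up.cov_S by (auto simp: K_def)
  then have K: "finite K" using up.finite_S finite_subset by blast
  have "\<forall>k\<in>K. \<exists>F. up.harm F v w \<and> upper_facet (fst k) w (snd k) F"
    using upper_facet_extend by (auto simp: K_def)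
  then obtain U where U: "\<And>k. k \<in> K \<Longrightarrow> up.harm (U k) v w \<and> upper_facet (fst k) w (snd k) (U k)" by metis
  have "\<forall>k\<in>K. \<exists>F. up.harm F v w \<and> lower_facet v (snd k) (fst k) F"
    using lower_facet_extend by (auto simp: K_def)
  then obtain L where L: "\<And>k. k \<in> K \<Longrightarrow> up.harm (L k) v w \<and> lower_facet v (snd k) (fst k) (L k)" by metis
  obtain fs where fs: "set fs = U ` K \<union> L ` K" using finite_list[of "U ` K \<union> L ` K"] K by blast
  define \<psi> :: "'a \<Rightarrow> nat \<Rightarrow>\<^sub>0 real" where "\<psi> u = Abs_poly_mapping (\<lambda>i. if i < length fs then (fs ! i) u else 0)" for u
  have look: "Poly_Mapping.lookup (\<psi> u) i = (if i < length fs then (fs ! i) u else 0)" for u i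
  proof -
    have "finite {i. (if i < length fs then (fs ! i) u else 0) \<noteq> 0}"
      by (rule finite_subset[of _ "{..<length fs}"]) auto
    then show ?thesis by (simp add: \<psi>_def Abs_poly_mapping_inverse)
  qed
  have coord: "\<exists>i. F = (\<lambda>u. Poly_Mapping.lookup (\<psi> u) i)" if F: "F \<in> set fs" for F
  proof -
    obtain i where i: "i < length fs" "fs ! i = F" using iffD1[OF in_set_conv_nth F] by (elim exE conjE)
    have "F = (\<lambda>u. Poly_Mapping.lookup (\<psi> u) i)" using i look by (intro ext) simp
    then show ?thesis by blast
  qed
  show ?thesis
  proof (rule exI[of _ \<psi>], rule exI[of _ "length fs"], intro conjI allI impI)
    show "Poly_Mapping.keys (\<psi> u) \<subseteq> {..<length fs}" for u
      using look by (auto simp: in_keys_iff split: if_splits)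
    show "up.harm (\<lambda>u. Poly_Mapping.lookup (\<psi> u) i) v w" for i
    proof (cases "i < length fs")
      case True
      then have "fs ! i \<in> U ` K \<union> L ` K" using fs nth_mem by blast
      then consider k where "k \<in> K" "fs ! i = U k" | k where "k \<in> K" "fs ! i = L k" by (elim UnE imageE) auto
      then have "up.harm (fs ! i) v w" using U L by cases (metis, metis)
      moreover have "(\<lambda>u. Poly_Mapping.lookup (\<psi> u) i) = fs ! i" using look True by auto
      ultimately show ?thesis by simp
    next
      case False
      then have "(\<lambda>u. Poly_Mapping.lookup (\<psi> u) i) = (\<lambda>_. 0)" using look by auto
      then show ?thesis using up.harm_const by simp
    qed
  next
    fix x a assume "v \<preceq> x \<and> x \<lessdot> a \<and> a \<preceq> w"
    then have k: "(x, a) \<in> K" by (simp add: K_def)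
    then obtain i where "U (x, a) = (\<lambda>u. Poly_Mapping.lookup (\<psi> u) i)" using coord fs by blast
    then show "\<exists>i. upper_facet x w a (\<lambda>u. Poly_Mapping.lookup (\<psi> u) i)" using U[OF k] by auto
  next
    fix b y assume "v \<preceq> b \<and> b \<lessdot> y \<and> y \<preceq> w"
    then have k: "(b, y) \<in> K" by (simp add: K_def)
    then obtain i where "L (b, y) = (\<lambda>u. Poly_Mapping.lookup (\<psi> u) i)" using coord fs by blast
    then show "\<exists>i. lower_facet v y b (\<lambda>u. Poly_Mapping.lookup (\<psi> u) i)" using L[OF k] by auto
  qed
qed

context
  fixes \<psi> :: "'a \<Rightarrow> nat \<Rightarrow>\<^sub>0 real" and v w
  assumes vw: "v \<preceq> w"
    and \<psi>_harm: "\<And>i. up.harm (\<lambda>u. Poly_Mapping.lookup (\<psi> u) i) v w"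
    and \<psi>_upper: "\<And>x a. v \<preceq> x \<Longrightarrow> x \<lessdot> a \<Longrightarrow> a \<preceq> w \<Longrightarrow> \<exists>i. upper_facet x w a (\<lambda>u. Poly_Mapping.lookup (\<psi> u) i)"
    and \<psi>_lower: "\<And>b y. v \<preceq> b \<Longrightarrow> b \<lessdot> y \<Longrightarrow> y \<preceq> w \<Longrightarrow> \<exists>i. lower_facet v y b (\<lambda>u. Poly_Mapping.lookup (\<psi> u) i)"
begin

abbreviation hull_on where "hull_on x y \<equiv> convex hull (\<psi> ` interval x y)"

text \<open>Climbing from \<open>v\<close> to \<open>x\<close> one cover at a time, every step passes to a facet of the preceding face.\<close>

lemma upper_face:
  assumes "v \<preceq> x"
  shows "x \<preceq> w \<longrightarrow> hull_on x w face_of hull_on v w"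
  using assms
proof (induction rule: rtranclp_induct)
  case base then show ?case by (simp add: face_of_refl)
next
  case (step y z)
  show ?case
  proof
    assume z: "z \<preceq> w"
    then have yw: "y \<preceq> w" using up.cov_le_trans step by blast
    obtain i where i: "upper_facet y w z (\<lambda>u. Poly_Mapping.lookup (\<psi> u) i)" using \<psi>_upper step z by blast
    have neg: "Poly_Mapping.lookup (\<psi> u) i < 0" if "u \<in> interval y w" "\<not> z \<preceq> u" for u
      using upper_facet_neg[OF i that] .
    have zero: "Poly_Mapping.lookup (\<psi> u) i = 0" if "z \<preceq> u" "u \<preceq> w" for u
      using i that by (simp add: upper_facet_def)
    have sub: "y \<preceq> u" if "z \<preceq> u" for u using up.cov_le_trans[OF step(2) that] .
    have "{p \<in> \<psi> ` interval y w. Poly_Mapping.lookup p i = 0} = \<psi> ` interval z w"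
      using neg zero sub by (auto simp: image_iff) (metis less_irrefl)+
    moreover have "convex hull {p \<in> \<psi> ` interval y w. Poly_Mapping.lookup p i = 0} face_of hull_on y w"
    proof (rule face_of_convex_hull_exposed[OF _ linear_lookup])
      show "Poly_Mapping.lookup p i \<le> 0" if "p \<in> \<psi> ` interval y w" for p
        using that neg zero by (metis (mono_tags, lifting) image_iff less_imp_le mem_Collect_eq order_refl)
    qed (use finite_interval in blast)
    ultimately have "hull_on z w face_of hull_on y w" by simp
    then show "hull_on z w face_of hull_on v w" using step(3) yw face_of_trans by blast
  qed
qed

lemma lower_face:
  assumes "v \<preceq> x" "x \<preceq> y" "y \<preceq> w"
  shows "hull_on x y face_of hull_on x w"
  using assms(3,2)
proof (induction rule: converse_rtranclp_induct)
  case base then show ?case by (simp add: face_of_refl)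
next
  case (step y z)
  have vy: "v \<preceq> y" using up.le_trans[OF assms(1) step(4)] .
  obtain i where i: "lower_facet v z y (\<lambda>u. Poly_Mapping.lookup (\<psi> u) i)" using \<psi>_lower[OF vy step(1,2)] by blast
  have vu: "v \<preceq> u" if "x \<preceq> u" for u using up.le_trans[OF assms(1) that] .
  have neg: "Poly_Mapping.lookup (\<psi> u) i < 0" if "u \<in> interval x z" "\<not> u \<preceq> y" for u
    using lower_facet_neg[OF i, of u] vu that by simp
  have zero: "Poly_Mapping.lookup (\<psi> u) i = 0" if "x \<preceq> u" "u \<preceq> y" for u
    using i that vu by (simp add: lower_facet_def)
  have sub: "u \<preceq> z" if "u \<preceq> y" for u using up.le_cov_trans[OF that step(1)] .
  have "{p \<in> \<psi> ` interval x z. Poly_Mapping.lookup p i = 0} = \<psi> ` interval x y"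
    using neg zero sub by (auto simp: image_iff) (metis less_irrefl)+
  moreover have "convex hull {p \<in> \<psi> ` interval x z. Poly_Mapping.lookup p i = 0} face_of hull_on x z"
  proof (rule face_of_convex_hull_exposed[OF _ linear_lookup])
    show "Poly_Mapping.lookup p i \<le> 0" if "p \<in> \<psi> ` interval x z" for p
      using that neg zero by (metis (mono_tags, lifting) image_iff less_imp_le mem_Collect_eq order_refl)
  qed (use finite_interval in blast)
  ultimately have "hull_on x y face_of hull_on x z" by simp
  moreover have "x \<preceq> z" using up.le_cov_trans[OF step(4,1)] .
  ultimately show ?case using step(3) face_of_trans by blast
qed

text \<open>A vertex in the hull of \<open>[x, y]\<close> satisfies the equations of the facets met on the way from \<open>v\<close> up
to \<open>x\<close>, and \<open>upper_facet_neg\<close> turns these equations into order relations.\<close>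

lemma mem_hull_upper:
  assumes p: "\<psi> u \<in> hull_on x y" and y: "y \<preceq> w" and u: "u \<in> interval v w"
  shows "v \<preceq> x' \<Longrightarrow> x' \<preceq> x \<longrightarrow> x' \<preceq> u"
proof (induction rule: rtranclp_induct)
  case base then show ?case using u by simp
next
  case (step a b)
  show ?case
  proof
    assume b: "b \<preceq> x"
    have au: "a \<preceq> u" using step(2,3) up.cov_le_trans[OF step(2) b] by blast
    show "b \<preceq> u"
    proof (cases "b \<preceq> w")
      case True
      obtain i where i: "upper_facet a w b (\<lambda>u. Poly_Mapping.lookup (\<psi> u) i)" using \<psi>_upper step True by blast
      have "Poly_Mapping.lookup q i = 0" if q: "q \<in> \<psi> ` interval x y" for q
      proof -
        obtain s where s: "q = \<psi> s" "x \<preceq> s" "s \<preceq> y" using q by blast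
        have "b \<preceq> s" "s \<preceq> w" using up.le_trans[OF b s(2)] up.le_trans[OF s(3) y] by auto
        then show ?thesis using i s by (simp add: upper_facet_def)
      qed
      then have "Poly_Mapping.lookup (\<psi> u) i = 0" using linear_zero_on_hull[OF linear_lookup _ p] by blast
      then show ?thesis using upper_facet_neg[OF i, of u] au u by auto
    next
      case False
      have "x \<preceq> y"
      proof (rule ccontr)
        assume "\<not> x \<preceq> y"
        then have e: "interval x y = {}" using up.le_trans by blast
        show False using p unfolding e by simp
      qed
      then show ?thesis using False up.le_trans[OF b up.le_trans[OF _ y]] by blast
    qed
  qed
qed

lemma mem_hull_lower:
  assumes p: "\<psi> u \<in> hull_on x y" and x: "v \<preceq> x" and u: "u \<in> interval v w"
  shows "y' \<preceq> w \<Longrightarrow> y \<preceq> y' \<longrightarrow> u \<preceq> y'"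
proof (induction rule: converse_rtranclp_induct)
  case base then show ?case using u by simp
next
  case (step b c)
  have xy: "x \<preceq> y"
  proof (rule ccontr)
    assume "\<not> x \<preceq> y"
    then have e: "interval x y = {}" using up.le_trans by blast
    show False using p unfolding e by simp
  qed
  show ?case
  proof
    assume b: "y \<preceq> b"
    have uc: "u \<preceq> c" using step(1,3) up.le_cov_trans[OF b step(1)] by blast
    have vb: "v \<preceq> b" using up.le_trans[OF x up.le_trans[OF xy b]] .
    obtain i where i: "lower_facet v c b (\<lambda>u. Poly_Mapping.lookup (\<psi> u) i)" using \<psi>_lower[OF vb step(1,2)] by blast
    have "Poly_Mapping.lookup q i = 0" if q: "q \<in> \<psi> ` interval x y" for q
    proof -
      obtain s where s: "q = \<psi> s" "x \<preceq> s" "s \<preceq> y" using q by blast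
      have "v \<preceq> s" "s \<preceq> b" using up.le_trans[OF x s(2)] up.le_trans[OF s(3) b] by auto
      then show ?thesis using i s by (simp add: lower_facet_def)
    qed
    then have "Poly_Mapping.lookup (\<psi> u) i = 0" using linear_zero_on_hull[OF linear_lookup _ p] by blast
    then show "u \<preceq> b" using lower_facet_neg[OF i, of u] uc u by auto
  qed
qed

lemma mem_hull:
  assumes "\<psi> u \<in> hull_on x y" "v \<preceq> x" "y \<preceq> w" "u \<in> interval v w"
  shows "u \<in> interval x y"
  using mem_hull_upper[OF assms(1,3,4,2)] mem_hull_lower[OF assms(1,2,4,3)] by simp

text \<open>The interval \<open>[x, y]\<close> is minimal among those containing the set \<open>M\<close> of vertices of \<open>F\<close>, hence every
facet function of \<open>[x, y]\<close> is negative at the barycentre of \<open>M\<close>. Therefore the barycentre can be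
moved a little away from any \<open>u\<close> in \<open>[x, y]\<close> without leaving the hull. It then lies in an open
segment ending at \<open>u\<close>, and since it belongs to the face \<open>F\<close>, so does \<open>u\<close>.\<close>

lemma vertices_of_face:
  assumes F: "F face_of hull_on v w" and M: "M = {u \<in> interval v w. \<psi> u \<in> F}" "M \<noteq> {}"
    and xy: "v \<preceq> x" "x \<preceq> y" "y \<preceq> w" "M \<subseteq> interval x y"
    and min_up: "\<And>a. x \<lessdot> a \<Longrightarrow> a \<preceq> y \<Longrightarrow> \<not> M \<subseteq> interval a y"
    and min_down: "\<And>b. b \<lessdot> y \<Longrightarrow> x \<preceq> b \<Longrightarrow> \<not> M \<subseteq> interval x b"
    and u: "u \<in> interval x y"
  shows "u \<in> M"
proof -
  have sub: "interval x y \<subseteq> interval v w" using up.le_trans[OF xy(1)] up.le_trans[OF _ xy(3)] by blast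
  have finM: "finite M" using finite_subset[OF xy(4) finite_interval] .
  define c where "c = real (card M)"
  have c: "c > 0" using finM M(2) by (simp add: c_def card_gt_0_iff)
  define avg where "avg F = (\<Sum>m\<in>M. F m) / c" for F :: "'a \<Rightarrow> real"
  have avg_neg: "avg g < 0" if "\<And>m. m \<in> M \<Longrightarrow> g m \<le> 0" "m \<in> M" "g m < 0" for g m
  proof -
    have "(\<Sum>m\<in>M. g m) < (\<Sum>m\<in>M. 0)" using finM that by (intro sum_strict_mono_ex1) auto
    then show ?thesis using c by (simp add: avg_def divide_less_0_iff)
  qed
  have upper: "avg g < 0" if g: "upper_facet x y a g" for a g
  proof -
    have a: "x \<lessdot> a" "a \<preceq> y" using g by (auto simp: upper_facet_def)
    obtain m where m: "m \<in> M" "m \<notin> interval a y" using min_up[OF a] by blast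
    have "g k \<le> 0" if "k \<in> M" for k
      using upper_facet_neg[OF g, of k] g that xy(4) by (cases "a \<preceq> k") (auto simp: upper_facet_def)
    moreover have "g m < 0" using upper_facet_neg[OF g, of m] m xy(4) by auto
    ultimately show ?thesis using avg_neg m by blast
  qed
  have lower: "avg g < 0" if g: "lower_facet x y b g" for b g
  proof -
    have b: "b \<lessdot> y" "x \<preceq> b" using g by (auto simp: lower_facet_def)
    obtain m where m: "m \<in> M" "m \<notin> interval x b" using min_down[OF b] by blast
    have "g k \<le> 0" if "k \<in> M" for k
      using lower_facet_neg[OF g, of k] g that xy(4) by (cases "k \<preceq> b") (auto simp: lower_facet_def)
    moreover have "g m < 0" using lower_facet_neg[OF g, of m] m xy(4) by auto
    ultimately show ?thesis using avg_neg m by blast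
  qed
  define A where "A = {a. x \<lessdot> a \<and> a \<preceq> y}"
  define B where "B = {b. b \<lessdot> y \<and> x \<preceq> b}"
  have fin: "finite A" "finite B"
    using up.finite_S by (auto simp: A_def B_def intro: rev_finite_subset dest: up.cov_S)
  have "\<forall>a\<in>A. \<exists>g. upper_facet x y a g" using upper_facet_ex by (simp add: A_def)
  then obtain gA where gA: "\<And>a. a \<in> A \<Longrightarrow> upper_facet x y a (gA a)" by metis
  have "\<forall>b\<in>B. \<exists>g. lower_facet x y b g" using lower_facet_ex by (simp add: B_def)
  then obtain gB where gB: "\<And>b. b \<in> B \<Longrightarrow> lower_facet x y b (gB b)" by metis
  have neg: "\<And>a. a \<in> A \<Longrightarrow> avg (gA a) < 0" "\<And>b. b \<in> B \<Longrightarrow> avg (gB b) < 0"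
    using upper gA lower gB by blast+
  have "eventually (\<lambda>\<epsilon>. (\<forall>a\<in>A. avg (gA a) + \<epsilon> * (avg (gA a) - gA a u) < 0 + \<epsilon> * 0) \<and>
     (\<forall>b\<in>B. avg (gB b) + \<epsilon> * (avg (gB b) - gB b u) < 0 + \<epsilon> * 0)) (at_right 0)"
    by (intro eventually_conj eventually_ball_finite ballI eventually_perturb_less fin neg)
  from eventually_right_ex[OF this] obtain \<epsilon> where e: "\<epsilon> > 0"
      "\<And>a. a \<in> A \<Longrightarrow> avg (gA a) + \<epsilon> * (avg (gA a) - gA a u) < 0"
      "\<And>b. b \<in> B \<Longrightarrow> avg (gB b) + \<epsilon> * (avg (gB b) - gB b u) < 0" by auto
  \<comment> \<open>The barycentre moved away from \<open>u\<close>.\<close>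
  let ?z = "\<lambda>F. (1 + \<epsilon>) * avg F - \<epsilon> * F u"
  have avg_cong: "avg F = avg F'" if "\<And>k. k \<in> interval x y \<Longrightarrow> F k = F' k" for F F'
    unfolding avg_def using that xy(4) by (intro arg_cong2[where f = "(/)"] sum.cong) auto
  have "evaluation x y ?z"
    unfolding evaluation_def
  proof (intro conjI allI impI)
    show "?z (\<lambda>u. F u + F' u) = ?z F + ?z F'" for F F'
      by (simp add: avg_def sum.distrib add_divide_distrib algebra_simps)
    show "?z (\<lambda>u. k * F u) = k * ?z F" for k F
      by (simp add: avg_def sum_distrib_left[symmetric] algebra_simps)
    show "?z (\<lambda>_. 1) = 1" using c by (simp add: avg_def c_def[symmetric])
    show "?z F = ?z F'" if "\<forall>k\<in>interval x y. F k = F' k" for F F'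
      using avg_cong[of F F'] that u by simp
  qed
  moreover have "within_facets x y ?z"
    unfolding within_facets_def
  proof (intro conjI allI impI)
    fix a g assume g: "upper_facet x y a g"
    then have a: "a \<in> A" by (simp add: A_def upper_facet_def)
    have eq: "\<And>k. k \<in> interval x y \<Longrightarrow> g k = gA a k" using upper_facet_unique[OF g gA[OF a]] .
    show "?z g \<le> 0" using avg_cong[OF eq] eq[OF u] e(2)[OF a] by (simp add: algebra_simps)
  next
    fix b g assume g: "lower_facet x y b g"
    then have b: "b \<in> B" by (simp add: B_def lower_facet_def)
    have eq: "\<And>k. k \<in> interval x y \<Longrightarrow> g k = gB b k" using lower_facet_unique[OF g gB[OF b]] .
    show "?z g \<le> 0" using avg_cong[OF eq] eq[OF u] e(3)[OF b] by (simp add: algebra_simps)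
  qed
  ultimately obtain \<mu> where \<mu>: "\<And>k. 0 \<le> \<mu> k" "sum \<mu> (interval x y) = 1"
      "\<And>F. up.harm F x y \<Longrightarrow> ?z F = (\<Sum>k\<in>interval x y. \<mu> k * F k)"
    using in_hull_if_within_facets[OF xy(2)] unfolding in_hull_def by blast
  define p where "p = (\<Sum>k\<in>interval x y. \<mu> k *\<^sub>R \<psi> k)"
  have P: "\<psi> k \<in> hull_on v w" if "k \<in> interval x y" for k using sub that by (intro hull_inc) blast
  have pP: "p \<in> hull_on v w" unfolding p_def
    by (rule convex_sum[OF finite_interval]) (use \<mu> P in auto)
  define r where "r = (\<Sum>m\<in>M. (1 / c) *\<^sub>R \<psi> m)"
  have rF: "r \<in> F" unfolding r_def
  proof (rule convex_sum[OF finM])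
    show "convex F" using F by (simp add: face_of_def)
    show "(\<Sum>m\<in>M. 1 / c) = 1" using c by (simp add: c_def[symmetric])
  qed (use c M in auto)
  have "(1 + \<epsilon>) *\<^sub>R r = p + \<epsilon> *\<^sub>R \<psi> u"
  proof (rule poly_mapping_eqI)
    fix i
    let ?f = "\<lambda>u. Poly_Mapping.lookup (\<psi> u) i"
    have "up.harm ?f x y" using up.harm_mono[OF \<psi>_harm xy(1,3)] .
    then have "(1 + \<epsilon>) * avg ?f - \<epsilon> * ?f u = Poly_Mapping.lookup p i"
      using \<mu>(3) by (simp add: p_def lookup_sum lookup_scaleR)
    moreover have "Poly_Mapping.lookup r i = avg ?f"
      by (simp add: r_def avg_def lookup_sum lookup_scaleR sum_divide_distrib)
    ultimately show "Poly_Mapping.lookup ((1 + \<epsilon>) *\<^sub>R r) i = Poly_Mapping.lookup (p + \<epsilon> *\<^sub>R \<psi> u) i"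
      by (simp add: lookup_add lookup_scaleR)
  qed
  then have "(1 / (1 + \<epsilon>)) *\<^sub>R (1 + \<epsilon>) *\<^sub>R r = (1 / (1 + \<epsilon>)) *\<^sub>R (p + \<epsilon> *\<^sub>R \<psi> u)" by simp
  then have r: "r = (1 / (1 + \<epsilon>)) *\<^sub>R p + (\<epsilon> / (1 + \<epsilon>)) *\<^sub>R \<psi> u"
    using e(1) by (simp add: scaleR_add_right)
  have sum1: "1 / (1 + \<epsilon>) = 1 - \<epsilon> / (1 + \<epsilon>)" using e(1) by (simp add: field_simps)
  have "\<psi> u \<in> F"
  proof (cases "p = \<psi> u")
    case True
    then have "r = \<psi> u" using r unfolding sum1 by (simp add: scaleR_left_distrib[symmetric])
    then show ?thesis using rF by simp
  next
    case False
    have "r \<in> open_segment p (\<psi> u)"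
      unfolding in_segment using False r e(1) by (intro conjI exI[of _ "\<epsilon> / (1 + \<epsilon>)"]) (auto simp: sum1)
    then show ?thesis using F pP P[OF u] rF unfolding face_of_def by blast
  qed
  then show ?thesis using M(1) sub u by blast
qed

lemma face_is_interval:
  assumes F: "F face_of hull_on v w" and ne: "F \<noteq> {}"
  shows "\<exists>x y. v \<preceq> x \<and> x \<preceq> y \<and> y \<preceq> w \<and> F = hull_on x y"
proof -
  define M where "M = {u \<in> interval v w. \<psi> u \<in> F}"
  have FM: "F = convex hull (\<psi> ` M)"
  proof -
    have "F \<inter> \<psi> ` interval v w = \<psi> ` M" by (auto simp: M_def)
    then show ?thesis using face_of_finite_convex_hull[OF _ F] finite_interval by simp
  qed
  then have M: "M \<noteq> {}" using ne by auto
  let ?Q = "\<lambda>(x, y). v \<preceq> x \<and> x \<preceq> y \<and> y \<preceq> w \<and> M \<subseteq> interval x y"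
  have "?Q (v, w)" using vw by (auto simp: M_def)
  then obtain xy where xy: "?Q xy" and least: "\<And>z. ?Q z \<Longrightarrow> nat (rk (snd xy) - rk (fst xy)) \<le> nat (rk (snd z) - rk (fst z))"
    using ex_has_least_nat[of ?Q "(v, w)" "\<lambda>z. nat (rk (snd z) - rk (fst z))"] by blast
  obtain x y where [simp]: "xy = (x, y)" by fastforce
  have q: "v \<preceq> x" "x \<preceq> y" "y \<preceq> w" "M \<subseteq> interval x y" using xy by auto
  have 1: "\<not> M \<subseteq> interval a y" if a: "x \<lessdot> a" "a \<preceq> y" for a
  proof
    assume "M \<subseteq> interval a y"
    then have "?Q (a, y)" using q a up.le_cov_trans[OF q(1) a(1)] by simp
    then show False using least[of "(a, y)"] up.cov_rk[OF a(1)] up.le_rk[OF a(2)] by simp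
  qed
  have 2: "\<not> M \<subseteq> interval x b" if b: "b \<lessdot> y" "x \<preceq> b" for b
  proof
    assume "M \<subseteq> interval x b"
    then have "?Q (x, b)" using q b up.cov_le_trans[OF b(1) q(3)] by simp
    then show False using least[of "(x, b)"] up.cov_rk[OF b(1)] up.le_rk[OF b(2)] by simp
  qed
  have "M = interval x y"
    using q(4) vertices_of_face[OF F M_def M q 1 2] by blast
  then show ?thesis using q FM by blast
qed

lemma interval_lattice_iso:
  "poset_iso (inclusion_poset (insert {} {interval x y | x y. x \<in> interval v w \<and> y \<in> interval v w \<and> x \<preceq> y}))
     (face_lattice (hull_on v w))"
proof -
  let ?\<A> = "insert {} {interval x y | x y. x \<in> interval v w \<and> y \<in> interval v w \<and> x \<preceq> y}"
  let ?f = "\<lambda>X. convex hull (\<psi> ` X)"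
  have emb: "?f X \<subseteq> ?f Y \<longleftrightarrow> X \<subseteq> Y" if X: "X \<in> ?\<A>" and Y: "Y \<in> ?\<A>" for X Y
  proof
    assume "X \<subseteq> Y" then show "?f X \<subseteq> ?f Y" by (intro hull_mono image_mono)
  next
    assume sub: "?f X \<subseteq> ?f Y"
    show "X \<subseteq> Y"
    proof
      fix u assume u: "u \<in> X"
      have Xs: "X \<subseteq> interval v w" using X up.le_trans by blast
      have uY: "\<psi> u \<in> ?f Y" using sub u hull_inc[of "\<psi> u" "\<psi> ` X"] by blast
      then have "Y \<noteq> {}" by auto
      then obtain x y where "Y = interval x y" "v \<preceq> x" "y \<preceq> w" using Y by blast
      then show "u \<in> Y" using mem_hull[of u x y] uY u Xs by blast
    qed
  qed
  have "inj_on ?f ?\<A>" using emb by (intro inj_onI) blast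
  moreover have "?f ` ?\<A> = {F. F face_of hull_on v w}"
  proof
    show "?f ` ?\<A> \<subseteq> {F. F face_of hull_on v w}"
    proof
      fix F assume "F \<in> ?f ` ?\<A>"
      then obtain X where X: "X \<in> ?\<A>" "F = ?f X" by blast
      show "F \<in> {F. F face_of hull_on v w}"
      proof (cases "X = {}")
        case True then show ?thesis using X by simp
      next
        case False
        then obtain x y where xy: "X = interval x y" "v \<preceq> x" "x \<preceq> w" "x \<preceq> y" "y \<preceq> w" using X by blast
        have "hull_on x y face_of hull_on v w"
          using face_of_trans[OF lower_face[OF xy(2,4,5)]] upper_face[OF xy(2)] xy(3) by blast
        then show ?thesis using X xy by simp
      qed
    qed
    show "{F. F face_of hull_on v w} \<subseteq> ?f ` ?\<A>"
    proof
      fix F assume "F \<in> {F. F face_of hull_on v w}"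
      then have F: "F face_of hull_on v w" by simp
      show "F \<in> ?f ` ?\<A>"
      proof (cases "F = {}")
        case True then show ?thesis by (intro image_eqI[of _ _ "{}"]) auto
      next
        case False
        then obtain x y where xy: "v \<preceq> x" "x \<preceq> y" "y \<preceq> w" "F = hull_on x y" using face_is_interval[OF F] by blast
        have "interval x y \<in> ?\<A>" using xy(1-3) up.le_trans[OF xy(1,2)] up.le_trans[OF xy(2,3)] by blast
        then show ?thesis using xy(4) by blast
      qed
    qed
  qed
  ultimately have "bij_betw ?f ?\<A> {F. F face_of hull_on v w}" by (simp add: bij_betw_def)
  moreover have "order_emb (inclusion_poset ?\<A>) (face_lattice (hull_on v w)) ?f"
    unfolding order_emb_def face_lattice_def
    using emb by (simp add: weak_partial_order_inclusion) (simp add: inclusion_poset_def)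
  ultimately show ?thesis
    unfolding poset_iso_def face_lattice_def by (intro exI[of _ ?f]) (simp add: inclusion_poset_def)
qed

end

theorem interval_lattice_polytopal:
  assumes "v \<preceq> w"
  shows "is_polytope_face_lattice (inclusion_poset (insert {} {interval x y | x y. x \<in> interval v w \<and> y \<in> interval v w \<and> x \<preceq> y}))"
proof -
  obtain \<psi> :: "'a \<Rightarrow> nat \<Rightarrow>\<^sub>0 real" and d where keys: "\<And>u. Poly_Mapping.keys (\<psi> u) \<subseteq> {..<d}"
    and \<psi>: "\<And>i. up.harm (\<lambda>u. Poly_Mapping.lookup (\<psi> u) i) v w"
      "\<And>x a. v \<preceq> x \<Longrightarrow> x \<lessdot> a \<Longrightarrow> a \<preceq> w \<Longrightarrow> \<exists>i. upper_facet x w a (\<lambda>u. Poly_Mapping.lookup (\<psi> u) i)"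
      "\<And>b y. v \<preceq> b \<Longrightarrow> b \<lessdot> y \<Longrightarrow> y \<preceq> w \<Longrightarrow> \<exists>i. lower_facet v y b (\<lambda>u. Poly_Mapping.lookup (\<psi> u) i)"
    using embedding_ex[of v w] by metis
  let ?P = "convex hull (\<psi> ` interval v w)"
  have "polytope ?P" unfolding polytope_def using finite_interval by blast
  moreover have "\<forall>x\<in>?P. Poly_Mapping.keys x \<subseteq> {..<d}"
  proof
    fix x assume x: "x \<in> ?P"
    have "Poly_Mapping.lookup x i = 0" if "\<not> i < d" for i
    proof (rule linear_zero_on_hull[OF linear_lookup _ x])
      fix p assume "p \<in> \<psi> ` interval v w"
      then have "Poly_Mapping.keys p \<subseteq> {..<d}" using keys by blast
      then show "Poly_Mapping.lookup p i = 0" using that by (auto simp: in_keys_iff)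
    qed
    then show "Poly_Mapping.keys x \<subseteq> {..<d}" by (auto simp: in_keys_iff)
  qed
  ultimately show ?thesis
    unfolding is_polytope_face_lattice_def using interval_lattice_iso[OF assms \<psi>] by blast
qed

end

section \<open>Covers in the Bruhat order\<close>

abbreviation tr where "tr \<equiv> Transposition.transpose"

text \<open>Conjugation by the transposition identifies the inversions of the product with the set \<open>B\<close>, which
is compared with the set \<open>A\<close> of inversions of \<open>p\<close>. The two sets differ only in pairs that involve
\<open>i\<close> or \<open>j\<close>. A position between \<open>i\<close> and \<open>j\<close> contributes two new inversions if its value lies
between \<open>p i\<close> and \<open>p j\<close>, and otherwise one inversion is exchanged for another; the pair of \<open>i\<close> and \<open>j\<close>
itself contributes one more.\<close>

lemma length_transpose:
  assumes p: "inj_on p {1..n}" and ij: "1 \<le> i" "i < j" "j \<le> n" "p i < p j"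
  shows "perm_length n (p \<circ> tr i j) = perm_length n p + 1 + 2 * card {m. i < m \<and> m < j \<and> p i < p m \<and> p m < p j}"
proof -
  let ?t = "tr i j" and ?N = "{1..n}"
  define A where "A = {(a, b). a \<in> ?N \<and> b \<in> ?N \<and> a < b \<and> p b < p a}"
  define B where "B = {(a, b). a \<in> ?N \<and> b \<in> ?N \<and> ?t a < ?t b \<and> p b < p a}"
  let ?M = "{m. i < m \<and> m < j}"
  let ?L = "{m\<in>?M. p m < p i}" and ?K = "{m\<in>?M. p i < p m \<and> p m < p j}" and ?H = "{m\<in>?M. p j < p m}"
  have fin: "finite A" "finite B"
    by (rule finite_subset[of _ "?N \<times> ?N"]; auto simp: A_def B_def)+
  have finM: "finite ?M" by (rule finite_subset[of _ "{..j}"]) auto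
  have tN: "?t a \<in> ?N \<longleftrightarrow> a \<in> ?N" for a using ij by (auto simp: Transposition.transpose_def)
  have lenA: "perm_length n p = card A"
    unfolding perm_length_def A_def by (intro arg_cong[of _ _ card]) auto
  have "perm_length n (p \<circ> ?t) = card {(a, b). a \<in> ?N \<and> b \<in> ?N \<and> a < b \<and> p (?t b) < p (?t a)}"
    unfolding perm_length_def by (intro arg_cong[of _ _ card]) auto
  also have "\<dots> = card (map_prod ?t ?t ` {(a, b). a \<in> ?N \<and> b \<in> ?N \<and> a < b \<and> p (?t b) < p (?t a)})"
    by (rule card_image[symmetric]) (auto intro!: inj_onI dest: transpose_eq_imp_eq)
  also have "map_prod ?t ?t ` {(a, b). a \<in> ?N \<and> b \<in> ?N \<and> a < b \<and> p (?t b) < p (?t a)} = B"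
  proof (intro equalityI subsetI)
    fix z assume "z \<in> B"
    then obtain a b where z: "z = (a, b)" "a \<in> ?N" "b \<in> ?N" "?t a < ?t b" "p b < p a" by (auto simp: B_def)
    have "z = map_prod ?t ?t (?t a, ?t b)" using z by simp
    moreover have "(?t a, ?t b) \<in> {(a, b). a \<in> ?N \<and> b \<in> ?N \<and> a < b \<and> p (?t b) < p (?t a)}"
      using z tN[of a] tN[of b] by simp
    ultimately show "z \<in> map_prod ?t ?t ` {(a, b). a \<in> ?N \<and> b \<in> ?N \<and> a < b \<and> p (?t b) < p (?t a)}" by blast
  next
    fix z assume "z \<in> map_prod ?t ?t ` {(a, b). a \<in> ?N \<and> b \<in> ?N \<and> a < b \<and> p (?t b) < p (?t a)}"
    then obtain a b where z: "z = (?t a, ?t b)" "a \<in> ?N" "b \<in> ?N" "a < b" "p (?t b) < p (?t a)" by auto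
    then show "z \<in> B" using tN[of a] tN[of b] by (auto simp: B_def)
  qed
  finally have lenB: "perm_length n (p \<circ> ?t) = card B" .
  have inN: "m \<in> ?N" if "m \<in> ?M" for m using that ij by auto
  have ne: "p m \<noteq> p i \<and> p m \<noteq> p j" if "m \<in> ?M" for m
    using inj_onD[OF p, of m i] inj_onD[OF p, of m j] inN[OF that] that ij by auto
  have BA: "B - A = insert (j, i) (Pair j ` (?L \<union> ?K) \<union> (\<lambda>m. (m, i)) ` (?K \<union> ?H))" (is "_ = ?R")
  proof (intro equalityI subsetI)
    fix z assume "z \<in> B - A"
    then obtain a b where z: "z = (a, b)" "a \<in> ?N" "b \<in> ?N" "?t a < ?t b" "p b < p a" "\<not> a < b"
      by (auto simp: A_def B_def)
    have "b < a" using z by (metis linorder_neqE_nat less_irrefl)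
    then consider "a = j" "b = i" | "a = j" "b \<in> ?M" | "b = i" "a \<in> ?M"
      using z(4) ij by (auto simp: Transposition.transpose_def split: if_splits)
    then show "z \<in> ?R"
    proof cases
      case 2 then show ?thesis using z ne[of b] by auto
    next
      case 3 then show ?thesis using z ne[of a] by auto
    qed (use z in auto)
  next
    fix z assume "z \<in> ?R"
    then consider "z = (j, i)" | m where "m \<in> ?M" "p m < p j" "z = (j, m)" | m where "m \<in> ?M" "p i < p m" "z = (m, i)"
      using ij by force
    then show "z \<in> B - A"
    proof cases
      case 1 then show ?thesis using ij by (auto simp: A_def B_def)
    next
      case 2 then show ?thesis using ij inN[of m] by (auto simp: A_def B_def Transposition.transpose_def)
    next
      case 3 then show ?thesis using ij inN[of m] by (auto simp: A_def B_def Transposition.transpose_def)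
    qed
  qed
  have AB: "A - B = Pair i ` ?L \<union> (\<lambda>m. (m, j)) ` ?H" (is "_ = ?R")
  proof (intro equalityI subsetI)
    fix z assume "z \<in> A - B"
    then obtain a b where z: "z = (a, b)" "a \<in> ?N" "b \<in> ?N" "\<not> ?t a < ?t b" "p b < p a" "a < b"
      by (auto simp: A_def B_def)
    consider "a = i" "b = j" | "a = i" "b \<in> ?M" | "b = j" "a \<in> ?M"
      using z ij by (auto simp: Transposition.transpose_def split: if_splits)
    then show "z \<in> ?R"
    proof cases
      case 1 then show ?thesis using z ij by auto
    qed (use z in auto)
  next
    fix z assume "z \<in> ?R"
    then consider m where "m \<in> ?M" "p m < p i" "z = (i, m)" | m where "m \<in> ?M" "p j < p m" "z = (m, j)"
      by force
    then show "z \<in> A - B"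
    proof cases
      case 1 then show ?thesis using ij inN[of m] by (auto simp: A_def B_def Transposition.transpose_def)
    next
      case 2 then show ?thesis using ij inN[of m] by (auto simp: A_def B_def Transposition.transpose_def)
    qed
  qed
  have fins: "finite ?L" "finite ?K" "finite ?H" using finM by auto
  have cLK: "card (?L \<union> ?K) = card ?L + card ?K" and cKH: "card (?K \<union> ?H) = card ?K + card ?H"
    using fins by (intro card_Un_disjoint; auto)+
  have "card (B - A) = Suc (card (Pair j ` (?L \<union> ?K) \<union> (\<lambda>m. (m, i)) ` (?K \<union> ?H)))"
    unfolding BA using finM by (intro card_insert_disjoint) auto
  also have "card (Pair j ` (?L \<union> ?K) \<union> (\<lambda>m. (m, i)) ` (?K \<union> ?H)) = card (Pair j ` (?L \<union> ?K)) + card ((\<lambda>m. (m, i)) ` (?K \<union> ?H))"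
    using finM by (intro card_Un_disjoint) auto
  also have "card (Pair j ` (?L \<union> ?K)) = card (?L \<union> ?K)" by (rule card_image) (auto intro: inj_onI)
  also have "card ((\<lambda>m. (m, i)) ` (?K \<union> ?H)) = card (?K \<union> ?H)" by (rule card_image) (auto intro: inj_onI)
  finally have cBA: "card (B - A) = 1 + card ?L + 2 * card ?K + card ?H" using cLK cKH by simp
  have "card (A - B) = card (Pair i ` ?L) + card ((\<lambda>m. (m, j)) ` ?H)"
    unfolding AB using finM by (intro card_Un_disjoint) auto
  also have "card (Pair i ` ?L) = card ?L" by (rule card_image) (auto intro: inj_onI)
  also have "card ((\<lambda>m. (m, j)) ` ?H) = card ?H" by (rule card_image) (auto intro: inj_onI)
  finally have cAB: "card (A - B) = card ?L + card ?H" .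
  have "card B = card (B \<inter> A) + card (B - A)" "card A = card (A \<inter> B) + card (A - B)"
    using fin by (simp_all add: card_Diff_subset_Int Int_commute card_mono)
  then have "card B = card A + 1 + 2 * card ?K" using cBA cAB by (simp add: Int_commute)
  moreover have "?K = {m. i < m \<and> m < j \<and> p i < p m \<and> p m < p j}" by auto
  ultimately show ?thesis using lenA lenB by simp
qed

definition incr :: "nat \<Rightarrow> (nat \<Rightarrow> nat) \<Rightarrow> nat \<Rightarrow> nat \<Rightarrow> (nat \<Rightarrow> nat) \<Rightarrow> bool" where
  "incr n x i j y \<longleftrightarrow> 1 \<le> i \<and> i < j \<and> j \<le> n \<and> x i < x j \<and> y = x \<circ> tr i j"

definition bcov :: "nat \<Rightarrow> (nat \<Rightarrow> nat) \<Rightarrow> (nat \<Rightarrow> nat) \<Rightarrow> bool" where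
  "bcov n x y \<longleftrightarrow> x permutes {1..n} \<and> (\<exists>i j. incr n x i j y) \<and> perm_length n y = perm_length n x + 1"

lemma incr_length: "x permutes {1..n} \<Longrightarrow> incr n x i j y \<Longrightarrow>
    perm_length n y = perm_length n x + 1 + 2 * card {m. i < m \<and> m < j \<and> x i < x m \<and> x m < x j}"
  unfolding incr_def using length_transpose[of x n i j] permutes_inj_on by blast

lemma incr_length_less: "x permutes {1..n} \<Longrightarrow> incr n x i j y \<Longrightarrow> perm_length n x < perm_length n y"
  using incr_length by fastforce

lemma permutes_transpose: "x permutes {1..n} \<Longrightarrow> i \<in> {1..n} \<Longrightarrow> j \<in> {1..n} \<Longrightarrow> x \<circ> tr i j permutes {1..n}"
  by (intro permutes_compose permutes_swap_id)

lemma incr_permutes: "x permutes {1..n} \<Longrightarrow> incr n x i j y \<Longrightarrow> y permutes {1..n}"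
  unfolding incr_def using permutes_transpose[of x n i j] by auto

lemma incr_cov_iff:
  assumes "x permutes {1..n}" "incr n x i j y"
  shows "bcov n x y \<longleftrightarrow> (\<forall>m. i < m \<and> m < j \<longrightarrow> \<not> (x i < x m \<and> x m < x j))"
proof -
  have "finite {m. i < m \<and> m < j \<and> x i < x m \<and> x m < x j}" by (rule finite_subset[of _ "{..j}"]) auto
  then have "card {m. i < m \<and> m < j \<and> x i < x m \<and> x m < x j} = 0 \<longleftrightarrow> (\<forall>m. i < m \<and> m < j \<longrightarrow> \<not> (x i < x m \<and> x m < x j))"
    by auto
  then show ?thesis using incr_length[OF assms] assms unfolding bcov_def by auto
qed

lemma bcov_permutes: "bcov n x y \<Longrightarrow> x permutes {1..n} \<and> y permutes {1..n}"
  unfolding bcov_def using incr_permutes by blast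

lemma bcov_length: "bcov n x y \<Longrightarrow> perm_length n y = perm_length n x + 1"
  by (simp add: bcov_def)

lemma bruhat_step_iff:
  assumes "x permutes {1..n}"
  shows "bruhat_step n x y \<longleftrightarrow> (\<exists>i j. incr n x i j y)"
proof
  assume "bruhat_step n x y"
  then obtain i j where ij: "1 \<le> i" "i < j" "j \<le> n" "y = x \<circ> tr i j" and len: "perm_length n x < perm_length n y"
    by (auto simp: bruhat_step_def)
  have "x i \<noteq> x j" using permutes_inj[OF assms] ij by (auto dest: injD)
  moreover have "\<not> x j < x i"
  proof
    assume "x j < x i"
    then have "incr n y i j x" using ij by (auto simp: incr_def comp_assoc)
    moreover have "y permutes {1..n}" using permutes_transpose[OF assms, of i j] ij by auto
    ultimately show False using incr_length_less len by fastforce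
  qed
  ultimately have "incr n x i j y" using ij by (auto simp: incr_def)
  then show "\<exists>i j. incr n x i j y" by blast
next
  assume "\<exists>i j. incr n x i j y"
  then show "bruhat_step n x y" using incr_length_less[OF assms] by (auto simp: bruhat_step_def incr_def)
qed

text \<open>If a position \<open>m\<close> obstructs the cover, the transposition of \<open>i\<close> and \<open>j\<close> is replaced by the three
transpositions of \<open>i\<close>, \<open>m\<close>, then \<open>i\<close>, \<open>j\<close>, then \<open>m\<close>, \<open>j\<close>, each of which increases the length by
less.\<close>

lemma incr_imp_le:
  assumes "x permutes {1..n}" "incr n x i j y"
  shows "(bcov n)\<^sup>*\<^sup>* x y"
  using assms
proof (induction "perm_length n y - perm_length n x" arbitrary: x y i j rule: less_induct)
  case less
  note x = less.prems(1) and xy = less.prems(2)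
  show ?case
  proof (cases "bcov n x y")
    case False
    then obtain m where m: "i < m" "m < j" "x i < x m" "x m < x j" using incr_cov_iff[OF x xy] by blast
    define x1 where "x1 = x \<circ> tr i m"
    define x2 where "x2 = x1 \<circ> tr i j"
    have ij: "1 \<le> i" "i < j" "j \<le> n" "y = x \<circ> tr i j" using xy by (auto simp: incr_def)
    have 1: "incr n x i m x1" using m ij by (simp add: incr_def x1_def)
    have x1: "x1 permutes {1..n}" using incr_permutes[OF x 1] .
    have 2: "incr n x1 i j x2" using m ij by (simp add: incr_def x2_def) (simp add: x1_def Transposition.transpose_def)
    have x2: "x2 permutes {1..n}" using incr_permutes[OF x1 2] .
    have "y = x2 \<circ> tr m j" unfolding ij(4) x2_def x1_def using m ij by (auto simp: fun_eq_iff Transposition.transpose_def)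
    then have 3: "incr n x2 m j y" using m ij by (simp add: incr_def) (simp add: x1_def x2_def Transposition.transpose_def)
    note lens = incr_length_less[OF x 1] incr_length_less[OF x1 2] incr_length_less[OF x2 3]
    have "(bcov n)\<^sup>*\<^sup>* x x1" using less.hyps[OF _ x 1] lens by linarith
    moreover have "(bcov n)\<^sup>*\<^sup>* x1 x2" using less.hyps[OF _ x1 2] lens by linarith
    moreover have "(bcov n)\<^sup>*\<^sup>* x2 y" using less.hyps[OF _ x2 3] lens by linarith
    ultimately show ?thesis by simp
  qed auto
qed

lemma bruhat_le_iff:
  assumes "x permutes {1..n}"
  shows "(bruhat_step n)\<^sup>*\<^sup>* x y \<longleftrightarrow> (bcov n)\<^sup>*\<^sup>* x y"
proof
  assume "(bruhat_step n)\<^sup>*\<^sup>* x y"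
  then have "(bcov n)\<^sup>*\<^sup>* x y \<and> y permutes {1..n}"
  proof (induction rule: rtranclp_induct)
    case (step y z)
    then obtain i j where i: "incr n y i j z" using bruhat_step_iff by blast
    then show ?case using step incr_imp_le[of y n i j z] incr_permutes[of y n i j z] by auto
  qed (use assms in auto)
  then show "(bcov n)\<^sup>*\<^sup>* x y" by blast
next
  assume "(bcov n)\<^sup>*\<^sup>* x y"
  then show "(bruhat_step n)\<^sup>*\<^sup>* x y"
  proof (rule rtranclp_mono[THEN predicate2D, rotated], intro predicate2I)
    show "bruhat_step n x y" if "bcov n x y" for x y
      using that bruhat_step_iff unfolding bcov_def by blast
  qed
qed

section \<open>Intervals of length two in the Bruhat order\<close>

text \<open>The label encodes the pair of exchanged positions; the code is monotone for the lexicographic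
order of pairs of positions up to \<open>n\<close>. Defining it by the positions at which \<open>x\<close> and \<open>y\<close> differ
makes it symmetric, so that it labels the dual order too.\<close>

definition lab :: "nat \<Rightarrow> (nat \<Rightarrow> nat) \<Rightarrow> (nat \<Rightarrow> nat) \<Rightarrow> nat" where
  "lab n x y = Min {m. x m \<noteq> y m} * (n + 1) + Max {m. x m \<noteq> y m}"

lemma lab_sym: "lab n x y = lab n y x"
  unfolding lab_def by (simp add: eq_commute)

lemma lab_incr:
  assumes "incr n x i j y" shows "lab n x y = i * (n + 1) + j"
proof -
  have "{m. x m \<noteq> y m} = {i, j}" using assms by (auto simp: incr_def Transposition.transpose_def split: if_splits)
  then show ?thesis using assms by (simp add: lab_def incr_def)
qed

lemma pair_code_less:
  assumes "j \<le> n" "i < k \<or> i = k \<and> j < l" shows "i * (n + 1) + j < k * (n + 1) + (l :: nat)"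
proof (cases "i < k")
  case True
  then have "(i + 1) * (n + 1) \<le> k * (n + 1)" by (intro mult_right_mono) auto
  then show ?thesis using assms by simp
qed (use assms in auto)

lemma pair_code_inj:
  assumes "j \<le> n" "l \<le> n" "i * (n + 1) + j = k * (n + 1) + (l :: nat)" shows "i = k \<and> j = l"
  using pair_code_less[of j n i k l] pair_code_less[of l n k i j] assms by (metis less_irrefl linorder_neqE_nat)

lemma transpose_moves: "tr i j a = b \<Longrightarrow> a \<noteq> b \<Longrightarrow> {i, j} = {a, b}"
  by (auto simp: Transposition.transpose_def split: if_splits)

lemma factor_support:
  assumes e: "\<And>m. m \<notin> T \<Longrightarrow> tr i j (tr k l m) = m" and "tr i j (tr k l a) \<noteq> a" "i \<noteq> j" "k \<noteq> (l :: nat)"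
  shows "{i, j, k, l} \<subseteq> T"
proof -
  have ne: "{i, j} \<noteq> {k, l}" using assms(2) by (auto simp: doubleton_eq_iff transpose_commute)
  have kl: "m \<in> T" if m: "m = k \<or> m = l" for m
  proof (rule ccontr)
    assume "m \<notin> T"
    then have "tr i j (if m = k then l else k) = m" using e[of m] m assms(4) by (auto split: if_splits)
    then show False using ne m assms(3,4) transpose_moves[of i j l k] transpose_moves[of i j k l] by (auto split: if_splits)
  qed
  have "m \<in> T" if m: "m = i \<or> m = j" for m
  proof (rule ccontr)
    assume mT: "m \<notin> T"
    then have "m \<noteq> k" "m \<noteq> l" using kl by auto
    then show False using e[OF mT] m assms(3) by auto
  qed
  then show ?thesis using kl by auto
qed

lemma pairs_of_three:
  assumes "{i, j} \<subseteq> {a, b, c}" "i < j" "a < b" "b < (c :: nat)"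
  shows "(i, j) \<in> {(a, b), (b, c), (a, c)}"
  using assms by auto

text \<open>The two cyclic rotations of three positions are the products of two transpositions that are
neither disjoint nor equal. Each has three factorisations, of which an interval of length two uses
those two that increase the length.\<close>

lemma factor_rot1:
  assumes "tr i j \<circ> tr k l = tr a b \<circ> tr b c" "i < j" "k < l" "a < b" "b < (c :: nat)"
  shows "(i, j, k, l) \<in> {(a, b, b, c), (b, c, a, c), (a, c, a, b)}"
proof -
  have e: "tr i j (tr k l m) = tr a b (tr b c m)" for m using fun_cong[OF assms(1), of m] by simp
  have ea: "tr i j (tr k l a) = b" and eb: "tr i j (tr k l b) = c"
    using e[of a] e[of b] assms by (simp_all add: Transposition.transpose_def)
  have "{i, j, k, l} \<subseteq> {a, b, c}" by (rule factor_support[where a = a]) (use e ea assms in auto)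
  then have "(i, j) \<in> {(a, b), (b, c), (a, c)}" "(k, l) \<in> {(a, b), (b, c), (a, c)}"
    using pairs_of_three[of i j a b c] pairs_of_three[of k l a b c] assms by auto
  then show ?thesis using ea eb assms(4,5) by (elim insertE emptyE; simp add: Transposition.transpose_def)
qed

lemma factor_rot2:
  assumes "tr i j \<circ> tr k l = tr b c \<circ> tr a b" "i < j" "k < l" "a < b" "b < (c :: nat)"
  shows "(i, j, k, l) \<in> {(a, b, a, c), (b, c, a, b), (a, c, b, c)}"
proof -
  have e: "tr i j (tr k l m) = tr b c (tr a b m)" for m using fun_cong[OF assms(1), of m] by simp
  have ea: "tr i j (tr k l a) = c" and eb: "tr i j (tr k l b) = a"
    using e[of a] e[of b] assms by (simp_all add: Transposition.transpose_def)
  have "{i, j, k, l} \<subseteq> {a, b, c}" by (rule factor_support[where a = a]) (use e ea assms in auto)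
  then have "(i, j) \<in> {(a, b), (b, c), (a, c)}" "(k, l) \<in> {(a, b), (b, c), (a, c)}"
    using pairs_of_three[of i j a b c] pairs_of_three[of k l a b c] assms by auto
  then show ?thesis using ea eb assms(4,5) by (elim insertE emptyE; simp add: Transposition.transpose_def)
qed

lemma doubleton_sorted: "{i, j} = {a, b} \<Longrightarrow> i < j \<Longrightarrow> a < (b :: nat) \<Longrightarrow> i = a \<and> j = b"
  by (metis doubleton_eq_iff less_asym)

lemma factor_disjoint:
  assumes "tr i j \<circ> tr k l = tr a b \<circ> tr c d" "i < j" "k < l" "a < b" "c < (d :: nat)" "{a, b} \<inter> {c, d} = {}"
  shows "(i, j, k, l) \<in> {(a, b, c, d), (c, d, a, b)}"
proof -
  have e: "tr i j (tr k l m) = tr a b (tr c d m)" for m using fun_cong[OF assms(1), of m] by simp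
  have ea: "tr i j (tr k l a) = b" and eb: "tr i j (tr k l b) = a" and ec: "tr i j (tr k l c) = d"
    using e[of a] e[of b] e[of c] assms by auto
  have ne: "a \<noteq> b" "c \<noteq> d" using assms by auto
  have "{i, j} = {a, b} \<or> {i, j} = {c, d}"
  proof -
    consider "a \<notin> {k, l}" | "b \<notin> {k, l}" | "{k, l} = {a, b}" using ne by blast
    then show ?thesis
    proof cases
      case 1 then show ?thesis using ea transpose_moves[of i j a b] ne by auto
    next
      case 2 then show ?thesis using eb transpose_moves[of i j b a] ne by auto
    next
      case 3
      then have "c \<noteq> k \<and> c \<noteq> l" using assms(6) by blast
      then have "tr k l c = c" by simp
      then show ?thesis using ec transpose_moves[of i j c d] ne by auto
    qed
  qed
  then show ?thesis
  proof
    assume ij: "{i, j} = {a, b}"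
    have k: "tr k l c = tr i j d" using arg_cong[OF ec, of "tr i j"] by simp
    have "d \<noteq> i \<and> d \<noteq> j" using ij assms(6) by blast
    then have "tr i j d = d" by simp
    with k have "{k, l} = {c, d}" using transpose_moves[of k l c d] ne by simp
    then show ?thesis using doubleton_sorted[OF ij] doubleton_sorted[of k l c d] assms(2-5) by simp
  next
    assume ij: "{i, j} = {c, d}"
    have k: "tr k l a = tr i j b" using arg_cong[OF ea, of "tr i j"] by simp
    have "b \<noteq> i \<and> b \<noteq> j" using ij assms(6) by blast
    then have "tr i j b = b" by simp
    with k have "{k, l} = {a, b}" using transpose_moves[of k l a b] ne by simp
    then show ?thesis using doubleton_sorted[OF ij] doubleton_sorted[of k l a b] assms(2-5) by simp
  qed
qed

lemma permutes_comp_cancel: "x permutes A \<Longrightarrow> x \<circ> f = x \<circ> g \<Longrightarrow> f = g"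
  using permutes_inj[of x A] by (auto simp: fun_eq_iff inj_eq)

lemma incr_twice: "incr n x i j m \<Longrightarrow> incr n m k l y \<Longrightarrow> y = x \<circ> (tr i j \<circ> tr k l)"
  by (simp only: incr_def o_assoc)

lemma incr_factor:
  assumes "x permutes A" "y = x \<circ> f" "incr n x i j m" "incr n m k l y"
  shows "tr i j \<circ> tr k l = f"
  using permutes_comp_cancel[OF assms(1), of "tr i j \<circ> tr k l" f] incr_twice[OF assms(3,4)] assms(2) by metis

definition lex_less :: "nat \<Rightarrow> nat \<Rightarrow> nat \<Rightarrow> nat \<Rightarrow> bool" where
  "lex_less i j k l \<longleftrightarrow> i < k \<or> i = k \<and> j < l"

text \<open>The middle element \<open>p\<close> is the one whose cover of \<open>x\<close> has the smaller label. The four comparisons of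
labels are what \<open>lab_diamond\<close> demands, for the Bruhat order and for its dual. The last clause is
the affine relation of the four permutations.\<close>

definition square :: "nat \<Rightarrow> (nat \<Rightarrow> nat) \<Rightarrow> (nat \<Rightarrow> nat) \<Rightarrow> (nat \<Rightarrow> nat) \<Rightarrow> (nat \<Rightarrow> nat) \<Rightarrow> bool" where
  "square n x p q y \<longleftrightarrow> bcov n x p \<and> bcov n p y \<and> bcov n x q \<and> bcov n q y \<and> p \<noteq> q
    \<and> (\<forall>m. bcov n x m \<and> bcov n m y \<longrightarrow> m = p \<or> m = q)
    \<and> lab n x p < lab n x q \<and> lab n x p < lab n p y \<and> lab n q y < lab n x q \<and> lab n q y < lab n p y
    \<and> (\<exists>\<alpha> \<beta> \<gamma> \<delta>. 0 < \<alpha> \<and> 0 < \<beta> \<and> 0 < \<gamma> \<and> 0 < \<delta> \<and> \<alpha> + \<delta> = \<beta> + \<gamma>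
        \<and> (\<forall>i. \<alpha> * real (x i) + \<delta> * real (y i) = \<beta> * real (p i) + \<gamma> * real (q i)))"

lemma square_intro:
  assumes x: "x permutes {1..n}" and len: "perm_length n y = perm_length n x + 2"
    and p: "incr n x i1 j1 p" "incr n p k1 l1 y" and q: "incr n x i2 j2 q" "incr n q k2 l2 y"
    and uniq: "\<And>i j k l m. incr n x i j m \<Longrightarrow> incr n m k l y \<Longrightarrow> m = p \<or> m = q"
    and lex: "lex_less i1 j1 i2 j2" "lex_less i1 j1 k1 l1" "lex_less k2 l2 i2 j2" "lex_less k2 l2 k1 l1"
    and pos: "0 < \<alpha>" "0 < \<beta>" "0 < \<gamma>" "0 < \<delta>" "\<alpha> + \<delta> = \<beta> + \<gamma>"
    and rel: "\<And>i. \<alpha> * real (x i) + \<delta> * real (y i) = \<beta> * real (p i) + \<gamma> * real (q i)"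
  shows "square n x p q y"
proof -
  have pp: "p permutes {1..n}" "q permutes {1..n}" using incr_permutes x p q by blast+
  have "perm_length n x < perm_length n p" "perm_length n p < perm_length n y"
    "perm_length n x < perm_length n q" "perm_length n q < perm_length n y"
    using incr_length_less x pp p q by blast+
  then have cov: "bcov n x p" "bcov n p y" "bcov n x q" "bcov n q y"
    using p q x pp len unfolding bcov_def by auto
  have labs: "lab n x p < lab n x q" "lab n x p < lab n p y" "lab n q y < lab n x q" "lab n q y < lab n p y"
    unfolding lab_incr[OF p(1)] lab_incr[OF p(2)] lab_incr[OF q(1)] lab_incr[OF q(2)]
    using pair_code_less lex p q unfolding lex_less_def incr_def by blast+
  moreover from this have "p \<noteq> q" by auto
  moreover have "\<forall>m. bcov n x m \<and> bcov n m y \<longrightarrow> m = p \<or> m = q"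
    using uniq unfolding bcov_def by blast
  ultimately show ?thesis using cov pos rel unfolding square_def by blast
qed

text \<open>Since \<open>x a\<close> is the smallest of the three values at \<open>a\<close>, \<open>b\<close>, \<open>c\<close>, there are two cases
for the order of the values. In both cases the coefficients of the affine relation
are differences of these values.\<close>

lemma square_rot1:
  assumes x: "x permutes {1..n}" and abc: "a < b" "b < c" and y: "y = x \<circ> (tr a b \<circ> tr b c)"
    and len: "perm_length n y = perm_length n x + 2" and m: "incr n x i j m" "incr n m k l y"
  shows "\<exists>p q. square n x p q y"
proof -
  have fac: "(i, j, k, l) \<in> {(a, b, b, c), (b, c, a, c), (a, c, a, b)}" if "incr n x i j m" "incr n m k l y" for i j k l m
  proof (rule factor_rot1)
    show "tr i j \<circ> tr k l = tr a b \<circ> tr b c" by (rule incr_factor[OF x y that])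
  qed (use that abc in \<open>auto simp: incr_def\<close>)
  have ord: "x a < x b" "x a < x c" and rng: "1 \<le> a" "c \<le> n"
  proof -
    consider "i = a" "j = b" "k = b" "l = c" | "i = b" "j = c" "k = a" "l = c" | "i = a" "j = c" "k = a" "l = b"
      using fac[OF m] by blast
    then show "x a < x b" "x a < x c" "1 \<le> a" "c \<le> n"
      by (cases; use m abc in \<open>simp add: incr_def Transposition.transpose_def\<close>)+
  qed
  have inj: "x b \<noteq> x c" using permutes_inj[OF x] abc by (auto dest: injD)
  let ?p = "x \<circ> tr a b"
  have p: "incr n x a b ?p" "incr n ?p b c y" using ord rng abc y by (auto simp: incr_def o_assoc)
  show ?thesis
  proof (cases "x b < x c")
    case True
    let ?q = "x \<circ> tr b c"
    have q: "incr n x b c ?q" "incr n ?q a c y"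
      using True ord rng abc y by (auto simp: incr_def fun_eq_iff Transposition.transpose_def)
    have "square n x ?p ?q y"
    proof (rule square_intro[OF x len p q, of "real (x c) - real (x a)" "real (x c) - real (x b)" "real (x c) - real (x a)" "real (x c) - real (x b)"])
      fix i j k l m assume m: "incr n x i j m" "incr n m k l y"
      then show "m = ?p \<or> m = ?q" using fac[OF m] True abc by (auto simp: incr_def)
    next
      fix i
      show "(real (x c) - real (x a)) * real (x i) + (real (x c) - real (x b)) * real (y i) =
          (real (x c) - real (x b)) * real (?p i) + (real (x c) - real (x a)) * real (?q i)"
        using abc y by (auto simp: Transposition.transpose_def algebra_simps)
    qed (use True ord abc in \<open>auto simp: lex_less_def\<close>)
    then show ?thesis by blast
  next
    case False
    then have cb: "x c < x b" using inj by simp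
    let ?q = "x \<circ> tr a c"
    have q: "incr n x a c ?q" "incr n ?q a b y"
      using cb ord rng abc y by (auto simp: incr_def fun_eq_iff Transposition.transpose_def)
    have "square n x ?p ?q y"
    proof (rule square_intro[OF x len p q, of "real (x b) - real (x c)" "real (x b) - real (x c)" "real (x b) - real (x a)" "real (x b) - real (x a)"])
      fix i j k l m assume m: "incr n x i j m" "incr n m k l y"
      then show "m = ?p \<or> m = ?q" using fac[OF m] cb abc by (auto simp: incr_def)
    next
      fix i
      show "(real (x b) - real (x c)) * real (x i) + (real (x b) - real (x a)) * real (y i) =
          (real (x b) - real (x c)) * real (?p i) + (real (x b) - real (x a)) * real (?q i)"
        using abc y by (auto simp: Transposition.transpose_def algebra_simps)
    qed (use cb ord abc in \<open>auto simp: lex_less_def\<close>)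
    then show ?thesis by blast
  qed
qed

text \<open>Here \<open>x c\<close> is the largest of the three values, and the cases differ in the order of the other
two.\<close>

lemma square_rot2:
  assumes x: "x permutes {1..n}" and abc: "a < b" "b < c" and y: "y = x \<circ> (tr b c \<circ> tr a b)"
    and len: "perm_length n y = perm_length n x + 2" and m: "incr n x i j m" "incr n m k l y"
  shows "\<exists>p q. square n x p q y"
proof -
  have fac: "(i, j, k, l) \<in> {(a, b, a, c), (b, c, a, b), (a, c, b, c)}" if "incr n x i j m" "incr n m k l y" for i j k l m
  proof (rule factor_rot2)
    show "tr i j \<circ> tr k l = tr b c \<circ> tr a b" by (rule incr_factor[OF x y that])
  qed (use that abc in \<open>auto simp: incr_def\<close>)
  have ord: "x b < x c" "x a < x c" and rng: "1 \<le> a" "c \<le> n"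
  proof -
    consider "i = a" "j = b" "k = a" "l = c" | "i = b" "j = c" "k = a" "l = b" | "i = a" "j = c" "k = b" "l = c"
      using fac[OF m] by blast
    then show "x b < x c" "x a < x c" "1 \<le> a" "c \<le> n"
      by (cases; use m abc in \<open>simp add: incr_def Transposition.transpose_def\<close>)+
  qed
  have inj: "x a \<noteq> x b" using permutes_inj[OF x] abc by (auto dest: injD)
  let ?q = "x \<circ> tr b c"
  have q: "incr n x b c ?q" "incr n ?q a b y" using ord rng abc y by (auto simp: incr_def o_assoc)
  show ?thesis
  proof (cases "x a < x b")
    case True
    let ?p = "x \<circ> tr a b"
    have p: "incr n x a b ?p" "incr n ?p a c y"
      using True ord rng abc y by (auto simp: incr_def fun_eq_iff Transposition.transpose_def)
    have "square n x ?p ?q y"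
    proof (rule square_intro[OF x len p q, of "real (x c) - real (x a)" "real (x c) - real (x a)" "real (x b) - real (x a)" "real (x b) - real (x a)"])
      fix i j k l m assume m: "incr n x i j m" "incr n m k l y"
      then show "m = ?p \<or> m = ?q" using fac[OF m] True abc by (auto simp: incr_def)
    next
      fix i
      show "(real (x c) - real (x a)) * real (x i) + (real (x b) - real (x a)) * real (y i) =
          (real (x c) - real (x a)) * real (?p i) + (real (x b) - real (x a)) * real (?q i)"
        using abc y by (auto simp: Transposition.transpose_def algebra_simps)
    qed (use True ord abc in \<open>auto simp: lex_less_def\<close>)
    then show ?thesis by blast
  next
    case False
    then have ba: "x b < x a" using inj by simp
    let ?p = "x \<circ> tr a c"
    have p: "incr n x a c ?p" "incr n ?p b c y"
      using ba ord rng abc y by (auto simp: incr_def fun_eq_iff Transposition.transpose_def)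
    have "square n x ?p ?q y"
    proof (rule square_intro[OF x len p q, of "real (x a) - real (x b)" "real (x c) - real (x b)" "real (x a) - real (x b)" "real (x c) - real (x b)"])
      fix i j k l m assume m: "incr n x i j m" "incr n m k l y"
      then show "m = ?p \<or> m = ?q" using fac[OF m] ba abc by (auto simp: incr_def)
    next
      fix i
      show "(real (x a) - real (x b)) * real (x i) + (real (x c) - real (x b)) * real (y i) =
          (real (x c) - real (x b)) * real (?p i) + (real (x a) - real (x b)) * real (?q i)"
        using abc y by (auto simp: Transposition.transpose_def algebra_simps)
    qed (use ba ord abc in \<open>auto simp: lex_less_def\<close>)
    then show ?thesis by blast
  qed
qed

lemma square_disjoint:
  assumes x: "x permutes {1..n}" and disj: "{a, b} \<inter> {c, d} = {}" and lt: "lex_less a b c d"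
    and p: "incr n x a b p" and y: "incr n p c d y" and len: "perm_length n y = perm_length n x + 2"
  shows "square n x p (x \<circ> tr c d) y"
proof -
  let ?q = "x \<circ> tr c d"
  have py: "p = x \<circ> tr a b" "y = x \<circ> tr a b \<circ> tr c d" "a < b" "c < d" using p y by (auto simp: incr_def)
  have ne: "a \<noteq> c" "a \<noteq> d" "b \<noteq> c" "b \<noteq> d" using disj by auto
  have q: "incr n x c d ?q" "incr n ?q a b y"
    using p y ne by (auto simp: incr_def fun_eq_iff Transposition.transpose_def)
  show ?thesis
  proof (rule square_intro[OF x len p y q, of 1 1 1 1])
    fix i j k l m assume m: "incr n x i j m" "incr n m k l y"
    have "tr i j \<circ> tr k l = tr a b \<circ> tr c d" by (rule incr_factor[OF x incr_twice[OF p y] m])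
    then have "(i, j, k, l) \<in> {(a, b, c, d), (c, d, a, b)}"
      using m py disj by (intro factor_disjoint) (auto simp: incr_def)
    then show "m = p \<or> m = ?q" using m py by (auto simp: incr_def)
  next
    fix i show "1 * real (x i) + 1 * real (y i) = 1 * real (p i) + 1 * real (?q i)"
      using py ne by (auto simp: Transposition.transpose_def)
  qed (use lt in auto)
qed

text \<open>Two transpositions that are neither equal nor disjoint share exactly one position, and their
product is one of the two cyclic rotations of the three positions involved.\<close>

lemma square_ex:
  assumes m: "bcov n x m" "bcov n m y"
  shows "\<exists>p q. square n x p q y"
proof -
  have x: "x permutes {1..n}" using bcov_permutes m by blast
  obtain i j where ij: "incr n x i j m" using m by (auto simp: bcov_def)
  obtain k l where kl: "incr n m k l y" using m by (auto simp: bcov_def)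
  have len: "perm_length n y = perm_length n x + 2" using m by (simp add: bcov_def)
  have le: "i < j" "k < l" "y = x \<circ> (tr i j \<circ> tr k l)" using ij kl by (auto simp: incr_def o_assoc)
  have ne: "\<not> (i = k \<and> j = l)" using ij kl by (auto simp: incr_def)
  note r1 = square_rot1[OF x _ _ _ len ij kl] and r2 = square_rot2[OF x _ _ _ len ij kl]
  consider "{i, j} \<inter> {k, l} = {}" | "i = k" "j < l" | "i = k" "l < j" | "j = l" "i < k" | "j = l" "k < i"
    | "j = k" | "i = l"
  proof (cases "i = k")
    case True
    then have "j < l \<or> l < j" using ne by auto
    then show ?thesis using that(2,3) True by blast
  next
    case ik: False
    show ?thesis
    proof (cases "j = l")
      case True
      have "i < k \<or> k < i" using ik by auto
      then show ?thesis using that(4,5) True by blast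
    next
      case False
      then show ?thesis using that(1,6,7) ik by auto
    qed
  qed
  then show ?thesis
  proof cases
    case 1
    show ?thesis
    proof (cases "lex_less i j k l")
      case True then show ?thesis using square_disjoint[OF x 1 True ij kl len] by blast
    next
      case False
      then have lt: "lex_less k l i j" using 1 by (auto simp: lex_less_def)
      let ?q = "x \<circ> tr k l"
      have "i \<noteq> k" "i \<noteq> l" "j \<noteq> k" "j \<noteq> l" using 1 by auto
      then have "incr n x k l ?q" "incr n ?q i j y"
        using ij kl by (auto simp: incr_def fun_eq_iff Transposition.transpose_def)
      then show ?thesis using square_disjoint[OF x _ lt _ _ len] 1 by blast
    qed
  next
    case 2
    have "tr i j \<circ> tr k l = tr j l \<circ> tr i j" using 2 le by (auto simp: fun_eq_iff Transposition.transpose_def)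
    then show ?thesis using r2[of i j l] 2 le by simp
  next
    case 3
    have "tr i j \<circ> tr k l = tr i l \<circ> tr l j" using 3 le by (auto simp: fun_eq_iff Transposition.transpose_def)
    then show ?thesis using r1[of i l j] 3 le by simp
  next
    case 4
    have "tr i j \<circ> tr k l = tr k j \<circ> tr i k" using 4 le by (auto simp: fun_eq_iff Transposition.transpose_def)
    then show ?thesis using r2[of i k j] 4 le by simp
  next
    case 5
    have "tr i j \<circ> tr k l = tr k i \<circ> tr i j" using 5 le by (auto simp: fun_eq_iff Transposition.transpose_def)
    then show ?thesis using r1[of k i j] 5 le by simp
  next
    case 6
    then show ?thesis using r1[of i j l] le by simp
  next
    case 7
    then show ?thesis using r2[of k l j] le by simp
  qed
qed

section \<open>Increasing chains in the Bruhat order\<close>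

text \<open>Covers are described for the Bruhat order (\<open>\<epsilon> = 1\<close>) and its dual (\<open>\<epsilon> = - 1\<close>) simultaneously.\<close>

definition exchange :: "nat \<Rightarrow> int \<Rightarrow> (nat \<Rightarrow> nat) \<Rightarrow> nat \<Rightarrow> nat \<Rightarrow> (nat \<Rightarrow> nat) \<Rightarrow> bool" where
  "exchange n \<epsilon> x i j a \<longleftrightarrow> 1 \<le> i \<and> i < j \<and> j \<le> n \<and> a = x \<circ> tr i j \<and> \<epsilon> * int (x i) < \<epsilon> * int (x j)
     \<and> (\<forall>m. i < m \<and> m < j \<longrightarrow> \<not> (\<epsilon> * int (x i) < \<epsilon> * int (x m) \<and> \<epsilon> * int (x m) < \<epsilon> * int (x j)))"

lemma exchange_lab: "exchange n \<epsilon> x i j a \<Longrightarrow> lab n x a = i * (n + 1) + j"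
proof -
  assume e: "exchange n \<epsilon> x i j a"
  then have "{m. x m \<noteq> a m} = {i, j}" by (auto simp: exchange_def Transposition.transpose_def split: if_splits)
  then show ?thesis using e by (simp add: lab_def exchange_def)
qed

text \<open>Along an increasing chain the left one of the exchanged positions moves to the right, and positions
that have been passed are final. So \<open>i\<close> is the first position at which \<open>x\<close> and \<open>u\<close> differ. While
it stays at \<open>i\<close> the right one moves to the right as well; therefore \<open>j\<close> is the first
position after \<open>i\<close> whose value lies beyond \<open>x i\<close> but not beyond the final value \<open>u i\<close>. This determines
\<open>i\<close> and \<open>j\<close> from \<open>x\<close> and \<open>u\<close>.\<close>

lemma increasing_chain_first:
  assumes C: "\<And>x a. C x a \<Longrightarrow> x permutes {1..n} \<and> (\<exists>i j. exchange n \<epsilon> x i j a)" and "\<epsilon> \<noteq> 0"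
    and "increasing_chain C (lab n) x a u"
  shows "\<exists>i j. exchange n \<epsilon> x i j a \<and> (\<forall>m<i. x m = u m) \<and> \<epsilon> * int (x j) \<le> \<epsilon> * int (u i)
     \<and> (\<forall>m. i < m \<and> m < j \<longrightarrow> \<not> (\<epsilon> * int (x i) < \<epsilon> * int (x m) \<and> \<epsilon> * int (x m) \<le> \<epsilon> * int (u i)))"
  using assms(3)
proof (induction rule: increasing_chain.induct)
  case (last x u)
  then obtain i j where e: "exchange n \<epsilon> x i j u" using C by blast
  have inj: "inj x" using C last permutes_inj by blast
  have "x m \<noteq> x j" if "m < j" for m using inj that by (auto dest: injD)
  then have "\<epsilon> * int (x m) \<noteq> \<epsilon> * int (x j)" if "m < j" for m using that \<open>\<epsilon> \<noteq> 0\<close> by simp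
  then have "\<forall>m. i < m \<and> m < j \<longrightarrow> \<not> (\<epsilon> * int (x i) < \<epsilon> * int (x m) \<and> \<epsilon> * int (x m) \<le> \<epsilon> * int (u i))"
    using e by (auto simp: exchange_def order_le_less)
  moreover have "\<forall>m<i. x m = u m" "\<epsilon> * int (x j) \<le> \<epsilon> * int (u i)"
    using e by (auto simp: exchange_def Transposition.transpose_def)
  ultimately show ?case using e by blast
next
  case (step x a c u)
  obtain i j where e: "exchange n \<epsilon> x i j a" using C step by blast
  obtain k l where f: "exchange n \<epsilon> a k l c" "\<forall>m<k. a m = u m" "\<epsilon> * int (a l) \<le> \<epsilon> * int (u k)"
      "\<forall>m. k < m \<and> m < l \<longrightarrow> \<not> (\<epsilon> * int (a k) < \<epsilon> * int (a m) \<and> \<epsilon> * int (a m) \<le> \<epsilon> * int (u k))"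
    using step.IH by blast
  have x: "inj x" using C step permutes_inj by blast
  have ij: "i < j" "j \<le> n" "a = x \<circ> tr i j" "\<epsilon> * int (x i) < \<epsilon> * int (x j)" "k < l" "l \<le> n" "\<epsilon> * int (a k) < \<epsilon> * int (a l)"
    and between: "\<And>m. i < m \<Longrightarrow> m < j \<Longrightarrow> \<not> (\<epsilon> * int (x i) < \<epsilon> * int (x m) \<and> \<epsilon> * int (x m) < \<epsilon> * int (x j))"
    using e f(1) by (auto simp: exchange_def)
  have a: "a i = x j" "a j = x i" "\<And>m. m \<noteq> i \<Longrightarrow> m \<noteq> j \<Longrightarrow> a m = x m"
    using ij by (auto simp: Transposition.transpose_def)
  have "i * (n + 1) + j \<le> k * (n + 1) + l" using step.hyps(3) exchange_lab[OF e] exchange_lab[OF f(1)] by simp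
  then have "i < k \<or> i = k \<and> j \<le> l"
    using pair_code_less[of l n k i j] ij by (metis linorder_neqE_nat not_le)
  then have *: "(\<forall>m<i. x m = u m) \<and> \<epsilon> * int (x j) \<le> \<epsilon> * int (u i)
     \<and> (\<forall>m. i < m \<and> m < j \<longrightarrow> \<not> (\<epsilon> * int (x i) < \<epsilon> * int (x m) \<and> \<epsilon> * int (x m) \<le> \<epsilon> * int (u i)))"
  proof
    assume ik: "i < k"
    then have "u i = x j" using f(2) a by metis
    moreover have "\<forall>m<i. x m = u m" using f(2) a(3) ik ij(1) by (metis less_trans nat_neq_iff)
    moreover have "\<epsilon> * int (x m) \<noteq> \<epsilon> * int (x j)" if "m < j" for m
      using x that \<open>\<epsilon> \<noteq> 0\<close> by (auto dest: injD)
    ultimately show ?thesis using between by (auto simp: order_le_less)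
  next
    assume ik: "i = k \<and> j \<le> l"
    then have jl: "j < l" using ij a by (metis le_neq_implies_less less_asym)
    have al: "a l = x l" using a(3) jl ij by simp
    have "\<forall>m<i. x m = u m" using f(2) a(3) ik ij(1) by (metis less_trans nat_neq_iff)
    moreover have "\<epsilon> * int (x j) \<le> \<epsilon> * int (u i)" using f(3) ij(7) a ik by simp
    moreover have "\<not> (\<epsilon> * int (x i) < \<epsilon> * int (x m) \<and> \<epsilon> * int (x m) \<le> \<epsilon> * int (u i))" if m: "i < m" "m < j" for m
    proof
      assume h: "\<epsilon> * int (x i) < \<epsilon> * int (x m) \<and> \<epsilon> * int (x m) \<le> \<epsilon> * int (u i)"
      have am: "a m = x m" using a(3) m by simp
      have "\<epsilon> * int (x m) \<noteq> \<epsilon> * int (x j)" using x m \<open>\<epsilon> \<noteq> 0\<close> by (auto dest: injD)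
      then have "\<epsilon> * int (x j) < \<epsilon> * int (x m)" using between[OF m] h by linarith
      then show False using f(4) h m jl ik a am by auto
    qed
    ultimately show ?thesis by blast
  qed
  then show ?case using e by blast
qed

lemma increasing_chain_unique:
  assumes C: "\<And>x a. C x a \<Longrightarrow> x permutes {1..n} \<and> (\<exists>i j. exchange n \<epsilon> x i j a)" and "\<epsilon> \<noteq> 0"
    and a: "increasing_chain C (lab n) x a u" and b: "increasing_chain C (lab n) x b u"
  shows "a = b"
proof -
  obtain i j where 1: "exchange n \<epsilon> x i j a" "\<forall>m<i. x m = u m" "\<epsilon> * int (x j) \<le> \<epsilon> * int (u i)"
     "\<forall>m. i < m \<and> m < j \<longrightarrow> \<not> (\<epsilon> * int (x i) < \<epsilon> * int (x m) \<and> \<epsilon> * int (x m) \<le> \<epsilon> * int (u i))"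
    using increasing_chain_first[OF C \<open>\<epsilon> \<noteq> 0\<close> a] by blast
  obtain k l where 2: "exchange n \<epsilon> x k l b" "\<forall>m<k. x m = u m" "\<epsilon> * int (x l) \<le> \<epsilon> * int (u k)"
     "\<forall>m. k < m \<and> m < l \<longrightarrow> \<not> (\<epsilon> * int (x k) < \<epsilon> * int (x m) \<and> \<epsilon> * int (x m) \<le> \<epsilon> * int (u k))"
    using increasing_chain_first[OF C \<open>\<epsilon> \<noteq> 0\<close> b] by blast
  have lt: "i < j" "k < l" "\<epsilon> * int (x i) < \<epsilon> * int (x j)" "\<epsilon> * int (x k) < \<epsilon> * int (x l)"
    using 1(1) 2(1) by (auto simp: exchange_def)
  have ne: "x i \<noteq> u i" "x k \<noteq> u k" using 1(3) 2(3) lt by auto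
  have "i = k" using 1(2) 2(2) ne by (metis linorder_neqE_nat)
  moreover from this have "j = l"
    using 1(3,4) 2(3,4) lt by (metis linorder_neqE_nat)
  ultimately show ?thesis using 1(1) 2(1) by (simp add: exchange_def)
qed

lemma bcov_exchange: "bcov n x y \<Longrightarrow> x permutes {1..n} \<and> (\<exists>i j. exchange n 1 x i j y)"
proof -
  assume c: "bcov n x y"
  then obtain i j where ij: "incr n x i j y" by (auto simp: bcov_def)
  have x: "x permutes {1..n}" using bcov_permutes c by blast
  have "exchange n 1 x i j y" using ij incr_cov_iff[OF x ij] c by (auto simp: exchange_def incr_def)
  then show ?thesis using x by blast
qed

lemma bcov_exchange_down: "bcov n y x \<Longrightarrow> x permutes {1..n} \<and> (\<exists>i j. exchange n (-1) x i j y)"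
proof -
  assume c: "bcov n y x"
  then obtain i j where ij: "incr n y i j x" by (auto simp: bcov_def)
  have y: "y permutes {1..n}" "x permutes {1..n}" using bcov_permutes c by blast+
  have b: "\<forall>m. i < m \<and> m < j \<longrightarrow> \<not> (y i < y m \<and> y m < y j)" using incr_cov_iff[OF y(1) ij] c by blast
  have "x m = y m" if "i < m" "m < j" for m using ij that by (simp add: incr_def)
  moreover have "x i = y j" "x j = y i" "y = x \<circ> tr i j" using ij by (auto simp: incr_def comp_assoc)
  ultimately have "exchange n (-1) x i j y" using ij b by (auto simp: exchange_def incr_def)
  then show ?thesis using y by blast
qed

section \<open>Chains of length three and crowns\<close>

lemma length_three: "length xs = 3 \<Longrightarrow> \<exists>a b c. xs = [a, b, c]"
  by (auto simp: numeral_3_eq_3 length_Suc_conv)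

lemma length_four: "length xs = 4 \<Longrightarrow> \<exists>a b c d. xs = [a, b, c, d]"
  by (auto simp: eval_nat_numeral length_Suc_conv)

lemma card_three_sorted:
  assumes "card (W :: nat set) = 3"
  obtains a b c where "a < b" "b < c" "W = {a, b, c}"
proof -
  have fin: "finite W" using assms card.infinite by fastforce
  let ?xs = "sorted_list_of_set W"
  have "length ?xs = 3" using assms by simp
  then obtain a b c where xs: "?xs = [a, b, c]" using length_three by blast
  have "sorted_wrt (<) ?xs" by (rule strict_sorted_list_of_set)
  then have "a < b" "b < c" unfolding xs by auto
  moreover have "W = {a, b, c}" using set_sorted_list_of_set[OF fin] xs by auto
  ultimately show ?thesis using that by blast
qed

lemma card_four_sorted:
  assumes "card (W :: nat set) = 4"
  obtains a b c d where "a < b" "b < c" "c < d" "W = {a, b, c, d}"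
proof -
  have fin: "finite W" using assms card.infinite by fastforce
  let ?xs = "sorted_list_of_set W"
  have "length ?xs = 4" using assms by simp
  then obtain a b c d where xs: "?xs = [a, b, c, d]" using length_four by blast
  have "sorted_wrt (<) ?xs" by (rule strict_sorted_list_of_set)
  then have "a < b" "b < c" "c < d" unfolding xs by auto
  moreover have "W = {a, b, c, d}" using set_sorted_list_of_set[OF fin] xs by auto
  ultimately show ?thesis using that by blast
qed

lemma chain_within_three:
  assumes "incr n x i1 j1 p" "incr n p i2 j2 q" "incr n q i3 j3 y"
    and "{i1, j1, i2, j2, i3, j3} \<subseteq> {a, b, c}" "a < b" "b < c"
  shows "x a < x b \<and> x b < x c \<and> y = x \<circ> tr a c"
proof -
  have lt: "i1 < j1" "i2 < j2" "i3 < j3" and p: "p = x \<circ> tr i1 j1" and q: "q = p \<circ> tr i2 j2" and y: "y = q \<circ> tr i3 j3"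
    and less: "x i1 < x j1" "p i2 < p j2" "q i3 < q j3"
    using assms(1-3) by (auto simp: incr_def)
  have mem: "(i1, j1) \<in> {(a, b), (b, c), (a, c)}" "(i2, j2) \<in> {(a, b), (b, c), (a, c)}" "(i3, j3) \<in> {(a, b), (b, c), (a, c)}"
    using assms(4-6) lt by (intro pairs_of_three; simp)+
  have ord: "x a < x b \<and> x b < x c \<and> y a = x c \<and> y b = x b \<and> y c = x a"
    using mem less assms(5,6) unfolding y q p
    by (elim insertE emptyE; simp add: Transposition.transpose_def)
  moreover have "y m = x m" if "m \<notin> {a, b, c}" for m
  proof -
    have "m \<noteq> i1" "m \<noteq> j1" "m \<noteq> i2" "m \<noteq> j2" "m \<noteq> i3" "m \<noteq> j3" using that assms(4) by auto
    then show ?thesis unfolding y q p by simp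
  qed
  ultimately have "y m = (x \<circ> tr a c) m" for m
    using assms(5,6) by (cases "m \<in> {a, b, c}") (auto simp: Transposition.transpose_def)
  then show ?thesis using ord by blast
qed

lemma incr_pair_neq: "incr n x i j p \<Longrightarrow> incr n p k l q \<Longrightarrow> (i, j) \<noteq> (k, l)"
  by (auto simp: incr_def)

lemma incr_disjoint_pair_neq:
  assumes "incr n x i j p" "incr n p k l q" "incr n q u v y" "{i, j} \<inter> {k, l} = {}"
  shows "(i, j) \<noteq> (u, v)"
proof
  assume "(i, j) = (u, v)"
  moreover have "i \<noteq> k" "i \<noteq> l" "j \<noteq> k" "j \<noteq> l" using assms(4) by auto
  ultimately show False using assms(1-3) by (auto simp: incr_def)
qed

text \<open>The set \<open>B\<close> separates the second transposition without affecting the first, and \<open>C\<close> separates the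
third without affecting the other two. The set \<open>C\<close> is lacking only if the third transposition lies
within the support of the first two and this support is a single block of three positions.\<close>

lemma chain_separated_or_three:
  assumes 1: "incr n x i1 j1 p" and 2: "incr n p i2 j2 q" and 3: "incr n q i3 j3 y"
  shows "(\<exists>B C. (i1 \<in> B \<longleftrightarrow> j1 \<in> B) \<and> (i2 \<in> B \<longleftrightarrow> j2 \<notin> B) \<and> (i1 \<in> C \<longleftrightarrow> j1 \<in> C) \<and> (i2 \<in> C \<longleftrightarrow> j2 \<in> C) \<and> (i3 \<in> C \<longleftrightarrow> j3 \<notin> C))
    \<or> (\<exists>a b c. a < b \<and> b < c \<and> {i1, j1, i2, j2, i3, j3} \<subseteq> {a, b, c})"
proof -
  have lt: "i1 < j1" "i2 < j2" "i3 < j3" using 1 2 3 by (auto simp: incr_def)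
  have ne12: "(i1, j1) \<noteq> (i2, j2)" and ne23: "(i2, j2) \<noteq> (i3, j3)" using incr_pair_neq 1 2 3 by blast+
  have "\<exists>B. (i1 \<in> B \<longleftrightarrow> j1 \<in> B) \<and> (i2 \<in> B \<longleftrightarrow> j2 \<notin> B)"
  proof (cases "i2 \<in> {i1, j1}")
    case False then show ?thesis using lt by (intro exI[of _ "{i2}"]) auto
  next
    case True
    then have "j2 \<notin> {i1, j1}" using lt ne12 by auto
    then show ?thesis using lt by (intro exI[of _ "{j2}"]) auto
  qed
  moreover have "(\<exists>C. (i1 \<in> C \<longleftrightarrow> j1 \<in> C) \<and> (i2 \<in> C \<longleftrightarrow> j2 \<in> C) \<and> (i3 \<in> C \<longleftrightarrow> j3 \<notin> C))
    \<or> (\<exists>a b c. a < b \<and> b < c \<and> {i1, j1, i2, j2, i3, j3} \<subseteq> {a, b, c})"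
  proof (cases "{i1, j1} \<inter> {i2, j2} = {}")
    case True
    have ne13: "(i1, j1) \<noteq> (i3, j3)" using incr_disjoint_pair_neq[OF 1 2 3 True] .
    consider "i3 \<in> {i1, j1}" | "i3 \<in> {i2, j2}" | "i3 \<notin> {i1, j1}" "i3 \<notin> {i2, j2}" by blast
    then show ?thesis
    proof cases
      case 1
      then have "j3 \<notin> {i1, j1}" using lt ne13 by auto
      then show ?thesis using 1 True by (intro disjI1 exI[of _ "{i1, j1}"]) auto
    next
      case 2
      then have "j3 \<notin> {i2, j2}" using lt ne23 by auto
      then show ?thesis using 2 True by (intro disjI1 exI[of _ "{i2, j2}"]) auto
    next
      case 3
      then show ?thesis using lt by (intro disjI1 exI[of _ "{i3}"]) auto
    qed
  next
    case False
    define T where "T = {i1, j1, i2, j2}"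
    have "card T = 3" using False lt ne12 by (auto simp: T_def card_insert_if)
    then obtain a b c where abc: "a < b" "b < c" "T = {a, b, c}" by (rule card_three_sorted)
    consider "i3 \<in> T" "j3 \<in> T" | "i3 \<notin> T" | "j3 \<notin> T" by blast
    then show ?thesis
    proof cases
      case 1
      then show ?thesis using abc unfolding T_def by (intro disjI2 exI[of _ a] exI[of _ b] exI[of _ c]) auto
    next
      case 2
      then show ?thesis using lt by (intro disjI1 exI[of _ "{i3}"]) (auto simp: T_def)
    next
      case 3
      then show ?thesis using lt by (intro disjI1 exI[of _ "{j3}"]) (auto simp: T_def)
    qed
  qed
  ultimately show ?thesis by blast
qed

text \<open>The elements are listed by increasing length.\<close>

definition crown_list :: "(nat \<Rightarrow> nat) \<Rightarrow> nat \<Rightarrow> nat \<Rightarrow> nat \<Rightarrow> (nat \<Rightarrow> nat) list" where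
  "crown_list x a b c = [x, x \<circ> tr a b, x \<circ> tr b c, x \<circ> tr a b \<circ> tr b c, x \<circ> tr b c \<circ> tr a b, x \<circ> tr a c]"

text \<open>A crown in the symmetric group consists of the rearrangements of three values \<open>x a < x b < x c\<close>
when reversing them increases the length by three only, that is, by no more than in the symmetric
group on three letters.\<close>

locale crown =
  fixes n x a b c
  assumes x: "x permutes {1..n}" and rng: "1 \<le> a" "a < b" "b < c" "c \<le> n" and ord: "x a < x b" "x b < x c"
    and len: "perm_length n (x \<circ> tr a c) = perm_length n x + 3"
begin

abbreviation "p1 \<equiv> x \<circ> tr a b"
abbreviation "p2 \<equiv> x \<circ> tr b c"
abbreviation "q1 \<equiv> x \<circ> tr a b \<circ> tr b c"
abbreviation "q2 \<equiv> x \<circ> tr b c \<circ> tr a b"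
abbreviation "y \<equiv> x \<circ> tr a c"

lemma edges: "incr n x a b p1" "incr n x b c p2" "incr n p1 b c q1" "incr n p1 a c q2"
    "incr n p2 a c q1" "incr n p2 a b q2" "incr n q1 a b y" "incr n q2 b c y"
  using rng ord by (auto simp: incr_def fun_eq_iff Transposition.transpose_def)

lemma perms: "p1 permutes {1..n}" "p2 permutes {1..n}" "q1 permutes {1..n}" "q2 permutes {1..n}" "y permutes {1..n}"
  using incr_permutes x edges by blast+

lemma lengths: "perm_length n p1 = perm_length n x + 1" "perm_length n p2 = perm_length n x + 1"
    "perm_length n q1 = perm_length n x + 2" "perm_length n q2 = perm_length n x + 2"
proof -
  have "perm_length n x < perm_length n p1" "perm_length n x < perm_length n p2"
    "perm_length n p1 < perm_length n q1" "perm_length n p1 < perm_length n q2"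
    "perm_length n p2 < perm_length n q1" "perm_length n p2 < perm_length n q2"
    "perm_length n q1 < perm_length n y" "perm_length n q2 < perm_length n y"
    using incr_length_less x perms edges by blast+
  then show "perm_length n p1 = perm_length n x + 1" "perm_length n p2 = perm_length n x + 1"
    "perm_length n q1 = perm_length n x + 2" "perm_length n q2 = perm_length n x + 2" using len by linarith+
qed

lemma covers: "bcov n x p1" "bcov n x p2" "bcov n p1 q1" "bcov n p1 q2" "bcov n p2 q1" "bcov n p2 q2" "bcov n q1 y" "bcov n q2 y"
  unfolding bcov_def using edges lengths len x perms by auto

lemma between_unique:
  assumes "a < m" "m < c" "x a < x m" "x m < x c" shows "m = b"
proof -
  let ?K = "{m. a < m \<and> m < c \<and> x a < x m \<and> x m < x c}"
  have "incr n x a c y" using rng ord by (auto simp: incr_def)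
  then have "card ?K = 1" using incr_length[OF x] len by simp
  then obtain z where z: "?K = {z}" by (rule card_1_singletonE)
  have "m \<in> ?K" "b \<in> ?K" using assms rng ord by auto
  then have "m = z" "b = z" unfolding z by simp_all
  then show ?thesis by simp
qed

text \<open>The product of the three transpositions of a maximal chain is the transposition of \<open>a\<close> and \<open>c\<close>.
Solving for the first two shows that all of them move only \<open>a\<close>, \<open>c\<close> and one more position, on
which \<open>x\<close> takes a value between \<open>x a\<close> and \<open>x c\<close>; by \<open>between_unique\<close> this position is \<open>b\<close>.\<close>

lemma chain_positions:
  assumes 1: "incr n x i1 j1 p" and 2: "incr n p i2 j2 q" and 3: "incr n q i3 j3 y" and cov: "bcov n x p"
  shows "{i1, j1, i2, j2, i3, j3} \<subseteq> {a, b, c}"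
proof -
  have lt: "i1 < j1" "i2 < j2" "i3 < j3" using 1 2 3 by (auto simp: incr_def)
  have ne12: "(i1, j1) \<noteq> (i2, j2)" using incr_pair_neq 1 2 by blast
  have ne_ac: "(i1, j1) \<noteq> (a, c)" using cov 1 len by (auto simp: bcov_def incr_def)
  have "x \<circ> (tr i1 j1 \<circ> tr i2 j2) \<circ> tr i3 j3 = x \<circ> tr a c"
    using 1 2 3 by (simp add: incr_def o_assoc)
  then have "x \<circ> (tr i1 j1 \<circ> tr i2 j2) \<circ> tr i3 j3 \<circ> tr i3 j3 = x \<circ> tr a c \<circ> tr i3 j3" by simp
  then have "x \<circ> (tr i1 j1 \<circ> tr i2 j2) = x \<circ> (tr a c \<circ> tr i3 j3)" by (simp add: comp_assoc)
  then have eq: "tr i1 j1 \<circ> tr i2 j2 = tr a c \<circ> tr i3 j3" using permutes_comp_cancel[OF x] by blast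
  have ac: "a < c" using rng by simp
  consider "{a, c} \<inter> {i3, j3} = {}" | "i3 = a" "j3 = c" | s where "{a, c} \<union> {i3, j3} = {a, c, s}" "s \<noteq> a" "s \<noteq> c"
  proof -
    have "i3 = a \<and> j3 = c \<or> {a, c} \<inter> {i3, j3} = {} \<or> (\<exists>s. {a, c} \<union> {i3, j3} = {a, c, s} \<and> s \<noteq> a \<and> s \<noteq> c)"
    proof (cases "{a, c} \<inter> {i3, j3} = {} \<or> i3 = a \<and> j3 = c")
      case False
      then consider "i3 \<in> {a, c}" "j3 \<notin> {a, c}" | "j3 \<in> {a, c}" "i3 \<notin> {a, c}" using lt ac by auto
      then show ?thesis
      proof cases
        case 1 then show ?thesis by (intro disjI2 exI[of _ j3]) auto
      next
        case 2 then show ?thesis by (intro disjI2 exI[of _ i3]) auto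
      qed
    qed blast
    then show ?thesis using that by blast
  qed
  then show ?thesis
  proof cases
    case 1
    then have "(i1, j1, i2, j2) \<in> {(a, c, i3, j3), (i3, j3, a, c)}"
      using factor_disjoint[OF eq] lt ac by blast
    then have "(i1, j1) = (i3, j3)" "(i2, j2) = (a, c)" using ne_ac by auto
    then show ?thesis using incr_disjoint_pair_neq[OF assms(1-3)] 1 by auto
  next
    case 2
    then have "tr i1 j1 \<circ> tr i2 j2 = id" using eq by simp
    then have "tr i1 j1 (tr i2 j2 i2) = i2" by (metis comp_apply id_apply)
    then have "tr i1 j1 j2 = i2" by simp
    then have "{i1, j1} = {j2, i2}" using transpose_moves[of i1 j1 j2 i2] lt by simp
    then show ?thesis using doubleton_sorted[of i1 j1 i2 j2] ne12 lt by (auto simp: insert_commute)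
  next
    case 3
    have e: "tr i1 j1 (tr i2 j2 m) = tr a c (tr i3 j3 m)" for m using fun_cong[OF eq, of m] by simp
    have i3: "{i3, j3} \<subseteq> {a, c, s}" and sin: "s = i3 \<or> s = j3" using 3 by blast+
    have sub: "{i1, j1, i2, j2} \<subseteq> {a, c, s}"
    proof (rule factor_support[where a = s])
      fix m assume "m \<notin> {a, c, s}"
      then show "tr i1 j1 (tr i2 j2 m) = m" using e i3 by auto
    next
      have "tr i3 j3 s \<in> {a, c}" using sin i3 lt 3 by auto
      then show "tr i1 j1 (tr i2 j2 s) \<noteq> s" using e[of s] 3 by (auto simp: Transposition.transpose_def split: if_splits)
    qed (use lt in auto)
    have "card {a, c, s} = 3" using 3 ac by auto
    then obtain a' b' c' where abc: "a' < b'" "b' < c'" "{a, c, s} = {a', b', c'}" by (rule card_three_sorted)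
    have sub': "{i1, j1, i2, j2, i3, j3} \<subseteq> {a', b', c'}" using sub i3 unfolding abc(3)[symmetric] by simp
    have ch: "x a' < x b' \<and> x b' < x c' \<and> y = x \<circ> tr a' c'"
      using chain_within_three[OF assms(1-3) sub' abc(1,2)] .
    then have "tr a c = tr a' c'" using permutes_comp_cancel[OF x] by blast
    then have "{a, c} = {a', c'}"
      using transpose_moves[of a c a' c'] abc by simp
    then have ac': "a = a'" "c = c'" using doubleton_sorted[of a c a' c'] abc ac by auto
    then have "b' = b" using between_unique[of b'] ch abc by auto
    then show ?thesis using sub' ac' by auto
  qed
qed

lemma interval_elements:
  assumes "(bcov n)\<^sup>*\<^sup>* x u" "(bcov n)\<^sup>*\<^sup>* u y"
  shows "u \<in> set (crown_list x a b c)"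
proof -
  have len_le: "perm_length n s \<le> perm_length n t" if "(bcov n)\<^sup>*\<^sup>* s t" for s t
    using that by (induction rule: rtranclp_induct) (auto simp: bcov_def)
  have len_eq: "s = t" if "(bcov n)\<^sup>*\<^sup>* s t" "perm_length n t \<le> perm_length n s" for s t
  proof (rule ccontr)
    assume "s \<noteq> t"
    then have "\<exists>z. (bcov n)\<^sup>*\<^sup>* s z \<and> bcov n z t" using that(1) by (metis rtranclp.cases)
    then obtain z where "(bcov n)\<^sup>*\<^sup>* s z" "bcov n z t" by blast
    then show False using len_le[of s z] that(2) bcov_length[of n z t] by auto
  qed
  have atom: "bcov n s t" if "(bcov n)\<^sup>*\<^sup>* s t" "perm_length n t = perm_length n s + 1" for s t
  proof -
    have "s \<noteq> t" using that(2) by auto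
    then have "\<exists>z. bcov n s z \<and> (bcov n)\<^sup>*\<^sup>* z t" using that(1) by (metis converse_rtranclpE)
    then obtain z where z: "bcov n s z" "(bcov n)\<^sup>*\<^sup>* z t" by blast
    then have "z = t" using len_eq[of z t] that(2) bcov_length[of n s z] by simp
    then show ?thesis using z by simp
  qed
  have first: "\<exists>z. bcov n s z \<and> (bcov n)\<^sup>*\<^sup>* z t" if "(bcov n)\<^sup>*\<^sup>* s t" "perm_length n t \<noteq> perm_length n s" for s t
    using that by (metis converse_rtranclpE)
  have tri: "{i1, j1, i2, j2, i3, j3} \<subseteq> {a, b, c} \<and> (i1, j1) \<noteq> (a, c)"
    if "bcov n x p" "incr n x i1 j1 p" "incr n p i2 j2 q" "incr n q i3 j3 y" for p q i1 j1 i2 j2 i3 j3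
    using chain_positions[OF that(2-4,1)] that(1,2) len by (auto simp: bcov_def incr_def)
  have bounds: "perm_length n x \<le> perm_length n u" "perm_length n u \<le> perm_length n x + 3"
    using len_le[OF assms(1)] len_le[OF assms(2)] len by auto
  then consider "perm_length n u = perm_length n x" | "perm_length n u = perm_length n x + 1"
    | "perm_length n u = perm_length n x + 2" | "perm_length n u = perm_length n x + 3" by linarith
  then show "u \<in> set (crown_list x a b c)"
  proof cases
    case 1 then show ?thesis using len_eq[OF assms(1)] by (simp add: crown_list_def)
  next
    case 4 then show ?thesis using len_eq[OF assms(2)] len by (simp add: crown_list_def)
  next
    case 2
    then have xu: "bcov n x u" using atom assms by simp
    obtain q where q: "bcov n u q" "(bcov n)\<^sup>*\<^sup>* q y" using first[OF assms(2)] 2 len by auto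
    have qy: "bcov n q y" using atom[OF q(2)] bcov_length[OF q(1)] 2 len by simp
    obtain i1 j1 where 1: "incr n x i1 j1 u" using xu by (auto simp: bcov_def)
    obtain i2 j2 where 2: "incr n u i2 j2 q" using q by (auto simp: bcov_def)
    obtain i3 j3 where 3: "incr n q i3 j3 y" using qy by (auto simp: bcov_def)
    have "(i1, j1) \<in> {(a, b), (b, c), (a, c)}"
      using tri[OF xu 1 2 3] 1 rng by (intro pairs_of_three) (auto simp: incr_def)
    then show ?thesis using tri[OF xu 1 2 3] 1 by (auto simp: incr_def crown_list_def)
  next
    case 3
    then have uy: "bcov n u y" using atom[OF assms(2)] len by simp
    obtain p where p: "bcov n x p" "(bcov n)\<^sup>*\<^sup>* p u" using first[OF assms(1)] 3 by auto
    have pu: "bcov n p u" using atom[OF p(2)] bcov_length[OF p(1)] 3 by simp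
    obtain i1 j1 where 1: "incr n x i1 j1 p" using p by (auto simp: bcov_def)
    obtain i2 j2 where 2: "incr n p i2 j2 u" using pu by (auto simp: bcov_def)
    obtain i3 j3 where h3: "incr n u i3 j3 y" using uy by (auto simp: bcov_def)
    have mem: "(i3, j3) \<in> {(a, b), (b, c), (a, c)}"
      using tri[OF p(1) 1 2 h3] h3 rng by (intro pairs_of_three) (auto simp: incr_def)
    have u: "u = y \<circ> tr i3 j3" using h3 by (simp add: incr_def comp_assoc)
    have "y \<circ> tr a c = x" by (simp add: comp_assoc)
    then have "(i3, j3) \<noteq> (a, c)" using u 3 by auto
    moreover have "y \<circ> tr a b = q1" "y \<circ> tr b c = q2"
      using rng by (auto simp: fun_eq_iff Transposition.transpose_def)
    ultimately show ?thesis using mem u by (auto simp: crown_list_def)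
  qed
qed

lemma elements_between: "u \<in> set (crown_list x a b c) \<Longrightarrow> (bcov n)\<^sup>*\<^sup>* x u \<and> (bcov n)\<^sup>*\<^sup>* u y"
  using covers unfolding crown_list_def
  by (auto intro: rtranclp.rtrancl_refl r_into_rtranclp rtranclp_trans)

lemma le_iff:
  assumes "u \<in> set (crown_list x a b c)" "w \<in> set (crown_list x a b c)"
  shows "(bcov n)\<^sup>*\<^sup>* u w \<longleftrightarrow> u = w \<or> perm_length n u < perm_length n w"
proof
  have len_le: "perm_length n s \<le> perm_length n t \<and> (perm_length n s = perm_length n t \<longrightarrow> s = t)" if "(bcov n)\<^sup>*\<^sup>* s t" for s t
    using that by (induction rule: rtranclp_induct) (auto simp: bcov_def)
  show "u = w \<or> perm_length n u < perm_length n w" if "(bcov n)\<^sup>*\<^sup>* u w" using len_le[OF that] by auto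
next
  assume "u = w \<or> perm_length n u < perm_length n w"
  then show "(bcov n)\<^sup>*\<^sup>* u w"
  proof
    assume l: "perm_length n u < perm_length n w"
    consider "u = x" | "w = y" | "u \<in> {p1, p2}" "w \<in> {q1, q2}"
      using assms l lengths len unfolding crown_list_def by fastforce
    then show ?thesis
    proof cases
      case 3 then show ?thesis using covers by auto
    qed (use elements_between assms in auto)
  qed simp
qed

lemma crown_distinct: "distinct (crown_list x a b c)"
proof -
  have "p1 a \<noteq> p2 a" "q1 a \<noteq> q2 a" using rng ord by (auto simp: Transposition.transpose_def)
  then have "p1 \<noteq> p2" "q1 \<noteq> q2" by metis+
  then show ?thesis using lengths len unfolding crown_list_def by (auto dest: arg_cong[of _ _ "perm_length n"])
qed

lemma crown_lengths: "map (perm_length n) (crown_list x a b c) = map ((+) (perm_length n x)) [0, 1, 1, 2, 2, 3]"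
  using lengths len by (simp add: crown_list_def)

end

text \<open>In a crown an element lies below another one as soon as its length is smaller, so that the lengths
determine the order.\<close>

lemma poset_iso_of_ranks:
  assumes A: "weak_partial_order A" "carrier A = set us" "distinct us"
    and B: "weak_partial_order B" "carrier B = set ws" "distinct ws"
    and len: "length us = length ws"
    and leA: "\<And>u v. u \<in> set us \<Longrightarrow> v \<in> set us \<Longrightarrow> le A u v \<longleftrightarrow> u = v \<or> (r u :: nat) < r v"
    and leB: "\<And>u v. u \<in> set ws \<Longrightarrow> v \<in> set ws \<Longrightarrow> le B u v \<longleftrightarrow> u = v \<or> (s u :: nat) < s v"
    and r: "map r us = map ((+) k) rs" and s: "map s ws = map ((+) l) rs"
  shows "poset_iso A B"
proof -
  let ?I = "{..<length us}"
  have bu: "bij_betw (nth us) ?I (set us)" using bij_betw_nth[OF A(3)] by auto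
  have bw: "bij_betw (nth ws) ?I (set ws)" using bij_betw_nth[OF B(3)] len by auto
  let ?g = "the_inv_into ?I (nth us)"
  have g: "bij_betw ?g (set us) ?I" using bij_betw_the_inv_into[OF bu] .
  let ?f = "nth ws \<circ> ?g"
  have f: "bij_betw ?f (set us) (set ws)" using bij_betw_trans[OF g bw] .
  have "le B (?f u) (?f v) \<longleftrightarrow> le A u v" if uv: "u \<in> set us" "v \<in> set us" for u v
  proof -
    obtain i where i: "i < length us" "u = us ! i" using uv(1) by (metis in_set_conv_nth)
    obtain j where j: "j < length us" "v = us ! j" using uv(2) by (metis in_set_conv_nth)
    have gi: "?g u = i" "?g v = j"
      using i j the_inv_into_f_f[OF bij_betw_imp_inj_on[OF bu]] by auto
    have lr: "length rs = length us" using arg_cong[OF r, of length] by simp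
    have "r u = k + rs ! i" "r v = k + rs ! j"
      using arg_cong[OF r, of "\<lambda>l. l ! i"] arg_cong[OF r, of "\<lambda>l. l ! j"] i j lr by auto
    moreover have "s (ws ! i) = l + rs ! i" "s (ws ! j) = l + rs ! j"
      using arg_cong[OF s, of "\<lambda>l. l ! i"] arg_cong[OF s, of "\<lambda>l. l ! j"] i j lr len by auto
    moreover have "ws ! i = ws ! j \<longleftrightarrow> u = v"
      using i j len A(3) B(3) by (simp add: nth_eq_iff_index_eq)
    ultimately show ?thesis
      using leA[OF uv] leB[of "ws ! i" "ws ! j"] gi i j len by auto
  qed
  then have "order_emb A B ?f" unfolding order_emb_def using A B by auto
  then show ?thesis unfolding poset_iso_def using f A(2) B(2) by auto
qed

section \<open>Affine functions of the one-line notation\<close>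

definition linear_fun :: "nat \<Rightarrow> (nat \<Rightarrow> real) \<Rightarrow> real \<Rightarrow> (nat \<Rightarrow> nat) \<Rightarrow> real" where
  "linear_fun n c k u = (\<Sum>i\<in>{1..n}. c i * real (u i)) + k"

lemma linear_fun_incr:
  assumes "incr n x i j y"
  shows "linear_fun n c k y - linear_fun n c k x = (c i - c j) * (real (x j) - real (x i))"
proof -
  have ij: "i \<in> {1..n}" "j \<in> {1..n}" "i \<noteq> j" and y: "y = x \<circ> tr i j" using assms by (auto simp: incr_def)
  have "linear_fun n c k y - linear_fun n c k x = (\<Sum>m\<in>{1..n}. c m * (real (y m) - real (x m)))"
    by (simp add: linear_fun_def sum_subtractf algebra_simps)
  also have "\<dots> = (\<Sum>m\<in>{i, j}. c m * (real (y m) - real (x m)))"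
    by (rule sum.mono_neutral_right) (use ij y in auto)
  also have "\<dots> = (c i - c j) * (real (x j) - real (x i))"
    using ij(3) y by (simp add: algebra_simps)
  finally show ?thesis .
qed

lemma linear_fun_add: "linear_fun n c (k + d) u = linear_fun n c k u + d"
  by (simp add: linear_fun_def)

lemma square_relation:
  assumes "square n x p q y"
  obtains b t m where "0 < b" "0 < t" "0 < m p" "0 < m q" "b + t = m p + m q"
    "\<And>i. b * real (x i) + t * real (y i) = m p * real (p i) + m q * real (q i)"
proof -
  obtain \<alpha> \<beta> \<gamma> \<delta> where 1: "0 < \<alpha>" "0 < \<beta>" "0 < \<gamma>" "0 < \<delta>" "\<alpha> + \<delta> = \<beta> + \<gamma>"
      "\<And>i. \<alpha> * real (x i) + \<delta> * real (y i) = \<beta> * real (p i) + \<gamma> * real (q i)"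
    and "p \<noteq> q"
    using assms unfolding square_def by blast
  then show ?thesis using that[of \<alpha> \<delta> "\<lambda>r. if r = p then \<beta> else \<gamma>"] by simp
qed

lemma square_cases:
  assumes "bcov n x p" "bcov n p y" "bcov n x q" "bcov n q y" "p \<noteq> q"
  shows "square n x p q y \<or> square n x q p y"
proof -
  obtain p' q' where s: "square n x p' q' y" using square_ex assms by blast
  then have "\<And>m. bcov n x m \<Longrightarrow> bcov n m y \<Longrightarrow> m = p' \<or> m = q'" by (simp add: square_def)
  then have "p = p' \<and> q = q' \<or> p = q' \<and> q = p'" using assms by metis
  then show ?thesis using s by blast
qed

text \<open>The coefficients depend on the ends of a diamond and on the middle element but not on the order in
which the middle elements are listed.\<close>

lemma square_weights:
  "\<exists>wb wt wm. \<forall>x p q y. bcov n x p \<and> bcov n p y \<and> bcov n x q \<and> bcov n q y \<and> p \<noteq> q \<longrightarrow>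
    0 < (wb x y :: real) \<and> 0 < (wt x y :: real) \<and> 0 < (wm x p y :: real) \<and> wb x y + wt x y = wm x p y + wm x q y \<and>
    (\<forall>i. wb x y * real (x i) + wt x y * real (y i) = wm x p y * real (p i) + wm x q y * real (q i))"
proof -
  define P where "P x y b t m \<longleftrightarrow> (\<forall>p q. bcov n x p \<and> bcov n p y \<and> bcov n x q \<and> bcov n q y \<and> p \<noteq> q \<longrightarrow>
    0 < b \<and> 0 < t \<and> 0 < m p \<and> b + t = m p + m q \<and>
    (\<forall>i. b * real (x i) + t * real (y i) = m p * real (p i) + m q * real (q i)))"
    for x y and b t :: real and m :: "(nat \<Rightarrow> nat) \<Rightarrow> real"
  have "\<exists>b t m. P x y b t m" for x y
  proof (cases "\<exists>z. bcov n x z \<and> bcov n z y")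
    case True
    then obtain p q where s: "square n x p q y" using square_ex by blast
    obtain b t m where r: "0 < b" "0 < t" "0 < m p" "0 < m q" "b + t = m p + m q"
      "\<And>i. b * real (x i) + t * real (y i) = m p * real (p i) + m q * real (q i)"
      using square_relation[OF s] by metis
    have u: "z = p \<or> z = q" if "bcov n x z" "bcov n z y" for z using s that by (simp add: square_def)
    have "P x y b t m"
      unfolding P_def
    proof (intro allI impI)
      fix p' q' assume "bcov n x p' \<and> bcov n p' y \<and> bcov n x q' \<and> bcov n q' y \<and> p' \<noteq> q'"
      then have "p' = p \<and> q' = q \<or> p' = q \<and> q' = p" using u by metis
      then show "0 < b \<and> 0 < t \<and> 0 < m p' \<and> b + t = m p' + m q' \<and>
        (\<forall>i. b * real (x i) + t * real (y i) = m p' * real (p' i) + m q' * real (q' i))"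
        using r by auto
    qed
    then show ?thesis by blast
  next
    case False
    then show ?thesis unfolding P_def by blast
  qed
  then obtain b t m where btm: "\<And>x y. P x y (b x y) (t x y) (m x y)" by metis
  define wm where "wm x p y = m x y p" for x p y
  have "P x y (b x y) (t x y) (\<lambda>p. wm x p y)" for x y using btm by (simp add: wm_def)
  then show ?thesis unfolding P_def by blast
qed

lemma linear_fun_balanced:
  assumes "b + t = m1 + m2"
    and "\<And>i. b * real (x i) + t * real (y i) = m1 * real (p i) + m2 * real (q i)"
  shows "b * linear_fun n c k x + t * linear_fun n c k y = m1 * linear_fun n c k p + m2 * linear_fun n c k q"
proof -
  have "b * linear_fun n c k x + t * linear_fun n c k y = (\<Sum>i\<in>{1..n}. c i * (b * real (x i) + t * real (y i))) + (b + t) * k"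
    by (simp add: linear_fun_def sum_distrib_left sum.distrib algebra_simps)
  also have "\<dots> = (\<Sum>i\<in>{1..n}. c i * (m1 * real (p i) + m2 * real (q i))) + (m1 + m2) * k"
    unfolding assms ..
  also have "\<dots> = m1 * linear_fun n c k p + m2 * linear_fun n c k q"
    by (simp add: linear_fun_def sum_distrib_left sum.distrib algebra_simps)
  finally show ?thesis .
qed

text \<open>The first difference is adjusted at \<open>i1\<close>, the second one by a multiple of the indicator of \<open>B\<close> and
the third one by a multiple of the indicator of \<open>C\<close>.\<close>

lemma separating_potential:
  fixes s1 s2 s3 :: real
  assumes "i1 \<noteq> j1" "i1 \<in> B \<longleftrightarrow> j1 \<in> B" "i2 \<in> B \<longleftrightarrow> j2 \<notin> B"
    "i1 \<in> C \<longleftrightarrow> j1 \<in> C" "i2 \<in> C \<longleftrightarrow> j2 \<in> C" "i3 \<in> C \<longleftrightarrow> j3 \<notin> C"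
  shows "\<exists>c. c i1 - c j1 = s1 \<and> c i2 - c j2 = s2 \<and> c i3 - c j3 = s3"
proof -
  let ?c1 = "\<lambda>m. s1 * of_bool (m = i1)"
  obtain c2 where c2: "c2 i1 - c2 j1 = s1" "c2 i2 - c2 j2 = s2"
  proof -
    let ?t = "(s2 - (?c1 i2 - ?c1 j2)) * (of_bool (i2 \<in> B) - of_bool (j2 \<in> B))"
    show ?thesis using assms that[of "\<lambda>m. ?c1 m + ?t * of_bool (m \<in> B)"]
      by (cases "i2 \<in> B") (auto simp: algebra_simps)
  qed
  let ?t = "(s3 - (c2 i3 - c2 j3)) * (of_bool (i3 \<in> C) - of_bool (j3 \<in> C))"
  show ?thesis using assms c2
    by (intro exI[of _ "\<lambda>m. c2 m + ?t * of_bool (m \<in> C)"]) (cases "i3 \<in> C"; auto simp: algebra_simps)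
qed

text \<open>With \<open>c i = X ^ i\<close> each sum becomes a nonzero polynomial in \<open>X\<close>, and finitely many polynomials
have finitely many roots.\<close>

lemma generic_coefficients:
  fixes n :: nat
  assumes "finite D" "\<And>d. d \<in> D \<Longrightarrow> \<exists>i\<in>{1..n}. d i \<noteq> (0 :: real)"
  shows "\<exists>c. \<forall>d\<in>D. (\<Sum>i\<in>{1..n}. c i * d i) \<noteq> 0"
proof -
  define P where "P d = (\<Sum>i\<in>{1..n}. monom (d i) i)" for d :: "nat \<Rightarrow> real"
  have poly: "poly (P d) X = (\<Sum>i\<in>{1..n}. X ^ i * d i)" for d X
    by (simp add: P_def poly_sum poly_monom mult.commute)
  have "finite {X. poly (P d) X = 0}" if d: "d \<in> D" for d
  proof -
    obtain i where "i \<in> {1..n}" "d i \<noteq> 0" using assms(2)[OF d] by blast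
    then have "coeff (P d) i \<noteq> 0" by (simp add: P_def coeff_sum if_distrib[of "\<lambda>x. x = _"] sum.delta)
    then have "P d \<noteq> 0" by auto
    then show ?thesis by (rule poly_roots_finite)
  qed
  then have "finite (\<Union>d\<in>D. {X. poly (P d) X = 0})" using assms(1) by blast
  then obtain X where "X \<notin> (\<Union>d\<in>D. {X. poly (P d) X = 0})"
    using ex_new_if_finite[OF infinite_UNIV_char_0] by blast
  then show ?thesis using poly by (intro exI[of _ "\<lambda>i. X ^ i"]) auto
qed

lemma generic_ratio:
  assumes "finite S" "\<And>u. u \<in> S \<Longrightarrow> u permutes {1..n}"
  shows "\<exists>c. inj_on (linear_fun n c 0) S \<and>
    (\<forall>i j k l. 1 \<le> i \<and> i < j \<and> j \<le> n \<and> 1 \<le> k \<and> k < l \<and> l \<le> n \<and> (i, j) \<noteq> (k, l) \<longrightarrow>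
      (c i - c j) * (real l - real k) \<noteq> (c k - c l) * (real j - real i))"
proof -
  let ?N = "{1..n}"
  define D1 where "D1 = (\<lambda>(u, u') i. real (u i) - real (u' i)) ` {(u, u'). u \<in> S \<and> u' \<in> S \<and> u \<noteq> u'}"
  define Q where "Q = {(i, j, k, l). i \<in> ?N \<and> j \<in> ?N \<and> k \<in> ?N \<and> l \<in> ?N \<and> i < j \<and> k < l \<and> (i, j) \<noteq> (k, l)}"
  define vec where "vec = (\<lambda>(i, j, k, l) m. (of_bool (m = i) - of_bool (m = j)) * (real l - real k)
      - (of_bool (m = k) - of_bool (m = l)) * (real j - real i))"
  have "finite Q" by (rule finite_subset[of _ "?N \<times> ?N \<times> ?N \<times> ?N"]) (auto simp: Q_def)
  moreover have "finite {(u, u'). u \<in> S \<and> u' \<in> S \<and> u \<noteq> u'}"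
    by (rule finite_subset[of _ "S \<times> S"]) (use assms(1) in auto)
  then have "finite D1" unfolding D1_def by (rule finite_imageI)
  ultimately have "finite (D1 \<union> vec ` Q)" by blast
  moreover have "\<exists>i\<in>?N. d i \<noteq> 0" if "d \<in> D1 \<union> vec ` Q" for d
    using that
  proof
    assume "d \<in> D1"
    then obtain u u' where u: "u \<in> S" "u' \<in> S" "u \<noteq> u'" "\<And>i. d i = real (u i) - real (u' i)" by (auto simp: D1_def)
    then obtain i where i: "u i \<noteq> u' i" by blast
    moreover have "i \<in> ?N"
    proof (rule ccontr)
      assume "i \<notin> ?N"
      then have "u i = i" "u' i = i" using u assms(2) permutes_not_in by metis+
      then show False using i by simp
    qed
    ultimately show ?thesis using u(4) by (intro bexI[of _ i]) auto
  next
    assume "d \<in> vec ` Q"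
    then obtain i j k l where q: "i \<in> ?N" "j \<in> ?N" "k \<in> ?N" "l \<in> ?N" "i < j" "k < l" "(i, j) \<noteq> (k, l)" "d = vec (i, j, k, l)"
      by (auto simp: Q_def)
    consider "i < k" | "k < i" | "i = k" "j < l" | "i = k" "l < j" using q(7) by fastforce
    then show ?thesis
    proof cases
      case 1 then have "d i \<noteq> 0" using q by (simp add: vec_def) then show ?thesis using q by blast
    next
      case 2 then have "d k \<noteq> 0" using q by (simp add: vec_def) then show ?thesis using q by blast
    next
      case 3 then have "d l \<noteq> 0" using q by (simp add: vec_def) then show ?thesis using q by blast
    next
      case 4 then have "d j \<noteq> 0" using q by (simp add: vec_def) then show ?thesis using q by blast
    qed
  qed
  ultimately obtain c where c: "\<And>d. d \<in> D1 \<union> vec ` Q \<Longrightarrow> (\<Sum>i\<in>?N. c i * d i) \<noteq> 0"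
    using generic_coefficients[of "D1 \<union> vec ` Q" n] by blast
  have "inj_on (linear_fun n c 0) S"
  proof (rule inj_onI, rule ccontr)
    fix u u' assume u: "u \<in> S" "u' \<in> S" "linear_fun n c 0 u = linear_fun n c 0 u'" "u \<noteq> u'"
    have "(\<lambda>i. real (u i) - real (u' i)) \<in> D1"
      unfolding D1_def using u by (intro image_eqI[of _ _ "(u, u')"]) auto
    then have "(\<Sum>i\<in>?N. c i * (real (u i) - real (u' i))) \<noteq> 0" using c by blast
    then show False using u(3) by (simp add: linear_fun_def sum_subtractf right_diff_distrib)
  qed
  moreover have "(c i - c j) * (real l - real k) \<noteq> (c k - c l) * (real j - real i)"
    if q: "1 \<le> i \<and> i < j \<and> j \<le> n \<and> 1 \<le> k \<and> k < l \<and> l \<le> n \<and> (i, j) \<noteq> (k, l)" for i j k l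
  proof -
    have "(i, j, k, l) \<in> Q" using q by (auto simp: Q_def)
    then have "(\<Sum>m\<in>?N. c m * vec (i, j, k, l) m) \<noteq> 0" using c by blast
    moreover have pick: "(\<Sum>m\<in>?N. c m * of_bool (m = r)) = c r" if "r \<in> ?N" for r
      using that by (simp add: of_bool_def if_distrib[of "\<lambda>x. _ * x"] sum.delta cong: if_cong)
    have "c m * vec (i, j, k, l) m = (c m * of_bool (m = i) - c m * of_bool (m = j)) * (real l - real k)
      - (c m * of_bool (m = k) - c m * of_bool (m = l)) * (real j - real i)" for m
      by (simp add: vec_def algebra_simps)
    then have "(\<Sum>m\<in>?N. c m * vec (i, j, k, l) m)
      = ((\<Sum>m\<in>?N. c m * of_bool (m = i)) - (\<Sum>m\<in>?N. c m * of_bool (m = j))) * (real l - real k)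
      - ((\<Sum>m\<in>?N. c m * of_bool (m = k)) - (\<Sum>m\<in>?N. c m * of_bool (m = l))) * (real j - real i)"
      by (simp only: sum_subtractf sum_distrib_right[symmetric])
    then have "(\<Sum>m\<in>?N. c m * vec (i, j, k, l) m) = (c i - c j) * (real l - real k) - (c k - c l) * (real j - real i)"
      using q by (simp only: pick atLeastAtMost_iff) (simp add: pick)
    ultimately show ?thesis by auto
  qed
  ultimately show ?thesis by (intro exI[of _ c]) blast
qed

section \<open>Atoms of intervals of length three\<close>

lemma card_pairs_le:
  fixes U :: "nat set"
  assumes "finite U" "card U \<le> 3"
  shows "card {(k, l). k \<in> U \<and> l \<in> U \<and> k < l} \<le> 3"
proof -
  have "card {(k, l). k \<in> U \<and> l \<in> U \<and> k < l} \<le> card {B. B \<subseteq> U \<and> card B = 2}"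
  proof (rule card_inj_on_le)
    show "inj_on (\<lambda>(k, l). {k, l}) {(k, l). k \<in> U \<and> l \<in> U \<and> k < l}"
      by (auto simp: inj_on_def doubleton_eq_iff)
    show "(\<lambda>(k, l). {k, l}) ` {(k, l). k \<in> U \<and> l \<in> U \<and> k < l} \<subseteq> {B. B \<subseteq> U \<and> card B = 2}" by auto
    show "finite {B. B \<subseteq> U \<and> card B = 2}" using assms(1) by simp
  qed
  also have "\<dots> = card U choose 2" using n_subsets[OF assms(1)] .
  also have "\<dots> \<le> 3 choose 2" using assms(2) by (rule binomial_right_mono)
  finally show ?thesis by (simp add: choose_two)
qed

text \<open>Each of the six pairs belongs to two of the four triangles. A pair missing from one triangle leaves
a triangle without this pair, from which another pair is missing.\<close>

lemma triangle_free_card: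
  fixes a b c d :: nat
  assumes "a < b" "b < c" "c < d"
    and K: "\<And>k l. (k, l) \<in> K \<Longrightarrow> k < l \<and> k \<in> {a, b, c, d} \<and> l \<in> {a, b, c, d}"
    and tri: "\<And>p q r. p < q \<Longrightarrow> q < r \<Longrightarrow> (p, q) \<in> K \<Longrightarrow> (q, r) \<in> K \<Longrightarrow> (p, r) \<in> K \<Longrightarrow> False"
  shows "card K \<le> 4"
proof -
  define A where "A = {(a, b), (a, c), (a, d), (b, c), (b, d), (c, d)}"
  have KA: "K \<subseteq> A"
  proof
    fix e assume e: "e \<in> K"
    obtain k l where kl: "e = (k, l)" by fastforce
    have "k < l" "k \<in> {a, b, c, d}" "l \<in> {a, b, c, d}" using K[of k l] e unfolding kl by simp_all
    then show "e \<in> A" using assms(1-3) unfolding kl A_def by (elim insertE emptyE; simp)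
  qed
  have A: "card A = 6" "finite A" using assms(1-3) by (auto simp: A_def)
  have "\<exists>e f. e \<in> A \<and> f \<in> A \<and> e \<noteq> f \<and> e \<notin> K \<and> f \<notin> K"
  proof -
    have lt: "a < c" "a < d" "b < d" using assms(1-3) by auto
    have ne: "(a, b) \<noteq> (a, c)" "(a, b) \<noteq> (c, d)" "(a, b) \<noteq> (a, d)" "(b, c) \<noteq> (a, c)" "(b, c) \<noteq> (c, d)"
      "(b, c) \<noteq> (a, d)" "(a, c) \<noteq> (a, b)" "(a, c) \<noteq> (b, d)" "(a, c) \<noteq> (a, d)"
      using assms(1-3) by auto
    have mem: "(a, b) \<in> A" "(a, c) \<in> A" "(a, d) \<in> A" "(b, c) \<in> A" "(b, d) \<in> A" "(c, d) \<in> A"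
      by (simp_all add: A_def)
    consider "(a, b) \<notin> K" | "(b, c) \<notin> K" | "(a, c) \<notin> K" using tri assms(1,2) by blast
    then show ?thesis
    proof cases
      case 1
      have "(a, c) \<notin> K \<or> (c, d) \<notin> K \<or> (a, d) \<notin> K" using tri[of a c d] assms(3) lt by blast
      then show ?thesis using 1 ne mem by metis
    next
      case 2
      have "(a, c) \<notin> K \<or> (c, d) \<notin> K \<or> (a, d) \<notin> K" using tri[of a c d] assms(3) lt by blast
      then show ?thesis using 2 ne mem by metis
    next
      case 3
      have "(a, b) \<notin> K \<or> (b, d) \<notin> K \<or> (a, d) \<notin> K" using tri[of a b d] assms(1) lt by blast
      then show ?thesis using 3 ne mem by metis
    qed
  qed
  then obtain e f where ef: "e \<in> A" "f \<in> A" "e \<noteq> f" "e \<notin> K" "f \<notin> K" by blast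
  have "card K \<le> card (A - {e, f})" using KA ef A by (intro card_mono) auto
  also have "\<dots> = 4" using ef A by (simp add: card_Diff_subset)
  finally show ?thesis .
qed

lemma ordered_pair_eq: "{k, l} \<subseteq> {i, j} \<Longrightarrow> k < l \<Longrightarrow> i < j \<Longrightarrow> (k, l) = (i, j :: nat)"
  by auto

text \<open>The pairs \<open>(i1, j1)\<close>, \<open>(i2, j2)\<close>, \<open>(i3, j3)\<close> are the edges of a graph, and each pair in \<open>K\<close> lies
inside a connected component of this graph.\<close>

context
  fixes i1 j1 i2 j2 i3 j3 :: nat and K :: "(nat \<times> nat) set"
  assumes lt: "i1 < j1" "i2 < j2" "i3 < j3" and K: "\<forall>k l. (k, l) \<in> K \<longrightarrow> k < l"
    and confined: "\<forall>B k l. (i1 \<in> B \<longleftrightarrow> j1 \<in> B) \<and> (i2 \<in> B \<longleftrightarrow> j2 \<in> B) \<and> (i3 \<in> B \<longleftrightarrow> j3 \<in> B) \<and> (k, l) \<in> K \<longrightarrow> (k \<in> B \<longleftrightarrow> l \<in> B)"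
begin

lemma closed:
  "(k, l) \<in> K \<Longrightarrow> i1 \<in> B \<longleftrightarrow> j1 \<in> B \<Longrightarrow> i2 \<in> B \<longleftrightarrow> j2 \<in> B \<Longrightarrow> i3 \<in> B \<longleftrightarrow> j3 \<in> B \<Longrightarrow> k \<in> B \<longleftrightarrow> l \<in> B"
  using confined by blast

lemma pairs_in_support:
  assumes kl: "(k, l) \<in> K" shows "{k, l} \<subseteq> {i1, j1, i2, j2, i3, j3}"
proof -
  have "k \<noteq> l" using K[rule_format, OF kl] by simp
  then show ?thesis using closed[OF kl, of "{k}"] closed[OF kl, of "{l}"] by blast
qed

lemma few_pairs_split:
  assumes 1: "{i1, j1} \<inter> {i2, j2} = {}" "{i1, j1} \<inter> {i3, j3} = {}"
  shows "card K \<le> 4"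
proof -
  let ?U = "{i2, j2, i3, j3}"
  have split: "(k, l) = (i1, j1) \<or> {k, l} \<subseteq> ?U" if kl: "(k, l) \<in> K" for k l
  proof -
    have "k \<in> {i1, j1} \<longleftrightarrow> l \<in> {i1, j1}" using closed[OF kl, of "{i1, j1}"] 1 by auto
    moreover have "{k, l} \<subseteq> {i1, j1} \<union> ?U" using pairs_in_support[OF kl] by blast
    ultimately have "{k, l} \<subseteq> {i1, j1} \<or> {k, l} \<subseteq> ?U" by blast
    then show ?thesis using ordered_pair_eq[OF _ K[rule_format, OF kl] lt(1)] by blast
  qed
  show ?thesis
  proof (cases "{i2, j2} \<inter> {i3, j3} = {}")
    case True
    have "e \<in> {(i1, j1), (i2, j2), (i3, j3)}" if e: "e \<in> K" for e
    proof -
      obtain k l where kl: "e = (k, l)" by fastforce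
      then have kl': "(k, l) \<in> K" using e by simp
      have "k \<in> {i2, j2} \<longleftrightarrow> l \<in> {i2, j2}" using closed[OF kl', of "{i2, j2}"] 1 True by auto
      then have "(k, l) = (i1, j1) \<or> {k, l} \<subseteq> {i2, j2} \<or> {k, l} \<subseteq> {i3, j3}" using split[OF kl'] by blast
      then show ?thesis
        using ordered_pair_eq[OF _ K[rule_format, OF kl'] lt(2)] ordered_pair_eq[OF _ K[rule_format, OF kl'] lt(3)] kl by blast
    qed
    then have "K \<subseteq> {(i1, j1), (i2, j2), (i3, j3)}" by blast
    then have "card K \<le> card {(i1, j1), (i2, j2), (i3, j3)}" by (intro card_mono) auto
    also have "\<dots> \<le> 4" by (simp add: card_insert_if)
    finally show ?thesis .
  next
    case False
    then have "card ?U \<le> 3" by (auto simp: card_insert_if)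
    then have c3: "card {(k, l). k \<in> ?U \<and> l \<in> ?U \<and> k < l} \<le> 3" by (intro card_pairs_le) auto
    have fin: "finite {(k, l). k \<in> ?U \<and> l \<in> ?U \<and> k < l}" by (rule finite_subset[of _ "?U \<times> ?U"]) auto
    have "K \<subseteq> insert (i1, j1) {(k, l). k \<in> ?U \<and> l \<in> ?U \<and> k < l}"
    proof
      fix e assume e: "e \<in> K"
      obtain k l where kl: "e = (k, l)" by fastforce
      then have kl': "(k, l) \<in> K" using e by simp
      then show "e \<in> insert (i1, j1) {(k, l). k \<in> ?U \<and> l \<in> ?U \<and> k < l}" using split[OF kl'] K[rule_format, OF kl'] kl by simp
    qed
    then have "card K \<le> card (insert (i1, j1) {(k, l). k \<in> ?U \<and> l \<in> ?U \<and> k < l})"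
      using fin by (intro card_mono) blast+
    also have "\<dots> \<le> 4" using c3 fin by (simp add: card_insert_if)
    finally show ?thesis .
  qed
qed

end

text \<open>Either one of the three edges is disjoint from the other two, or the graph has at most four
vertices and then \<open>tri\<close> applies.\<close>

lemma few_pairs:
  fixes i1 j1 i2 j2 i3 j3 :: nat and K :: "(nat \<times> nat) set"
  assumes lt: "i1 < j1" "i2 < j2" "i3 < j3" and K: "\<forall>k l. (k, l) \<in> K \<longrightarrow> k < l"
    and confined: "\<forall>B k l. (i1 \<in> B \<longleftrightarrow> j1 \<in> B) \<and> (i2 \<in> B \<longleftrightarrow> j2 \<in> B) \<and> (i3 \<in> B \<longleftrightarrow> j3 \<in> B) \<and> (k, l) \<in> K \<longrightarrow> (k \<in> B \<longleftrightarrow> l \<in> B)"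
    and tri: "\<And>a b c. a < b \<Longrightarrow> b < c \<Longrightarrow> (a, b) \<in> K \<Longrightarrow> (b, c) \<in> K \<Longrightarrow> (a, c) \<in> K \<Longrightarrow> False"
  shows "card K \<le> 4"
proof -
  let ?e1 = "{i1, j1}" and ?e2 = "{i2, j2}" and ?e3 = "{i3, j3}"
  consider "?e1 \<inter> ?e2 = {}" "?e1 \<inter> ?e3 = {}" | "?e2 \<inter> ?e1 = {}" "?e2 \<inter> ?e3 = {}" | "?e3 \<inter> ?e1 = {}" "?e3 \<inter> ?e2 = {}"
    | "card (?e1 \<union> ?e2 \<union> ?e3) \<le> 4"
  proof -
    have c2: "card ?e1 \<le> 2" "card ?e2 \<le> 2" "card ?e3 \<le> 2" by (auto simp: card_insert_if)
    have meet: "card (A \<union> B) \<le> card A + 1" if "A \<inter> B \<noteq> {}" "card B \<le> 2" "finite A" "finite B" for A B :: "nat set"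
    proof -
      have "0 < card (A \<inter> B)" using that by (simp add: card_gt_0_iff)
      then show ?thesis using card_Un_Int[OF that(3,4)] that(2) by linarith
    qed
    have m1: "card (?e1 \<union> ?e2 \<union> ?e3) \<le> 4" if "?e1 \<inter> ?e2 \<noteq> {}" "(?e1 \<union> ?e2) \<inter> ?e3 \<noteq> {}"
      using meet[OF that(1)] meet[OF that(2)] c2 by simp
    have m2: "card (?e1 \<union> ?e3 \<union> ?e2) \<le> 4" if "?e1 \<inter> ?e3 \<noteq> {}" "(?e1 \<union> ?e3) \<inter> ?e2 \<noteq> {}"
      using meet[OF that(1)] meet[OF that(2)] c2 by simp
    have eq: "?e1 \<union> ?e3 \<union> ?e2 = ?e1 \<union> ?e2 \<union> ?e3" by (simp only: Un_assoc Un_commute[of ?e3])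
    show ?thesis
    proof (cases "?e1 \<inter> ?e2 = {}")
      case True
      note 12 = this
      show ?thesis
      proof (cases "?e1 \<inter> ?e3 = {}")
        case True then show ?thesis using that(1) 12 by simp
      next
        case 13: False
        show ?thesis
        proof (cases "?e2 \<inter> ?e3 = {}")
          case True then show ?thesis using that(2) 12 by (simp add: Int_commute)
        next
          case False
          then have "(?e1 \<union> ?e3) \<inter> ?e2 \<noteq> {}" by (simp only: Int_Un_distrib2 Int_commute[of ?e3]) simp
          then show ?thesis using that(4) m2[OF 13] unfolding eq by blast
        qed
      qed
    next
      case 12: False
      show ?thesis
      proof (cases "(?e1 \<union> ?e2) \<inter> ?e3 = {}")
        case True
        then have "?e1 \<inter> ?e3 = {} \<and> ?e2 \<inter> ?e3 = {}" by (simp only: Int_Un_distrib2 Un_empty)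
        then show ?thesis using that(3) by (simp only: Int_commute[of ?e3])
      next
        case False then show ?thesis using that(4) m1[OF 12] by blast
      qed
    qed
  qed
  then show ?thesis
  proof cases
    case 1 then show ?thesis using few_pairs_split[OF lt K confined] by blast
  next
    case 2
    have "\<forall>B k l. (i2 \<in> B \<longleftrightarrow> j2 \<in> B) \<and> (i1 \<in> B \<longleftrightarrow> j1 \<in> B) \<and> (i3 \<in> B \<longleftrightarrow> j3 \<in> B) \<and> (k, l) \<in> K \<longrightarrow> (k \<in> B \<longleftrightarrow> l \<in> B)"
      using confined by blast
    then show ?thesis using few_pairs_split[OF lt(2,1,3) K] 2 by blast
  next
    case 3
    have "\<forall>B k l. (i3 \<in> B \<longleftrightarrow> j3 \<in> B) \<and> (i1 \<in> B \<longleftrightarrow> j1 \<in> B) \<and> (i2 \<in> B \<longleftrightarrow> j2 \<in> B) \<and> (k, l) \<in> K \<longrightarrow> (k \<in> B \<longleftrightarrow> l \<in> B)"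
      using confined by blast
    then show ?thesis using few_pairs_split[OF lt(3,1,2) K] 3 by blast
  next
    case 4
    let ?T = "?e1 \<union> ?e2 \<union> ?e3"
    have T: "k < l \<and> k \<in> ?T \<and> l \<in> ?T" if "(k, l) \<in> K" for k l
      using pairs_in_support[OF lt K confined that] K[rule_format, OF that] by blast
    show ?thesis
    proof (cases "card ?T = 4")
      case True
      obtain a b c d where abcd: "a < b" "b < c" "c < d" "?T = {a, b, c, d}" using card_four_sorted[OF True] .
      show ?thesis
      proof (rule triangle_free_card[OF abcd(1-3)])
        fix k l assume "(k, l) \<in> K"
        then show "k < l \<and> k \<in> {a, b, c, d} \<and> l \<in> {a, b, c, d}" using T unfolding abcd(4) by blast
      qed (rule tri)
    next
      case False
      then have c3: "card {(k, l). k \<in> ?T \<and> l \<in> ?T \<and> k < l} \<le> 3" using 4 by (intro card_pairs_le) auto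
      have fin: "finite {(k, l). k \<in> ?T \<and> l \<in> ?T \<and> k < l}" by (rule finite_subset[of _ "?T \<times> ?T"], blast, simp)
      have "K \<subseteq> {(k, l). k \<in> ?T \<and> l \<in> ?T \<and> k < l}"
      proof (rule subrelI)
        fix k l assume "(k, l) \<in> K"
        then show "(k, l) \<in> {(k, l). k \<in> ?T \<and> l \<in> ?T \<and> k < l}" using T by blast
      qed
      then have "card K \<le> card {(k, l). k \<in> ?T \<and> l \<in> ?T \<and> k < l}" by (rule card_mono[OF fin])
      then show ?thesis using c3 by linarith
    qed
  qed
qed

section \<open>Crown-free Bruhat intervals\<close>

lemma chain_three_crown:
  assumes cov: "bcov n x p" "bcov n p q" "bcov n q y"
    and edges: "incr n x i1 j1 p" "incr n p i2 j2 q" "incr n q i3 j3 y"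
    and sub: "{i1, j1, i2, j2, i3, j3} \<subseteq> {a, b, c}" "a < b" "b < c"
  shows "crown n x a b c \<and> y = x \<circ> tr a c"
proof -
  have ch: "x a < x b" "x b < x c" "y = x \<circ> tr a c" using chain_within_three[OF edges sub] by blast+
  have x: "x permutes {1..n}" and y: "y permutes {1..n}" using bcov_permutes cov by blast+
  have yac: "y a = x c" "y c = x a" using ch(3) by auto
  have "a \<in> {1..n}"
  proof (rule ccontr)
    assume "a \<notin> {1..n}"
    then have "x a = a" "y a = a" using x y permutes_not_in by metis+
    then show False using yac ch by simp
  qed
  moreover have "c \<in> {1..n}"
  proof (rule ccontr)
    assume "c \<notin> {1..n}"
    then have "x c = c" "y c = c" using x y permutes_not_in by metis+
    then show False using yac ch by simp
  qed
  moreover have "perm_length n y = perm_length n x + 3" using cov by (simp add: bcov_def)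
  ultimately show ?thesis unfolding crown_def using ch x sub(2,3) by auto
qed

lemma incr_back: "incr n x i j y \<Longrightarrow> x = y \<circ> tr i j"
  by (simp add: incr_def comp_assoc)

text \<open>The coefficients of the affine relations are parameters because they are obtained by choice.\<close>

locale crown_free =
  fixes n :: nat and v w :: "nat \<Rightarrow> nat" and wb wt :: "(nat \<Rightarrow> nat) \<Rightarrow> (nat \<Rightarrow> nat) \<Rightarrow> real"
    and wm :: "(nat \<Rightarrow> nat) \<Rightarrow> (nat \<Rightarrow> nat) \<Rightarrow> (nat \<Rightarrow> nat) \<Rightarrow> real"
  assumes v: "v permutes {1..n}"
    and no_crown: "crown n x a b c \<Longrightarrow> (bcov n)\<^sup>*\<^sup>* v x \<Longrightarrow> (bcov n)\<^sup>*\<^sup>* (x \<circ> tr a c) w \<Longrightarrow> False"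
    and square_wts: "bcov n x p \<Longrightarrow> bcov n p y \<Longrightarrow> bcov n x q \<Longrightarrow> bcov n q y \<Longrightarrow> p \<noteq> q \<Longrightarrow>
      0 < wb x y \<and> 0 < wt x y \<and> 0 < wm x p y \<and> wb x y + wt x y = wm x p y + wm x q y \<and>
      (\<forall>i. wb x y * real (x i) + wt x y * real (y i) = wm x p y * real (p i) + wm x q y * real (q i))"
begin

definition S where "S = {u. (bcov n)\<^sup>*\<^sup>* v u \<and> (bcov n)\<^sup>*\<^sup>* u w}"

definition cv (infix \<open>\<lessdot>\<close> 50) where "x \<lessdot> y \<longleftrightarrow> bcov n x y \<and> x \<in> S \<and> y \<in> S"

definition LIN where "LIN = range (\<lambda>(c, k). linear_fun n c k)"

abbreviation rk where "rk u \<equiv> int (perm_length n u)"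

lemma linear_fun_LIN [simp]: "linear_fun n c k \<in> LIN"
  unfolding LIN_def by (rule range_eqI[of _ _ "(c, k)"]) simp

lemma S_permutes: "u \<in> S \<Longrightarrow> u permutes {1..n}"
proof -
  assume "u \<in> S"
  then have "(bcov n)\<^sup>*\<^sup>* v u" by (simp add: S_def)
  then show "u permutes {1..n}" by (induction rule: rtranclp_induct) (use v bcov_permutes in auto)
qed

lemma finite_S: "finite S"
  by (rule finite_subset[OF _ finite_permutations[of "{1..n}"]]) (use S_permutes in auto)

lemma S_between: "x \<in> S \<Longrightarrow> y \<in> S \<Longrightarrow> (bcov n)\<^sup>*\<^sup>* x z \<Longrightarrow> (bcov n)\<^sup>*\<^sup>* z y \<Longrightarrow> z \<in> S"
  unfolding S_def by (simp, meson rtranclp_trans)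

lemma cv_le_iff:
  assumes "x \<in> S" "y \<in> S" shows "(\<lessdot>)\<^sup>*\<^sup>* x y \<longleftrightarrow> (bcov n)\<^sup>*\<^sup>* x y"
proof
  show "(bcov n)\<^sup>*\<^sup>* x y" if "(\<lessdot>)\<^sup>*\<^sup>* x y"
    using that by (rule rtranclp_mono[THEN predicate2D, rotated]) (auto simp: cv_def)
  assume "(bcov n)\<^sup>*\<^sup>* x y"
  then show "(\<lessdot>)\<^sup>*\<^sup>* x y"
    using assms(1)
  proof (induction rule: converse_rtranclp_induct)
    case (step x z)
    have "z \<in> S" by (rule S_between[OF step.prems assms(2) r_into_rtranclp[of "bcov n"]]) (use step in auto)
    then have "x \<lessdot> z" "(\<lessdot>)\<^sup>*\<^sup>* z y" using step by (simp add: cv_def, blast)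
    then show ?case by (rule converse_rtranclp_into_rtranclp)
  qed simp
qed

lemma cv_edge: "x \<lessdot> y \<Longrightarrow> \<exists>i j. incr n x i j y"
  by (auto simp: cv_def bcov_def)

lemma cv_mid: "x \<lessdot> p \<Longrightarrow> p \<lessdot> y \<Longrightarrow> bcov n x q \<Longrightarrow> bcov n q y \<Longrightarrow> x \<lessdot> q \<and> q \<lessdot> y"
proof -
  assume a: "x \<lessdot> p" "p \<lessdot> y" "bcov n x q" "bcov n q y"
  then have "q \<in> S" by (intro S_between[of x y q]) (auto simp: cv_def)
  then show "x \<lessdot> q \<and> q \<lessdot> y" using a by (simp add: cv_def)
qed

lemma cv_thin:
  assumes p: "x \<lessdot> p" "p \<lessdot> y"
  shows "\<exists>q. q \<noteq> p \<and> x \<lessdot> q \<and> q \<lessdot> y \<and> (\<forall>m. x \<lessdot> m \<and> m \<lessdot> y \<longrightarrow> m = p \<or> m = q)"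
proof -
  obtain p' q' where s: "square n x p' q' y" using square_ex p unfolding cv_def by blast
  then have b: "bcov n x p'" "bcov n p' y" "bcov n x q'" "bcov n q' y" "p' \<noteq> q'"
    and u: "\<And>m. bcov n x m \<and> bcov n m y \<Longrightarrow> m = p' \<or> m = q'"
    unfolding square_def by blast+
  have u': "m = p' \<or> m = q'" if "x \<lessdot> m \<and> m \<lessdot> y" for m using u that unfolding cv_def by blast
  have c: "x \<lessdot> p'" "p' \<lessdot> y" "x \<lessdot> q'" "q' \<lessdot> y" using cv_mid[OF p] b by blast+
  consider "p = p'" | "p = q'" using u' p by blast
  then show ?thesis
  proof cases
    case 1 then show ?thesis using b(5) c u' by (intro exI[of _ q']) metis
  next
    case 2 then show ?thesis using b(5) c u' by (intro exI[of _ p']) metis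
  qed
qed

lemma cv_wts:
  assumes "x \<lessdot> p" "p \<lessdot> y" "x \<lessdot> q" "q \<lessdot> y" "p \<noteq> q"
  shows "0 < wb x y \<and> 0 < wt x y \<and> 0 < wm x p y \<and> wb x y + wt x y = wm x p y + wm x q y"
  using square_wts[of x p y q] assms unfolding cv_def by blast

lemma LIN_balanced:
  assumes "F \<in> LIN" "x \<lessdot> p" "p \<lessdot> y" "x \<lessdot> q" "q \<lessdot> y" "p \<noteq> q"
  shows "wb x y * F x + wt x y * F y = wm x p y * F p + wm x q y * F q"
proof -
  obtain c k where F: "F = linear_fun n c k" using assms(1) by (auto simp: LIN_def)
  have "wb x y + wt x y = wm x p y + wm x q y"
    "\<And>i. wb x y * real (x i) + wt x y * real (y i) = wm x p y * real (p i) + wm x q y * real (q i)"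
    using square_wts[of x p y q] assms unfolding cv_def by blast+
  then show ?thesis unfolding F by (rule linear_fun_balanced)
qed

text \<open>Three consecutive covers whose transpositions stay within three positions would form a chain of a
crown. Otherwise the coefficients can be adjusted along the chain.\<close>

lemma LIN_chain:
  assumes "x \<lessdot> a" "a \<lessdot> c" "c \<lessdot> d"
  shows "\<exists>F\<in>LIN. F x = r0 \<and> F a = r1 \<and> F c = r2 \<and> F d = r3"
proof -
  obtain i1 j1 where 1: "incr n x i1 j1 a" using cv_edge assms by blast
  obtain i2 j2 where 2: "incr n a i2 j2 c" using cv_edge assms by blast
  obtain i3 j3 where 3: "incr n c i3 j3 d" using cv_edge assms by blast
  have cov: "bcov n x a" "bcov n a c" "bcov n c d" and S: "x \<in> S" "d \<in> S" using assms by (auto simp: cv_def)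
  have "\<not> (a' < b' \<and> b' < c' \<and> {i1, j1, i2, j2, i3, j3} \<subseteq> {a', b', c'})" for a' b' c'
    using chain_three_crown[OF cov 1 2 3] no_crown[of x a' b' c'] S unfolding S_def by blast
  then have "\<not> (\<exists>a b c. a < b \<and> b < c \<and> {i1, j1, i2, j2, i3, j3} \<subseteq> {a, b, c})" by fast
  with chain_separated_or_three[OF 1 2 3]
  obtain B C where BC: "i1 \<in> B \<longleftrightarrow> j1 \<in> B" "i2 \<in> B \<longleftrightarrow> j2 \<notin> B"
      "i1 \<in> C \<longleftrightarrow> j1 \<in> C" "i2 \<in> C \<longleftrightarrow> j2 \<in> C" "i3 \<in> C \<longleftrightarrow> j3 \<notin> C"
    by (metis (no_types, lifting))
  have "i1 \<noteq> j1" using 1 by (simp add: incr_def)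
  define \<delta>1 where "\<delta>1 = real (x j1) - real (x i1)"
  define \<delta>2 where "\<delta>2 = real (a j2) - real (a i2)"
  define \<delta>3 where "\<delta>3 = real (c j3) - real (c i3)"
  have \<delta>: "\<delta>1 \<noteq> 0" "\<delta>2 \<noteq> 0" "\<delta>3 \<noteq> 0" using 1 2 3 by (auto simp: incr_def \<delta>1_def \<delta>2_def \<delta>3_def)
  obtain g where g: "g i1 - g j1 = (r1 - r0) / \<delta>1" "g i2 - g j2 = (r2 - r1) / \<delta>2" "g i3 - g j3 = (r3 - r2) / \<delta>3"
    using separating_potential[OF \<open>i1 \<noteq> j1\<close> BC] by metis
  define F where "F = linear_fun n g (0 + (r0 - linear_fun n g 0 x))"
  have "F x = r0" unfolding F_def linear_fun_add by simp
  moreover have "F a - F x = r1 - r0" "F c - F a = r2 - r1" "F d - F c = r3 - r2"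
    using linear_fun_incr[OF 1] linear_fun_incr[OF 2] linear_fun_incr[OF 3] g \<delta>
    unfolding F_def \<delta>1_def[symmetric] \<delta>2_def[symmetric] \<delta>3_def[symmetric] by simp_all
  moreover have "F \<in> LIN" by (simp add: F_def)
  ultimately show ?thesis by (intro bexI[of _ F]) auto
qed

lemma cv_square:
  assumes "x \<lessdot> p" "p \<lessdot> y" "x \<lessdot> q" "q \<lessdot> y" "p \<noteq> q"
  shows "square n x p q y \<or> square n x q p y"
  using square_cases[of n x p y q] assms unfolding cv_def by blast

lemma labelled_up: "labelled_poset S (\<lessdot>) rk wb wt wm LIN (lab n)"
proof
  show "finite S" by (rule finite_S)
  show "x \<in> S \<and> y \<in> S" if "x \<lessdot> y" for x y using that by (simp add: cv_def)
  show "rk y = rk x + 1" if "x \<lessdot> y" for x y using that by (simp add: cv_def bcov_def)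
  show "\<exists>q. q \<noteq> p \<and> x \<lessdot> q \<and> q \<lessdot> y \<and> (\<forall>m. x \<lessdot> m \<and> m \<lessdot> y \<longrightarrow> m = p \<or> m = q)" if "x \<lessdot> p" "p \<lessdot> y" for x p y
    using that by (rule cv_thin)
  show "0 < wb x y \<and> 0 < wt x y \<and> 0 < wm x p y \<and> wb x y + wt x y = wm x p y + wm x q y"
    if "x \<lessdot> p" "p \<lessdot> y" "x \<lessdot> q" "q \<lessdot> y" "p \<noteq> q" for x p y q using that by (rule cv_wts)
  show "wb x y * F x + wt x y * F y = wm x p y * F p + wm x q y * F q"
    if "F \<in> LIN" "x \<lessdot> p" "p \<lessdot> y" "x \<lessdot> q" "q \<lessdot> y" "p \<noteq> q" for F x p y q using that by (rule LIN_balanced)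
  show "\<exists>F\<in>LIN. F x = r0 \<and> F a = r1 \<and> F c = r2 \<and> F d = r3" if "x \<lessdot> a" "a \<lessdot> c" "c \<lessdot> d" for x a c d r0 r1 r2 r3
    using that by (rule LIN_chain)
  show "a = b" if ab: "x \<lessdot> a" "x \<lessdot> b" "lab n x a = lab n x b" for x a b
  proof -
    obtain i j where i: "incr n x i j a" using cv_edge ab by blast
    obtain k l where k: "incr n x k l b" using cv_edge ab by blast
    have "i = k \<and> j = l" using ab(3) pair_code_inj[of j n l i k] i k
      unfolding lab_incr[OF i] lab_incr[OF k] by (simp add: incr_def)
    then show ?thesis using i k by (simp add: incr_def)
  qed
  show "lab n x q < lab n x p \<longleftrightarrow> lab n p y < lab n x p"
    if "x \<lessdot> p" "p \<lessdot> y" "x \<lessdot> q" "q \<lessdot> y" "p \<noteq> q" for x p y q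
    using cv_square[OF that] unfolding square_def by auto
  show "a = b" if "increasing_chain (\<lessdot>) (lab n) x a u" "increasing_chain (\<lessdot>) (lab n) x b u" for x a b u
    by (rule increasing_chain_unique[OF _ _ that, where \<epsilon> = 1]) (use bcov_exchange in \<open>auto simp: cv_def\<close>)
qed

lemma labelled_down:
  "labelled_poset S (\<lambda>x y. y \<lessdot> x) (\<lambda>u. - rk u) (\<lambda>x y. wt y x) (\<lambda>x y. wb y x) (\<lambda>x p y. wm y p x) LIN (lab n)"
proof
  show "finite S" by (rule finite_S)
  show "x \<in> S \<and> y \<in> S" if "y \<lessdot> x" for x y using that by (simp add: cv_def)
  show "- rk y = - rk x + 1" if "y \<lessdot> x" for x y using that by (simp add: cv_def bcov_def)
  show "\<exists>q. q \<noteq> p \<and> q \<lessdot> x \<and> y \<lessdot> q \<and> (\<forall>m. m \<lessdot> x \<and> y \<lessdot> m \<longrightarrow> m = p \<or> m = q)" if "p \<lessdot> x" "y \<lessdot> p" for x p y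
    using cv_thin[OF that(2,1)] by blast
  show "0 < wt y x \<and> 0 < wb y x \<and> 0 < wm y p x \<and> wt y x + wb y x = wm y p x + wm y q x"
    if "p \<lessdot> x" "y \<lessdot> p" "q \<lessdot> x" "y \<lessdot> q" "p \<noteq> q" for x p y q using cv_wts[OF that(2,1,4,3,5)] by auto
  show "wt y x * F x + wb y x * F y = wm y p x * F p + wm y q x * F q"
    if "F \<in> LIN" "p \<lessdot> x" "y \<lessdot> p" "q \<lessdot> x" "y \<lessdot> q" "p \<noteq> q" for F x p y q
    using LIN_balanced[OF that(1,3,2,5,4,6)] by simp
  show "\<exists>F\<in>LIN. F x = r0 \<and> F a = r1 \<and> F c = r2 \<and> F d = r3" if "a \<lessdot> x" "c \<lessdot> a" "d \<lessdot> c" for x a c d r0 r1 r2 r3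
    using LIN_chain[OF that(3,2,1), of r3 r2 r1 r0] by blast
  show "a = b" if ab: "a \<lessdot> x" "b \<lessdot> x" "lab n x a = lab n x b" for x a b
  proof -
    obtain i j where i: "incr n a i j x" using cv_edge ab by blast
    obtain k l where k: "incr n b k l x" using cv_edge ab by blast
    have "i = k \<and> j = l" using ab(3) pair_code_inj[of j n l i k] i k
      unfolding lab_sym[of n x] lab_incr[OF i] lab_incr[OF k] by (simp add: incr_def)
    moreover have "a = x \<circ> tr i j" "b = x \<circ> tr k l" using incr_back i k by blast+
    ultimately show ?thesis by simp
  qed
  show "lab n x q < lab n x p \<longleftrightarrow> lab n p y < lab n x p"
    if "p \<lessdot> x" "y \<lessdot> p" "q \<lessdot> x" "y \<lessdot> q" "p \<noteq> q" for x p y q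
    using cv_square[OF that(2,1,4,3,5)] unfolding square_def lab_sym[of n x] lab_sym[of n _ y] by auto
  show "a = b" if "increasing_chain (\<lambda>x y. y \<lessdot> x) (lab n) x a u" "increasing_chain (\<lambda>x y. y \<lessdot> x) (lab n) x b u" for x a b u
    by (rule increasing_chain_unique[OF _ _ that, where \<epsilon> = "-1"]) (use bcov_exchange_down in \<open>auto simp: cv_def\<close>)
qed

sublocale L: labelled_poset S "(\<lessdot>)" rk wb wt wm LIN "lab n"
  by (rule labelled_up)

text \<open>Fix a maximal chain from \<open>x\<close> to \<open>y\<close>. If a set \<open>B\<close> of positions is respected by its three
transpositions, then the sum of the values on \<open>B\<close> is constant along the chain and hence, being
harmonic, on the whole interval. So the transposition of every atom respects \<open>B\<close>. Moreover three
atoms cannot form a triangle \<open>(i, j), (j, k), (i, k)\<close>, as \<open>j\<close> would obstruct the cover by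
\<open>(i, k)\<close>.\<close>

lemma few_atoms:
  assumes le: "(\<lessdot>)\<^sup>*\<^sup>* x y" and rk: "rk y = rk x + 3"
  shows "card {a. x \<lessdot> a \<and> (\<lessdot>)\<^sup>*\<^sup>* a y} \<le> 4"
proof -
  obtain a where a: "x \<lessdot> a" "(\<lessdot>)\<^sup>*\<^sup>* a y" using L.le_first[OF le] rk by force
  obtain c where c: "a \<lessdot> c" "(\<lessdot>)\<^sup>*\<^sup>* c y" using L.le_first[OF a(2)] rk L.cov_rk[OF a(1)] by force
  have cy: "c \<lessdot> y" using L.cov_of_rk[OF c(2)] L.cov_rk[OF c(1)] L.cov_rk[OF a(1)] rk by simp
  obtain i1 j1 where 1: "incr n x i1 j1 a" using cv_edge a by blast
  obtain i2 j2 where 2: "incr n a i2 j2 c" using cv_edge c by blast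
  obtain i3 j3 where 3: "incr n c i3 j3 y" using cv_edge cy by blast
  define K where "K = {(k, l). \<exists>u. x \<lessdot> u \<and> (\<lessdot>)\<^sup>*\<^sup>* u y \<and> incr n x k l u}"
  have x: "x permutes {1..n}" using S_permutes L.cov_S[OF a(1)] by blast
  have "card K \<le> 4"
  proof (rule few_pairs)
    show "i1 < j1" "i2 < j2" "i3 < j3" using 1 2 3 by (auto simp: incr_def)
    show "\<forall>k l. (k, l) \<in> K \<longrightarrow> k < l" by (auto simp: K_def incr_def)
    show "\<forall>B k l. (i1 \<in> B \<longleftrightarrow> j1 \<in> B) \<and> (i2 \<in> B \<longleftrightarrow> j2 \<in> B) \<and> (i3 \<in> B \<longleftrightarrow> j3 \<in> B) \<and> (k, l) \<in> K \<longrightarrow> (k \<in> B \<longleftrightarrow> l \<in> B)"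
    proof (intro allI impI)
      fix B k l assume B: "(i1 \<in> B \<longleftrightarrow> j1 \<in> B) \<and> (i2 \<in> B \<longleftrightarrow> j2 \<in> B) \<and> (i3 \<in> B \<longleftrightarrow> j3 \<in> B) \<and> (k, l) \<in> K"
      then obtain u where u: "x \<lessdot> u" "(\<lessdot>)\<^sup>*\<^sup>* u y" "incr n x k l u" by (auto simp: K_def)
      define F where "F = linear_fun n (\<lambda>m. of_bool (m \<in> B)) 0"
      have diff: "F z' - F z = (of_bool (i \<in> B) - of_bool (j \<in> B)) * (real (z j) - real (z i))"
        if "incr n z i j z'" for z z' i j unfolding F_def by (rule linear_fun_incr[OF that])
      have "F a - F x = 0" "F c - F a = 0" "F y - F c = 0"
        unfolding diff[OF 1] diff[OF 2] diff[OF 3] using B by auto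
      then have e: "F a = F x" "F c = F x" "F y = F x" by auto
      have "L.harm F x y" unfolding F_def by (rule L.lin_harm) simp
      then have "F u = F x"
        using L.harm_eq_rank3[OF a(1) c(1) cy _ L.harm_const[of "F x"] refl e L.cov_le[OF u(1)] u(2)] by blast
      then have "(of_bool (k \<in> B) - of_bool (l \<in> B)) * (real (x l) - real (x k)) = 0"
        using diff[OF u(3)] by simp
      moreover have "real (x l) - real (x k) \<noteq> 0" using u(3) by (auto simp: incr_def)
      ultimately show "k \<in> B \<longleftrightarrow> l \<in> B" by (auto split: if_splits)
    qed
    show False if lt: "i < j" "j < k" and K: "(i, j) \<in> K" "(j, k) \<in> K" "(i, k) \<in> K" for i j k
    proof -
      obtain u where u: "x \<lessdot> u" "incr n x i k u" using K(3) by (auto simp: K_def)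
      have "bcov n x u" using u by (simp add: cv_def)
      then have "\<not> (x i < x j \<and> x j < x k)" using incr_cov_iff[OF x u(2)] lt by blast
      then show False using K(1,2) by (auto simp: K_def incr_def)
    qed
  qed
  moreover have "finite K" by (rule finite_subset[of _ "{1..n} \<times> {1..n}"]) (auto simp: K_def incr_def)
  moreover have "{a. x \<lessdot> a \<and> (\<lessdot>)\<^sup>*\<^sup>* a y} \<subseteq> (\<lambda>(k, l). x \<circ> tr k l) ` K"
  proof
    fix u assume "u \<in> {a. x \<lessdot> a \<and> (\<lessdot>)\<^sup>*\<^sup>* a y}"
    then have u: "x \<lessdot> u" "(\<lessdot>)\<^sup>*\<^sup>* u y" by auto
    then obtain k l where kl: "incr n x k l u" using cv_edge by blast
    then have "(k, l) \<in> K" using u by (auto simp: K_def)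
    then show "u \<in> (\<lambda>(k, l). x \<circ> tr k l) ` K" using kl by (intro image_eqI[of _ _ "(k, l)"]) (auto simp: incr_def)
  qed
  ultimately show ?thesis by (meson card_image_le card_mono finite_imageI le_trans)
qed

abbreviation height where "height \<equiv> linear_fun n (\<lambda>i. - real i) 0"

lemma height_incr: "incr n x i j y \<Longrightarrow> height y - height x = (real j - real i) * (real (x j) - real (x i))"
  using linear_fun_incr[of n x i j y "\<lambda>i. - real i" 0] by simp

lemma height_less: "x \<lessdot> y \<Longrightarrow> height x < height y"
proof -
  assume "x \<lessdot> y"
  then obtain i j where ij: "incr n x i j y" using cv_edge by blast
  then have "0 < (real j - real i) * (real (x j) - real (x i))" by (auto simp: incr_def)
  then show "height x < height y" using height_incr[OF ij] by simp
qed

text \<open>The height is the linear function with the decreasing coefficients \<open>- i\<close>, so that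
exchanging the positions \<open>i < j\<close> raises it by \<open>(j - i) (x j - x i)\<close>; the function \<open>G\<close> has generic
coefficients. The dual bound on the number of atoms follows from \<open>card_coatoms\<close>.\<close>

theorem biconvex:
  obtains G where "biconvex_poset S (\<lessdot>) rk wb wt wm LIN (lab n) (lab n) height G"
proof -
  obtain c where inj: "inj_on (linear_fun n c 0) S" and
    ratio: "\<And>i j k l. 1 \<le> i \<Longrightarrow> i < j \<Longrightarrow> j \<le> n \<Longrightarrow> 1 \<le> k \<Longrightarrow> k < l \<Longrightarrow> l \<le> n \<Longrightarrow> (i, j) \<noteq> (k, l) \<Longrightarrow>
      (c i - c j) * (real l - real k) \<noteq> (c k - c l) * (real j - real i)"
    using generic_ratio[OF finite_S S_permutes] by metis
  let ?G = "linear_fun n c 0"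
  have cross: "(c i - c j) * s * ((real l - real k) * t) \<noteq> (c k - c l) * t * ((real j - real i) * s)"
    if "incr n x i j a" "incr n y k l b" "(i, j) \<noteq> (k, l)" "s \<noteq> 0" "t \<noteq> 0" for x a y b i j k l and s t :: real
  proof -
    have "(c i - c j) * (real l - real k) \<noteq> (c k - c l) * (real j - real i)"
      using ratio that(1-3) by (simp add: incr_def)
    then have "(s * t) * ((c i - c j) * (real l - real k)) \<noteq> (s * t) * ((c k - c l) * (real j - real i))"
      using that(4,5) by simp
    then show ?thesis by (simp add: algebra_simps)
  qed
  have up: "convex_poset S (\<lessdot>) rk wb wt wm LIN (lab n) height ?G"
  proof (intro convex_poset.intro[OF labelled_up] convex_poset_axioms.intro)
    show "height \<in> LIN" "?G \<in> LIN" by simp_all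
    show "height x < height y" if "x \<lessdot> y" for x y using height_less that .
    show "inj_on ?G S" by (rule inj)
    show "(?G a - ?G x) * (height b - height x) \<noteq> (?G b - ?G x) * (height a - height x)"
      if ab: "x \<lessdot> a" "x \<lessdot> b" "a \<noteq> b" for x a b
    proof -
      obtain i j where i: "incr n x i j a" using cv_edge ab by blast
      obtain k l where k: "incr n x k l b" using cv_edge ab by blast
      have ne: "(i, j) \<noteq> (k, l)" using i k ab(3) by (auto simp: incr_def)
      have "real (x j) - real (x i) \<noteq> 0" "real (x l) - real (x k) \<noteq> 0" using i k by (auto simp: incr_def)
      from cross[OF i k ne this] show ?thesis
        unfolding linear_fun_incr[OF i, of c] linear_fun_incr[OF k, of c] height_incr[OF i] height_incr[OF k] .
    qed
    show "card {a. v \<lessdot> a \<and> (\<lessdot>)\<^sup>*\<^sup>* a w} \<le> 4" if "(\<lessdot>)\<^sup>*\<^sup>* v w" "rk w = rk v + 3" for v w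
      using that by (rule few_atoms)
  qed
  interpret U: convex_poset S "(\<lessdot>)" rk wb wt wm LIN "lab n" height ?G by (rule up)
  have down: "convex_poset S (\<lambda>x y. y \<lessdot> x) (\<lambda>u. - rk u) (\<lambda>x y. wt y x) (\<lambda>x y. wb y x) (\<lambda>x p y. wm y p x) LIN (lab n) (\<lambda>u. - height u) ?G"
  proof (intro convex_poset.intro[OF labelled_down] convex_poset_axioms.intro)
    have "(\<lambda>u. - height u) = linear_fun n (\<lambda>i. real i) 0"
      by (simp add: linear_fun_def fun_eq_iff sum_negf)
    then show "(\<lambda>u. - height u) \<in> LIN" by simp
    show "?G \<in> LIN" by simp
    show "- height x < - height y" if "y \<lessdot> x" for x y using height_less[OF that] by simp
    show "inj_on ?G S" by (rule inj)
    show "(?G a - ?G x) * (- height b - - height x) \<noteq> (?G b - ?G x) * (- height a - - height x)"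
      if ab: "a \<lessdot> x" "b \<lessdot> x" "a \<noteq> b" for x a b
    proof -
      obtain i j where i: "incr n a i j x" using cv_edge ab by blast
      obtain k l where k: "incr n b k l x" using cv_edge ab by blast
      have "a = x \<circ> tr i j" "b = x \<circ> tr k l" using incr_back i k by blast+
      then have ne: "(i, j) \<noteq> (k, l)" using ab(3) by auto
      have "real (a j) - real (a i) \<noteq> 0" "real (b l) - real (b k) \<noteq> 0" using i k by (auto simp: incr_def)
      from cross[OF i k ne this]
      have "(?G x - ?G a) * (height x - height b) \<noteq> (?G x - ?G b) * (height x - height a)"
        unfolding linear_fun_incr[OF i, of c] linear_fun_incr[OF k, of c] height_incr[OF i] height_incr[OF k] .
      then show ?thesis by (simp add: algebra_simps)
    qed
    show "card {a. a \<lessdot> v \<and> (\<lambda>x y. y \<lessdot> x)\<^sup>*\<^sup>* a w} \<le> 4"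
      if "(\<lambda>x y. y \<lessdot> x)\<^sup>*\<^sup>* v w" "- rk w = - rk v + 3" for v w
    proof -
      note swap = rtranclp_swap[of "(\<lessdot>)"]
      have le: "(\<lessdot>)\<^sup>*\<^sup>* w v" using that(1) unfolding swap .
      have rk: "rk v = rk w + 3" using that(2) by linarith
      show ?thesis unfolding swap U.card_coatoms[OF rk] by (rule few_atoms[OF le rk])
    qed
  qed
  show ?thesis by (rule that, rule biconvex_poset.intro[OF up down])
qed

end

section \<open>Bruhat intervals as posets\<close>

abbreviation ble where "ble n \<equiv> (bcov n)\<^sup>*\<^sup>*"

lemma ble_permutes: "ble n x y \<Longrightarrow> x permutes {1..n} \<Longrightarrow> y permutes {1..n}"
  by (induction rule: rtranclp_induct) (auto dest: bcov_permutes)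

lemma ble_length: "ble n x y \<Longrightarrow> perm_length n x \<le> perm_length n y \<and> (perm_length n x = perm_length n y \<longrightarrow> x = y)"
  by (induction rule: rtranclp_induct) (auto simp: bcov_def)

lemma ble_antisym: "ble n x y \<Longrightarrow> ble n y x \<Longrightarrow> x = y"
  using ble_length[of n x y] ble_length[of n y x] by auto

lemma bruhat_interval_set:
  assumes "v permutes {1..n}"
  shows "\<lbrace>v..w\<rbrace>\<^bsub>bruhat n\<^esub> = {u. ble n v u \<and> ble n u w}"
  unfolding at_least_at_most_def bruhat_def using assms ble_permutes bruhat_le_iff by auto

lemma bruhat_interval_carrier:
  "v permutes {1..n} \<Longrightarrow> carrier (bruhat_interval n v w) = {u. ble n v u \<and> ble n u w}"
  unfolding bruhat_interval_def using bruhat_interval_set by simp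

lemma bruhat_interval_le: "x permutes {1..n} \<Longrightarrow> x \<sqsubseteq>\<^bsub>bruhat_interval n v w\<^esub> y \<longleftrightarrow> ble n x y"
  unfolding bruhat_interval_def bruhat_def using bruhat_le_iff by simp

lemma bruhat_partial_order:
  assumes C: "\<And>x. x \<in> C \<Longrightarrow> x permutes {1..n}"
  shows "partial_order ((bruhat n)\<lparr>carrier := C\<rparr>)"
proof
  fix x y assume "x \<sqsubseteq>\<^bsub>(bruhat n)\<lparr>carrier := C\<rparr>\<^esub> y" "y \<sqsubseteq>\<^bsub>(bruhat n)\<lparr>carrier := C\<rparr>\<^esub> x"
    "x \<in> carrier ((bruhat n)\<lparr>carrier := C\<rparr>)" "y \<in> carrier ((bruhat n)\<lparr>carrier := C\<rparr>)"
  then have "ble n x y" "ble n y x" using bruhat_le_iff C by (auto simp: bruhat_def)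
  then show "x .=\<^bsub>(bruhat n)\<lparr>carrier := C\<rparr>\<^esub> y" using ble_antisym by (simp add: bruhat_def)
qed (auto simp: bruhat_def)

lemma bruhat_interval_partial_order: "v permutes {1..n} \<Longrightarrow> partial_order (bruhat_interval n v w)"
  unfolding bruhat_interval_def using bruhat_interval_set[of v n w] ble_permutes
  by (intro bruhat_partial_order) auto

lemma bruhat_weak_partial_order: "weak_partial_order (bruhat n)"
proof -
  have "(bruhat n)\<lparr>carrier := {p. p permutes {1..n}}\<rparr> = bruhat n" by (simp add: bruhat_def)
  then show ?thesis using bruhat_partial_order[of "{p. p permutes {1..n}}" n] partial_order.axioms(1) by fastforce
qed

section \<open>Crowns and lattices\<close>

interpretation S3: crown 3 id 1 2 3
proof
  have i: "incr 3 id 1 3 (id \<circ> tr 1 3)" by (simp add: incr_def)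
  have "{m. 1 < m \<and> m < 3 \<and> id (1 :: nat) < id m \<and> id m < id 3} = {2 :: nat}" by auto
  then show "perm_length 3 (id \<circ> tr 1 3) = perm_length 3 id + 3"
    using incr_length[OF permutes_id i] by simp
qed (auto simp: permutes_id)

lemma S3_elements: "{p. p permutes {1..3 :: nat}} = set (crown_list id 1 2 3)"
proof (rule card_subset_eq[symmetric])
  show "finite {p. p permutes {1..3 :: nat}}" by (simp add: finite_permutations)
  show "set (crown_list id 1 2 3) \<subseteq> {p. p permutes {1..3}}"
    using S3.perms S3.x by (auto simp: crown_list_def)
  have "card (set (crown_list id 1 2 3)) = length (crown_list id 1 2 3)"
    using S3.crown_distinct by (rule distinct_card)
  also have "\<dots> = 6" by (simp add: crown_list_def)
  also have "\<dots> = card {p. p permutes {1..3 :: nat}}"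
    using card_permutations[of "{1..3 :: nat}" 3] by (simp add: fact_numeral)
  finally show "card (set (crown_list id 1 2 3)) = card {p. p permutes {1..3 :: nat}}" .
qed

lemma crown_iso_S3:
  assumes c: "crown n x a b c"
  shows "poset_iso (bruhat_interval n x (x \<circ> tr a c)) (bruhat 3)"
proof -
  interpret crown n x a b c by (rule c)
  have perm: "u permutes {1..n}" if "u \<in> set (crown_list x a b c)" for u
    using that x perms by (auto simp: crown_list_def)
  show ?thesis
  proof (rule poset_iso_of_ranks)
    show "weak_partial_order (bruhat_interval n x y)"
      using bruhat_interval_partial_order[OF x] by (rule partial_order.axioms(1))
    show "carrier (bruhat_interval n x y) = set (crown_list x a b c)"
      unfolding bruhat_interval_carrier[OF x] using interval_elements elements_between by blast
    show "distinct (crown_list x a b c)" by (rule crown_distinct)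
    show "weak_partial_order (bruhat 3)" by (rule bruhat_weak_partial_order)
    show "carrier (bruhat 3) = set (crown_list id 1 2 3)" using S3_elements by (simp add: bruhat_def)
    show "distinct (crown_list id 1 2 3)" by (rule S3.crown_distinct)
    show "length (crown_list x a b c) = length (crown_list id 1 2 3)" by (simp add: crown_list_def)
    show "u \<sqsubseteq>\<^bsub>bruhat_interval n x y\<^esub> w \<longleftrightarrow> u = w \<or> perm_length n u < perm_length n w"
      if "u \<in> set (crown_list x a b c)" "w \<in> set (crown_list x a b c)" for u w
      using bruhat_interval_le[OF perm[OF that(1)]] le_iff[OF that] by simp
    show "u \<sqsubseteq>\<^bsub>bruhat 3\<^esub> w \<longleftrightarrow> u = w \<or> perm_length 3 u < perm_length 3 w"
      if "u \<in> set (crown_list id 1 2 3)" "w \<in> set (crown_list id 1 2 3)" for u w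
    proof -
      have "u permutes {1..3}" using that(1) S3_elements by blast
      then show ?thesis using bruhat_le_iff[of u 3 w] S3.le_iff[OF that] by (simp add: bruhat_def)
    qed
    show "map (perm_length n) (crown_list x a b c) = map ((+) (perm_length n x)) [0, 1, 1, 2, 2, 3]" by (rule crown_lengths)
    show "map (perm_length 3) (crown_list id 1 2 3) = map ((+) (perm_length 3 id)) [0, 1, 1, 2, 2, 3]" by (rule S3.crown_lengths)
  qed
qed

text \<open>The two atoms are distinct and so are the two coatoms, hence the length of \<open>s\<close> would be strictly
between one and two.\<close>

lemma S3_no_midpoint:
  assumes "ble 3 S3.p1 s" "ble 3 S3.p2 s" "ble 3 s S3.q1" "ble 3 s S3.q2"
  shows False
proof -
  have ne: "S3.p1 \<noteq> S3.p2" "S3.q1 \<noteq> S3.q2" using S3.crown_distinct by (auto simp: crown_list_def)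
  have l: "perm_length 3 S3.p1 \<le> perm_length 3 s" "perm_length 3 s \<le> perm_length 3 S3.q1"
    using ble_length assms(1,3) by blast+
  have "perm_length 3 s \<noteq> perm_length 3 S3.p1"
    using ble_length[OF assms(1)] ble_length[OF assms(2)] ne S3.lengths by auto
  moreover have "perm_length 3 s \<noteq> perm_length 3 S3.q1"
    using ble_length[OF assms(3)] ble_length[OF assms(4)] ne S3.lengths by auto
  ultimately show False using l S3.lengths by linarith
qed

text \<open>The join of the atoms of a crown, formed in the large interval, lies below its coatoms and therefore
in the crown.\<close>

lemma lattice_no_crown:
  assumes v: "v permutes {1..n}" and L: "lattice (bruhat_interval n v w)"
  shows "\<not> has_two_crown n v w"
proof
  assume "has_two_crown n v w"
  then obtain x y where xy: "x \<in> \<lbrace>v..w\<rbrace>\<^bsub>bruhat n\<^esub>" "y \<in> \<lbrace>v..w\<rbrace>\<^bsub>bruhat n\<^esub>" and iso: "poset_iso (bruhat_interval n x y) (bruhat 3)"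
    unfolding has_two_crown_def by blast
  have vx: "ble n v x" and yw: "ble n y w" using xy unfolding bruhat_interval_set[OF v] by auto
  have x: "x permutes {1..n}" using ble_permutes[OF vx v] .
  let ?I = "{u. ble n x u \<and> ble n u y}"
  obtain f where f: "order_emb (bruhat_interval n x y) (bruhat 3) f" "bij_betw f ?I {p. p permutes {1..3}}"
    using iso unfolding poset_iso_def bruhat_interval_carrier[OF x] by (auto simp: bruhat_def)
  have Ip: "u permutes {1..n}" if "u \<in> ?I" for u using that ble_permutes x by blast
  have fp: "f u permutes {1..3}" if "u \<in> ?I" for u using f(2) that by (auto simp: bij_betw_def)
  have emb: "ble 3 (f u) (f u') \<longleftrightarrow> ble n u u'" if u: "u \<in> ?I" "u' \<in> ?I" for u u'
  proof -
    have "f u \<sqsubseteq>\<^bsub>bruhat 3\<^esub> f u' \<longleftrightarrow> u \<sqsubseteq>\<^bsub>bruhat_interval n x y\<^esub> u'"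
      using f(1) u unfolding order_emb_def bruhat_interval_carrier[OF x] by blast
    then show ?thesis using bruhat_interval_le[OF Ip[OF u(1)]] bruhat_le_iff[OF fp[OF u(1)]] by (simp add: bruhat_def)
  qed
  have surj: "\<exists>u\<in>?I. f u = p" if "p permutes {1..3}" for p
  proof -
    have "p \<in> f ` ?I" using f(2) that unfolding bij_betw_def by simp
    then show ?thesis by (rule imageE) blast
  qed
  obtain P1 where P1: "P1 \<in> ?I" "f P1 = S3.p1" using surj[OF S3.perms(1)] by blast
  obtain P2 where P2: "P2 \<in> ?I" "f P2 = S3.p2" using surj[OF S3.perms(2)] by blast
  obtain Q1 where Q1: "Q1 \<in> ?I" "f Q1 = S3.q1" using surj[OF S3.perms(3)] by blast
  obtain Q2 where Q2: "Q2 \<in> ?I" "f Q2 = S3.q2" using surj[OF S3.perms(4)] by blast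
  have PQ: "ble n P1 Q1" "ble n P1 Q2" "ble n P2 Q1" "ble n P2 Q2"
    using emb[OF P1(1) Q1(1)] emb[OF P1(1) Q2(1)] emb[OF P2(1) Q1(1)] emb[OF P2(1) Q2(1)] S3.covers
    unfolding P1(2) P2(2) Q1(2) Q2(2) by blast+
  let ?L = "bruhat_interval n v w"
  have C: "carrier ?L = {u. ble n v u \<and> ble n u w}" by (rule bruhat_interval_carrier[OF v])
  have mem: "u \<in> carrier ?L" if "u \<in> ?I" for u
  proof -
    have "ble n x u" "ble n u y" using that by auto
    then show ?thesis unfolding C using rtranclp_trans[OF vx] rtranclp_trans[OF _ yw] by simp
  qed
  obtain s where s: "least ?L s (Upper ?L {P1, P2})"
    using upper_semilattice.sup_of_two_exists[OF lattice.axioms(1)[OF L] mem[OF P1(1)] mem[OF P2(1)]] ..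
  have le: "u \<sqsubseteq>\<^bsub>?L\<^esub> u' \<longleftrightarrow> ble n u u'" if "u \<in> carrier ?L" for u u'
  proof -
    have "ble n v u" using that unfolding C by simp
    then show ?thesis using bruhat_interval_le ble_permutes v by blast
  qed
  have sC: "s \<in> carrier ?L" and s1: "ble n P1 s" "ble n P2 s"
    using s le[OF mem[OF P1(1)]] le[OF mem[OF P2(1)]] mem P1 P2 unfolding least_def Upper_def by auto
  have up: "ble n s q" if q: "q \<in> ?I" "ble n P1 q" "ble n P2 q" for q
  proof -
    have "q \<in> Upper ?L {P1, P2}"
      unfolding Upper_def using mem[OF q(1)] le[OF mem[OF P1(1)]] le[OF mem[OF P2(1)]] q by auto
    then show ?thesis using s le[OF sC] unfolding least_def by blast
  qed
  have s2: "ble n s Q1" "ble n s Q2" using up Q1(1) Q2(1) PQ by blast+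
  have "ble n x P1" "ble n Q1 y" using P1(1) Q1(1) by auto
  then have sI: "s \<in> ?I" using rtranclp_trans[OF _ s1(1)] rtranclp_trans[OF s2(1)] by simp
  show False
  proof (rule S3_no_midpoint)
    show "ble 3 S3.p1 (f s)" using emb[OF P1(1) sI] s1(1) unfolding P1(2) by simp
    show "ble 3 S3.p2 (f s)" using emb[OF P2(1) sI] s1(2) unfolding P2(2) by simp
    show "ble 3 (f s) S3.q1" using emb[OF sI Q1(1)] s2(1) unfolding Q1(2) by simp
    show "ble 3 (f s) S3.q2" using emb[OF sI Q2(1)] s2(2) unfolding Q2(2) by simp
  qed
qed

section \<open>Face lattices of polytopes and lattices\<close>

text \<open>The intersection of two faces is a face.\<close>

lemma face_lattice_meet:
  assumes iso: "poset_iso (inclusion_poset \<A>) (face_lattice P)" and X: "X \<in> \<A>" and Y: "Y \<in> \<A>"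
  shows "\<exists>Z\<in>\<A>. \<forall>W\<in>\<A>. W \<subseteq> Z \<longleftrightarrow> W \<subseteq> X \<and> W \<subseteq> Y"
proof -
  obtain f where f: "order_emb (inclusion_poset \<A>) (face_lattice P) f" "bij_betw f \<A> {F. F face_of P}"
    using iso unfolding poset_iso_def face_lattice_def by (auto simp: inclusion_poset_def)
  have emb: "f A \<subseteq> f B \<longleftrightarrow> A \<subseteq> B" if "A \<in> \<A>" "B \<in> \<A>" for A B
    using f(1) that unfolding order_emb_def face_lattice_def by (simp add: inclusion_poset_def)
  have "f X face_of P" "f Y face_of P" using f(2) X Y by (auto simp: bij_betw_def)
  then have "f X \<inter> f Y face_of P" by (rule face_of_Int)
  then obtain Z where Z: "Z \<in> \<A>" "f Z = f X \<inter> f Y" using f(2) unfolding bij_betw_def by (metis imageE mem_Collect_eq)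
  have "W \<subseteq> Z \<longleftrightarrow> W \<subseteq> X \<and> W \<subseteq> Y" if "W \<in> \<A>" for W
    using emb[OF that Z(1)] emb[OF that X] emb[OF that Y] Z(2) by simp
  then show ?thesis by (intro bexI[OF _ Z(1)] ballI)
qed

text \<open>The meet \<open>Z\<close> of \<open>[a, w]\<close> and \<open>[b, w]\<close> contains exactly the upper bounds of \<open>a\<close> and \<open>b\<close>, because a
singleton is an interval. Being an interval, it has a least element. The meet of \<open>[v, a]\<close> and
\<open>[v, b]\<close> is treated in the same way.\<close>

lemma polytopal_lattice:
  assumes v: "v permutes {1..n}" and P: "is_polytope_face_lattice (Int_poset n v w)"
  shows "lattice (bruhat_interval n v w)"
proof -
  let ?L = "bruhat_interval n v w"
  let ?seg = "\<lambda>x y. {u. ble n x u \<and> ble n u y}"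
  define \<A> where "\<A> = insert {} {\<lbrace>x..y\<rbrace>\<^bsub>bruhat n\<^esub> | x y.
        x \<in> \<lbrace>v..w\<rbrace>\<^bsub>bruhat n\<^esub> \<and> y \<in> \<lbrace>v..w\<rbrace>\<^bsub>bruhat n\<^esub> \<and> x \<sqsubseteq>\<^bsub>bruhat n\<^esub> y}"
  have C: "carrier ?L = ?seg v w" by (rule bruhat_interval_carrier[OF v])
  have perm: "x permutes {1..n}" if "x \<in> ?seg v w" for x using that ble_permutes v by blast
  have le: "x \<sqsubseteq>\<^bsub>?L\<^esub> y \<longleftrightarrow> ble n x y" if "x \<in> ?seg v w" for x y
    using bruhat_interval_le[OF perm[OF that]] .
  have le': "x \<sqsubseteq>\<^bsub>bruhat n\<^esub> y \<longleftrightarrow> ble n x y" if "x \<in> ?seg v w" for x y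
    using bruhat_le_iff[OF perm[OF that]] by (simp add: bruhat_def)
  have seg_mem: "?seg x y \<in> \<A>" if "x \<in> ?seg v w" "y \<in> ?seg v w" "ble n x y" for x y
  proof -
    have "\<lbrace>x..y\<rbrace>\<^bsub>bruhat n\<^esub> \<in> \<A>"
      unfolding \<A>_def bruhat_interval_set[OF v] using that le'[OF that(1)] by blast
    then show ?thesis unfolding bruhat_interval_set[OF perm[OF that(1)]] .
  qed
  have seg_ex: "\<exists>x y. x \<in> ?seg v w \<and> y \<in> ?seg v w \<and> Z = ?seg x y" if Z: "Z \<in> \<A>" "Z \<noteq> {}" for Z
  proof -
    obtain x y where xy: "x \<in> ?seg v w" "y \<in> ?seg v w" "Z = \<lbrace>x..y\<rbrace>\<^bsub>bruhat n\<^esub>"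
      using Z unfolding \<A>_def bruhat_interval_set[OF v] by blast
    then show ?thesis using bruhat_interval_set[OF perm[OF xy(1)]] by blast
  qed
  have single: "{u} \<in> \<A>" if u: "u \<in> ?seg v w" for u
  proof -
    have "?seg u u = {u}" using ble_antisym by blast
    then show ?thesis using seg_mem[OF u u] by simp
  qed
  have meet: "\<exists>Z\<in>\<A>. \<forall>W\<in>\<A>. W \<subseteq> Z \<longleftrightarrow> W \<subseteq> X \<and> W \<subseteq> Y" if XY: "X \<in> \<A>" "Y \<in> \<A>" for X Y
  proof -
    obtain P :: "(nat \<Rightarrow>\<^sub>0 real) set" where "poset_iso (inclusion_poset \<A>) (face_lattice P)"
      using P unfolding is_polytope_face_lattice_def Int_poset_def \<A>_def by blast
    then show ?thesis using face_lattice_meet XY by blast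
  qed
  interpret partial_order ?L by (rule bruhat_interval_partial_order[OF v])
  show ?thesis
  proof unfold_locales
    fix a b assume "a \<in> carrier ?L" "b \<in> carrier ?L"
    then have ab: "a \<in> ?seg v w" "b \<in> ?seg v w" unfolding C by auto
    have w: "w \<in> ?seg v w" and v': "v \<in> ?seg v w" using ab(1) by (auto intro: rtranclp_trans)
    obtain Z where Z: "Z \<in> \<A>" "\<And>W. W \<in> \<A> \<Longrightarrow> W \<subseteq> Z \<longleftrightarrow> W \<subseteq> ?seg a w \<and> W \<subseteq> ?seg b w"
      using meet[OF seg_mem[OF ab(1) w] seg_mem[OF ab(2) w]] ab by auto
    have mem: "u \<in> Z \<longleftrightarrow> ble n a u \<and> ble n b u" if u: "u \<in> ?seg v w" for u
      using Z(2)[OF single[OF u]] u by auto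
    have "w \<in> Z" using mem[OF w] ab by auto
    then obtain s t where st: "s \<in> ?seg v w" "t \<in> ?seg v w" "Z = ?seg s t" using seg_ex[OF Z(1)] by blast
    have "ble n s t" using \<open>w \<in> Z\<close> st by (auto intro: rtranclp_trans)
    then have "s \<in> Z" using st by auto
    have "least ?L s (Upper ?L {a, b})"
      unfolding least_def
    proof (intro conjI ballI)
      show "Upper ?L {a, b} \<subseteq> carrier ?L" by (auto simp: Upper_def)
      show "s \<in> Upper ?L {a, b}" using mem[OF st(1)] \<open>s \<in> Z\<close> le[OF ab(1)] le[OF ab(2)] st(1) unfolding Upper_def C by auto
      fix u assume u: "u \<in> Upper ?L {a, b}"
      then have uC: "u \<in> ?seg v w" unfolding Upper_def C by simp
      have "ble n a u" "ble n b u" using u le[OF ab(1)] le[OF ab(2)] ab unfolding Upper_def C by auto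
      then have "u \<in> Z" using mem[OF uC] by simp
      then show "s \<sqsubseteq>\<^bsub>?L\<^esub> u" using le[OF st(1)] st by simp
    qed
    then show "\<exists>s. least ?L s (Upper ?L {a, b})" by (rule exI[of _ s])
    obtain Z' where Z': "Z' \<in> \<A>" "\<And>W. W \<in> \<A> \<Longrightarrow> W \<subseteq> Z' \<longleftrightarrow> W \<subseteq> ?seg v a \<and> W \<subseteq> ?seg v b"
      using meet[OF seg_mem[OF v' ab(1)] seg_mem[OF v' ab(2)]] ab by auto
    have mem': "u \<in> Z' \<longleftrightarrow> ble n u a \<and> ble n u b" if u: "u \<in> ?seg v w" for u
      using Z'(2)[OF single[OF u]] u by auto
    have "v \<in> Z'" using mem'[OF v'] ab by auto
    then obtain s' t' where st': "s' \<in> ?seg v w" "t' \<in> ?seg v w" "Z' = ?seg s' t'" using seg_ex[OF Z'(1)] by blast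
    have "ble n s' t'" using \<open>v \<in> Z'\<close> st' by (auto intro: rtranclp_trans)
    then have "t' \<in> Z'" using st' by auto
    have "greatest ?L t' (Lower ?L {a, b})"
      unfolding greatest_def
    proof (intro conjI ballI)
      show "Lower ?L {a, b} \<subseteq> carrier ?L" by (auto simp: Lower_def)
      show "t' \<in> Lower ?L {a, b}" using mem'[OF st'(2)] \<open>t' \<in> Z'\<close> le[OF st'(2)] st'(2) unfolding Lower_def C by auto
      fix u assume u: "u \<in> Lower ?L {a, b}"
      then have uC: "u \<in> ?seg v w" unfolding Lower_def C by simp
      have "ble n u a" "ble n u b" using u le[OF uC] ab unfolding Lower_def C by simp_all
      then have "u \<in> Z'" using mem'[OF uC] by simp
      then show "u \<sqsubseteq>\<^bsub>?L\<^esub> t'" using le[OF uC] st' by simp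
    qed
    then show "\<exists>s. greatest ?L s (Lower ?L {a, b})" by (rule exI[of _ t'])
  qed
qed

text \<open>A crown in the sense of the locale \<open>crown\<close> is isomorphic to the symmetric group on three letters,
so the hypothesis excludes it.\<close>

lemma crown_free_polytopal:
  assumes v: "v permutes {1..n}" and vw: "ble n v w" and no: "\<not> has_two_crown n v w"
  shows "is_polytope_face_lattice (Int_poset n v w)"
proof -
  obtain wb wt wm where wts: "\<forall>x p q y. bcov n x p \<and> bcov n p y \<and> bcov n x q \<and> bcov n q y \<and> p \<noteq> q \<longrightarrow>
    0 < (wb x y :: real) \<and> 0 < (wt x y :: real) \<and> 0 < (wm x p y :: real) \<and> wb x y + wt x y = wm x p y + wm x q y \<and>
    (\<forall>i. wb x y * real (x i) + wt x y * real (y i) = wm x p y * real (p i) + wm x q y * real (q i))"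
    using square_weights[of n] by blast
  interpret crown_free n v w wb wt wm
  proof
    fix x a b c assume c: "crown n x a b c" and vx: "ble n v x" and yw: "ble n (x \<circ> tr a c) w"
    have xy: "ble n x (x \<circ> tr a c)"
      using crown.elements_between[OF c, of x] by (simp add: crown_list_def)
    have "x \<in> \<lbrace>v..w\<rbrace>\<^bsub>bruhat n\<^esub>" "x \<circ> tr a c \<in> \<lbrace>v..w\<rbrace>\<^bsub>bruhat n\<^esub>"
      unfolding bruhat_interval_set[OF v] using vx yw rtranclp_trans[OF vx xy] rtranclp_trans[OF xy yw] by auto
    moreover have "x \<sqsubseteq>\<^bsub>bruhat n\<^esub> x \<circ> tr a c"
      using xy bruhat_le_iff[OF ble_permutes[OF vx v]] by (simp add: bruhat_def)
    ultimately have "has_two_crown n v w" unfolding has_two_crown_def using crown_iso_S3[OF c] by blast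
    then show False using no by blast
  next
    fix x p y q assume "bcov n x p" "bcov n p y" "bcov n x q" "bcov n q y" "p \<noteq> q"
    then show "0 < wb x y \<and> 0 < wt x y \<and> 0 < wm x p y \<and> wb x y + wt x y = wm x p y + wm x q y \<and>
      (\<forall>i. wb x y * real (x i) + wt x y * real (y i) = wm x p y * real (p i) + wm x q y * real (q i))"
      using wts[rule_format, of x p y q] by simp
  qed (rule v)
  obtain G where "biconvex_poset S (\<lessdot>) rk wb wt wm LIN (lab n) (lab n) height G" by (rule biconvex)
  then interpret B: biconvex_poset S "(\<lessdot>)" rk wb wt wm LIN "lab n" "lab n" height G .
  have vS: "v \<in> S" "w \<in> S" using vw by (auto simp: S_def)
  have seg: "B.interval x y = \<lbrace>x..y\<rbrace>\<^bsub>bruhat n\<^esub>" if xy: "x \<in> S" "y \<in> S" for x y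
    unfolding bruhat_interval_set[OF S_permutes[OF xy(1)]]
  proof (intro Collect_cong iffI conjI)
    fix u assume u: "(\<lessdot>)\<^sup>*\<^sup>* x u \<and> (\<lessdot>)\<^sup>*\<^sup>* u y"
    have "u \<in> S" using L.le_S u xy(2) by blast
    then show "ble n x u" "ble n u y" using u cv_le_iff xy by blast+
  next
    fix u assume u: "ble n x u \<and> ble n u y"
    then have "u \<in> S" using S_between xy by blast
    then show "(\<lessdot>)\<^sup>*\<^sup>* x u" "(\<lessdot>)\<^sup>*\<^sup>* u y" using u cv_le_iff xy by blast+
  qed
  have S_eq: "B.interval v w = S" unfolding seg[OF vS] bruhat_interval_set[OF v] S_def ..
  have le: "(\<lessdot>)\<^sup>*\<^sup>* x y \<longleftrightarrow> x \<sqsubseteq>\<^bsub>bruhat n\<^esub> y" if "x \<in> S" "y \<in> S" for x y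
    using cv_le_iff[OF that] bruhat_le_iff[OF S_permutes[OF that(1)]] by (simp add: bruhat_def)
  have "{B.interval x y |x y. x \<in> S \<and> y \<in> S \<and> (\<lessdot>)\<^sup>*\<^sup>* x y} = {\<lbrace>x..y\<rbrace>\<^bsub>bruhat n\<^esub> |x y. x \<in> S \<and> y \<in> S \<and> x \<sqsubseteq>\<^bsub>bruhat n\<^esub> y}"
  proof (intro Collect_cong ex_cong1)
    show "Z = B.interval x y \<and> x \<in> S \<and> y \<in> S \<and> (\<lessdot>)\<^sup>*\<^sup>* x y
      \<longleftrightarrow> Z = \<lbrace>x..y\<rbrace>\<^bsub>bruhat n\<^esub> \<and> x \<in> S \<and> y \<in> S \<and> x \<sqsubseteq>\<^bsub>bruhat n\<^esub> y" for Z x y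
    proof (cases "x \<in> S \<and> y \<in> S")
      case True then show ?thesis by (simp only: seg le)
    qed blast
  qed
  moreover have "(\<lessdot>)\<^sup>*\<^sup>* v w" using cv_le_iff[OF vS] vw by simp
  ultimately show ?thesis
    using B.interval_lattice_polytopal[of v w] unfolding Int_poset_def seg[OF vS, symmetric] S_eq by simp
qed

theorem corollary1p4:
  fixes n :: nat and v w :: "nat \<Rightarrow> nat"
  assumes "v \<in> carrier (bruhat n)" and "w \<in> carrier (bruhat n)"
    and "v \<sqsubseteq>\<^bsub>bruhat n\<^esub> w"
  shows "(is_polytope_face_lattice (Int_poset n v w) \<longleftrightarrow> \<not> has_two_crown n v w) \<and>
         (\<not> has_two_crown n v w \<longleftrightarrow> lattice (bruhat_interval n v w))"
proof -
  have v: "v permutes {1..n}" using assms(1) by (simp add: bruhat_def)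
  have "ble n v w" using assms(3) bruhat_le_iff[OF v] by (simp add: bruhat_def)
  then show ?thesis using lattice_no_crown[OF v] polytopal_lattice[OF v] crown_free_polytopal[OF v] by blast
qed

end
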